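(* Let $\mathbf{k}$ be a field of characteristic zero, $V$ a finite-dimensional $\mathbf{k}$-vector space with basis $e_1,\dots,e_n$, and $R\in\operatorname{End}(V\otimes V)$ a unitary solution of the quantum Yang–Baxter equation. Let $SR_m\subset\operatorname{End}(V^{\otimes m})$ be the image of the $R$-symmetric action of $S_m$ (the subalgebra generated by the elements $\tau_{(b,b+1)}R^{b,b+1}$), and let $HR_m\subset\operatorname{End}(V^{\otimes m})$ be the span of the maps $(\mathrm{id}\otimes\phi)\circ\Delta$, where $\Delta:V^{\otimes m}\to V^{\otimes m}\otimes H_R$ is the comodule action and $\phi:H_R\to\mathbf{k}$ is any linear map. Then $$\operatorname{End}_{SR_m}(V^{\otimes m})=HR_m,\qquad \operatorname{End}_{HR_m}(V^{\otimes m})=SR_m,\qquad V^{\otimes m}\cong\bigoplus_{\lambda}\rho_{\lambda,S_m}\otimes\rho_{\lambda,H_R},$$ where $\lambda$ runs over Young diagrams (partitions of $m$) parametrizing the irreducible representations $\rho_{\lambda,S_m}$ of $S_m$, and $\rho_{\lambda,H_R}:=c_\lambda(R)V^{\otimes m}$ is an $H_R$-subcomodule of $V^{\otimes m}$, with $c_\lambda\in\mathbf{k}[S_m]$ the Young symmetrizer of $\lambda$ and $c_\lambda(R)\in\operatorname{End}(V^{\otimes m})$ its image under the $R$-permutation action. Furthermore, $\rho_{\lambda,H_R}$ is an irreducible $H_R$-comodule, and this is the multiplicity-free decomposition of $V^{\otimes m}$ into irreducible $SR_m\otimes HR_m$-modules.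
   Context: $R^{ij}$ denotes $R$ acting on tensor factors $i,j$; $\tau_\sigma$ denotes the standard action of $\sigma\in S_m$ on $V^{\otimes m}$ by permuting factors. Unitary: $R^{21}R=\mathrm{Id}$, where $R^{21}=\tau_{(12)}R\tau_{(12)}$. QYBE: $R^{12}R^{13}R^{23}=R^{23}R^{13}R^{12}$. The $R$-permutation action of $S_m$ on $V^{\otimes m}$ is given on simple transpositions by $(b,b+1)*_R v:=\tau_{(b,b+1)}R^{b,b+1}v$. $H_R$ (Faddeev–Reshetikhin–Takhtajan bialgebra): let $F=\mathbf{k}\langle L_{ij}\rangle_{1\le i,j\le n}$ be the free algebra, $L=\sum_{i,j}e_{ij}\otimes L_{ij}\in\operatorname{End}(V)\otimes F$ ($e_{ij}$ matrix units), $L^{13}=\sum e_{ij}\otimes1\otimes L_{ij}$, $L^{23}=\sum 1\otimes e_{ij}\otimes L_{ij}$, $R^{12}=R\otimes1$; then $H_R=F/I_R$ where $I_R$ is the ideal generated by the entries of $R^{12}L^{13}L^{23}-L^{23}L^{13}R^{12}\in\operatorname{End}(V)\otimes\operatorname{End}(V)\otimes F$, with coproduct $\Delta(L_{ij})=\sum_k L_{ik}\otimes L_{kj}$ and counit $\epsilon(L_{ij})=\delta_{ij}$. $V$ is an $H_R$-comodule via $e_j\mapsto\sum_i e_i\otimes L_{ij}$, and $V^{\otimes m}$ is its tensor power comodule: $e_{j_1}\otimes\cdots\otimes e_{j_m}\mapsto\sum_{i_1,\dots,i_m}e_{i_1}\otimes\cdots\otimes e_{i_m}\otimes L_{i_1j_1}\cdots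 L_{i_mj_m}$.
   Formalization: Irreducibility of ρ_{λ,H_R}, and irreducibility and pairwise non-isomorphism of the summands, are stated only for those λ with c_λ(R)V^{⊗m} nonzero; it can vanish, e.g. for R = Id, n = 1, m = 2, λ = (1,1). *)

theory Defs
  imports "HOL-Library.Poly_Mapping" "HOL-Combinatorics.Combinatorics"
begin

section \<open>Coordinates: V has basis indexed by a finite type 'i; V^{\<otimes>m} has basis indexed by length-m lists\<close>

definition tidx :: "nat \<Rightarrow> 'i list set" where
  "tidx m = {I. length I = m}"

definition vecs :: "nat \<Rightarrow> ('i list \<Rightarrow> 'k::zero) set" where
  "vecs m = {v. \<forall>I. length I \<noteq> m \<longrightarrow> v I = 0}"

text \<open>Endomorphisms of V^{\<otimes>m}: matrices A (I,J) (column J = image of basis vector e_J), zero elsewhere.\<close>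
definition mats :: "nat \<Rightarrow> ('i list \<times> 'i list \<Rightarrow> 'k::zero) set" where
  "mats m = {A. \<forall>I J. (length I \<noteq> m \<or> length J \<noteq> m) \<longrightarrow> A (I,J) = 0}"

definition mmul :: "nat \<Rightarrow> ('i::finite list \<times> 'i list \<Rightarrow> 'k::comm_ring_1)
    \<Rightarrow> ('i list \<times> 'i list \<Rightarrow> 'k) \<Rightarrow> ('i list \<times> 'i list \<Rightarrow> 'k)" where
  "mmul m A B = (\<lambda>(I,J). \<Sum>K\<in>tidx m. A (I,K) * B (K,J))"

definition mid :: "nat \<Rightarrow> ('i list \<times> 'i list \<Rightarrow> 'k::comm_ring_1)" where
  "mid m = (\<lambda>(I,J). if I = J \<and> length I = m then 1 else 0)"

definition mapp :: "nat \<Rightarrow> ('i::finite list \<times> 'i list \<Rightarrow> 'k::comm_ring_1) \<Rightarrow> ('i list \<Rightarrow> 'k) \<Rightarrow> ('i list \<Rightarrow> 'k)" where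
  "mapp m A v = (\<lambda>I. if length I = m then \<Sum>J\<in>tidx m. A (I,J) * v J else 0)"

inductive_set kspan :: "('a \<Rightarrow> 'k::field) set \<Rightarrow> ('a \<Rightarrow> 'k) set" for S where
  kspan_zero: "(\<lambda>_. 0) \<in> kspan S"
| kspan_step: "s \<in> S \<Longrightarrow> v \<in> kspan S \<Longrightarrow> (\<lambda>x. c * s x + v x) \<in> kspan S"

definition ksubspace :: "('a \<Rightarrow> 'k::field) set \<Rightarrow> bool" where
  "ksubspace U \<longleftrightarrow> (\<lambda>_. 0) \<in> U \<and> (\<forall>u\<in>U. \<forall>v\<in>U. (\<lambda>x. u x + v x) \<in> U)
      \<and> (\<forall>c. \<forall>u\<in>U. (\<lambda>x. c * u x) \<in> U)"

definition klinear_on :: "('a \<Rightarrow> 'k::field) set \<Rightarrow> (('a \<Rightarrow> 'k) \<Rightarrow> ('b \<Rightarrow> 'k)) \<Rightarrow> bool" where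
  "klinear_on D T \<longleftrightarrow> (\<forall>f\<in>D. \<forall>g\<in>D. T (\<lambda>x. f x + g x) = (\<lambda>y. T f y + T g y))
      \<and> (\<forall>c. \<forall>f\<in>D. T (\<lambda>x. c * f x) = (\<lambda>y. c * T f y))"

text \<open>Tensor product of two coordinate subspaces U \<subseteq> k^A, X \<subseteq> k^B, realised inside k^(A\<times>B).\<close>
definition ktensor :: "('a \<Rightarrow> 'k::field) set \<Rightarrow> ('b \<Rightarrow> 'k) set \<Rightarrow> ('a \<times> 'b \<Rightarrow> 'k) set" where
  "ktensor U X = kspan {(\<lambda>(a,b). y a * w b) | y w. y \<in> U \<and> w \<in> X}"

text \<open>R \<in> End(V\<otimes>V) as matrix: R(e_c \<otimes> e_d) = \<Sum> R((a,b),(c,d)) e_a \<otimes> e_b.\<close>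

definition tmul :: "('a::finite \<times> 'a \<Rightarrow> 'k::comm_ring_1) \<Rightarrow> ('a \<times> 'a \<Rightarrow> 'k) \<Rightarrow> ('a \<times> 'a \<Rightarrow> 'k)" where
  "tmul X Y = (\<lambda>(x,z). \<Sum>y\<in>UNIV. X (x,y) * Y (y,z))"

definition tid :: "'a \<times> 'a \<Rightarrow> 'k::comm_ring_1" where
  "tid = (\<lambda>(x,y). if x = y then 1 else 0)"

definition R21 :: "(('i \<times> 'i) \<times> ('i \<times> 'i) \<Rightarrow> 'k) \<Rightarrow> (('i \<times> 'i) \<times> ('i \<times> 'i) \<Rightarrow> 'k)" where
  "R21 R = (\<lambda>((a,b),(c,d)). R ((b,a),(d,c)))"

definition unitary_R :: "(('i::finite \<times> 'i) \<times> ('i \<times> 'i) \<Rightarrow> 'k::comm_ring_1) \<Rightarrow> bool" where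
  "unitary_R R \<longleftrightarrow> tmul (R21 R) R = tid"

definition R12 :: "(('i \<times> 'i) \<times> ('i \<times> 'i) \<Rightarrow> 'k::zero) \<Rightarrow> (('i \<times> 'i \<times> 'i) \<times> ('i \<times> 'i \<times> 'i) \<Rightarrow> 'k)" where
  "R12 R = (\<lambda>((a,b,c),(a',b',c')). if c = c' then R ((a,b),(a',b')) else 0)"
definition R13 :: "(('i \<times> 'i) \<times> ('i \<times> 'i) \<Rightarrow> 'k::zero) \<Rightarrow> (('i \<times> 'i \<times> 'i) \<times> ('i \<times> 'i \<times> 'i) \<Rightarrow> 'k)" where
  "R13 R = (\<lambda>((a,b,c),(a',b',c')). if b = b' then R ((a,c),(a',c')) else 0)"
definition R23 :: "(('i \<times> 'i) \<times> ('i \<times> 'i) \<Rightarrow> 'k::zero) \<Rightarrow> (('i \<times> 'i \<times> 'i) \<times> ('i \<times> 'i \<times> 'i) \<Rightarrow> 'k)" where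
  "R23 R = (\<lambda>((a,b,c),(a',b',c')). if a = a' then R ((b,c),(b',c')) else 0)"

definition QYBE :: "(('i::finite \<times> 'i) \<times> ('i \<times> 'i) \<Rightarrow> 'k::comm_ring_1) \<Rightarrow> bool" where
  "QYBE R \<longleftrightarrow> tmul (tmul (R12 R) (R13 R)) (R23 R) = tmul (tmul (R23 R) (R13 R)) (R12 R)"

definition Rpos :: "nat \<Rightarrow> (('i \<times> 'i) \<times> ('i \<times> 'i) \<Rightarrow> 'k::zero) \<Rightarrow> nat \<Rightarrow> ('i list \<times> 'i list \<Rightarrow> 'k)" where
  "Rpos m R b = (\<lambda>(I,J). if length I = m \<and> length J = m \<and> (\<forall>k<m. k \<noteq> b \<and> k \<noteq> Suc b \<longrightarrow> I!k = J!k)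
      then R ((I!b, I!Suc b), (J!b, J!Suc b)) else 0)"

definition tswap :: "nat \<Rightarrow> nat \<Rightarrow> ('i list \<times> 'i list \<Rightarrow> 'k::{zero,one})" where
  "tswap m b = (\<lambda>(I,J). if length I = m \<and> length J = m \<and> I = J[b := J!Suc b, Suc b := J!b] then 1 else 0)"

definition sgen :: "nat \<Rightarrow> (('i::finite \<times> 'i) \<times> ('i \<times> 'i) \<Rightarrow> 'k::comm_ring_1) \<Rightarrow> nat \<Rightarrow> ('i list \<times> 'i list \<Rightarrow> 'k)" where
  "sgen m R b = mmul m (tswap m b) (Rpos m R b)"

fun word_perm :: "nat list \<Rightarrow> nat \<Rightarrow> nat" where
  "word_perm [] = id"
| "word_perm (b # ws) = transpose b (Suc b) \<circ> word_perm ws"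

fun word_mat :: "nat \<Rightarrow> (('i::finite \<times> 'i) \<times> ('i \<times> 'i) \<Rightarrow> 'k::comm_ring_1) \<Rightarrow> nat list \<Rightarrow> ('i list \<times> 'i list \<Rightarrow> 'k)" where
  "word_mat m R [] = mid m"
| "word_mat m R (b # ws) = mmul m (sgen m R b) (word_mat m R ws)"

text \<open>Action of an arbitrary permutation \<sigma> of {0..<m}: product of the generators along some
  word in the simple transpositions representing \<sigma> (well defined by unitarity + QYBE).\<close>
definition Ract :: "nat \<Rightarrow> (('i::finite \<times> 'i) \<times> ('i \<times> 'i) \<Rightarrow> 'k::comm_ring_1) \<Rightarrow> (nat \<Rightarrow> nat) \<Rightarrow> ('i list \<times> 'i list \<Rightarrow> 'k)" where
  "Ract m R \<sigma> = word_mat m R (SOME ws. (\<forall>b\<in>set ws. Suc b < m) \<and> word_perm ws = \<sigma>)"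

inductive_set SRm :: "nat \<Rightarrow> (('i::finite \<times> 'i) \<times> ('i \<times> 'i) \<Rightarrow> 'k::field) \<Rightarrow> ('i list \<times> 'i list \<Rightarrow> 'k) set"
  for m R where
  SR_id: "mid m \<in> SRm m R"
| SR_gen: "Suc b < m \<Longrightarrow> sgen m R b \<in> SRm m R"
| SR_add: "A \<in> SRm m R \<Longrightarrow> B \<in> SRm m R \<Longrightarrow> (\<lambda>x. A x + B x) \<in> SRm m R"
| SR_scal: "A \<in> SRm m R \<Longrightarrow> (\<lambda>x. c * A x) \<in> SRm m R"
| SR_mul: "A \<in> SRm m R \<Longrightarrow> B \<in> SRm m R \<Longrightarrow> mmul m A B \<in> SRm m R"

definition galg :: "nat \<Rightarrow> ((nat \<Rightarrow> nat) \<Rightarrow> 'k::zero) set" where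
  "galg m = {x. \<forall>\<sigma>. \<not> \<sigma> permutes {..<m} \<longrightarrow> x \<sigma> = 0}"

definition gmul :: "nat \<Rightarrow> ((nat \<Rightarrow> nat) \<Rightarrow> 'k::comm_ring_1) \<Rightarrow> ((nat \<Rightarrow> nat) \<Rightarrow> 'k) \<Rightarrow> ((nat \<Rightarrow> nat) \<Rightarrow> 'k)" where
  "gmul m x y = (\<lambda>\<sigma>. \<Sum>\<pi>\<in>{\<pi>. \<pi> permutes {..<m}}. x \<pi> * y (inv \<pi> \<circ> \<sigma>))"

definition grep :: "nat \<Rightarrow> (('i::finite \<times> 'i) \<times> ('i \<times> 'i) \<Rightarrow> 'k::comm_ring_1) \<Rightarrow> ((nat \<Rightarrow> nat) \<Rightarrow> 'k) \<Rightarrow> ('i list \<times> 'i list \<Rightarrow> 'k)" where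
  "grep m R x = (\<lambda>IJ. \<Sum>\<sigma>\<in>{\<sigma>. \<sigma> permutes {..<m}}. x \<sigma> * Ract m R \<sigma> IJ)"

definition is_partition :: "nat \<Rightarrow> nat list \<Rightarrow> bool" where
  "is_partition m p \<longleftrightarrow> sum_list p = m \<and> 0 \<notin> set p \<and> (\<forall>i. Suc i < length p \<longrightarrow> p ! Suc i \<le> p ! i)"

text \<open>Canonical Young tableau of shape p: numbers 0..m-1 filled row by row.\<close>
definition rowof :: "nat list \<Rightarrow> nat \<Rightarrow> nat" where
  "rowof p k = (LEAST r. k < sum_list (take (Suc r) p))"
definition colof :: "nat list \<Rightarrow> nat \<Rightarrow> nat" where
  "colof p k = k - sum_list (take (rowof p k) p)"

definition row_group :: "nat \<Rightarrow> nat list \<Rightarrow> (nat \<Rightarrow> nat) set" where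
  "row_group m p = {\<sigma>. \<sigma> permutes {..<m} \<and> (\<forall>k<m. rowof p (\<sigma> k) = rowof p k)}"
definition col_group :: "nat \<Rightarrow> nat list \<Rightarrow> (nat \<Rightarrow> nat) set" where
  "col_group m p = {\<sigma>. \<sigma> permutes {..<m} \<and> (\<forall>k<m. colof p (\<sigma> k) = colof p k)}"

definition young_sym :: "nat \<Rightarrow> nat list \<Rightarrow> ((nat \<Rightarrow> nat) \<Rightarrow> 'k::comm_ring_1)" where
  "young_sym m p = (\<lambda>\<sigma>. \<Sum>r\<in>row_group m p. \<Sum>q\<in>col_group m p. if r \<circ> q = \<sigma> then of_int (sign q) else 0)"

definition specht :: "nat \<Rightarrow> nat list \<Rightarrow> ((nat \<Rightarrow> nat) \<Rightarrow> 'k::comm_ring_1) set" where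
  "specht m p = {gmul m x (young_sym m p) | x. x \<in> galg m}"

definition rhoH :: "nat \<Rightarrow> (('i::finite \<times> 'i) \<times> ('i \<times> 'i) \<Rightarrow> 'k::comm_ring_1) \<Rightarrow> nat list \<Rightarrow> ('i list \<Rightarrow> 'k) set" where
  "rhoH m R p = {mapp m (grep m R (young_sym m p)) v | v. v \<in> vecs m}"

text \<open>Free algebra F = k<L_ij>: finitely supported functions on words in the letters (i,j).\<close>
definition fmul :: "(('i \<times> 'i) list \<Rightarrow>\<^sub>0 'k::comm_ring_1) \<Rightarrow> (('i \<times> 'i) list \<Rightarrow>\<^sub>0 'k) \<Rightarrow> (('i \<times> 'i) list \<Rightarrow>\<^sub>0 'k)" where
  "fmul p q = (\<Sum>u\<in>Poly_Mapping.keys p. \<Sum>v\<in>Poly_Mapping.keys q. Poly_Mapping.single (u @ v) (Poly_Mapping.lookup p u * Poly_Mapping.lookup q v))"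

definition fscal :: "'k::comm_ring_1 \<Rightarrow> (('i \<times> 'i) list \<Rightarrow>\<^sub>0 'k) \<Rightarrow> (('i \<times> 'i) list \<Rightarrow>\<^sub>0 'k)" where
  "fscal c p = fmul (Poly_Mapping.single [] c) p"

definition Lgen :: "'i \<Rightarrow> 'i \<Rightarrow> (('i \<times> 'i) list \<Rightarrow>\<^sub>0 'k::comm_ring_1)" where
  "Lgen i j = Poly_Mapping.single [(i,j)] 1"

definition Lword :: "'i list \<Rightarrow> 'i list \<Rightarrow> (('i \<times> 'i) list \<Rightarrow>\<^sub>0 'k::comm_ring_1)" where
  "Lword I J = foldr fmul (map2 Lgen I J) (Poly_Mapping.single [] 1)"

text \<open>Entry ((a,b),(c,d)) of R^{12}L^{13}L^{23} - L^{23}L^{13}R^{12}.\<close>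
definition frt_rel :: "(('i::finite \<times> 'i) \<times> ('i \<times> 'i) \<Rightarrow> 'k::comm_ring_1) \<Rightarrow> ('i \<times> 'i) \<times> ('i \<times> 'i) \<Rightarrow> (('i \<times> 'i) list \<Rightarrow>\<^sub>0 'k)" where
  "frt_rel R = (\<lambda>((a,b),(c,d)).
     (\<Sum>p\<in>UNIV. \<Sum>q\<in>UNIV. fscal (R ((a,b),(p,q))) (fmul (Lgen p c) (Lgen q d)))
   - (\<Sum>p\<in>UNIV. \<Sum>q\<in>UNIV. fscal (R ((p,q),(c,d))) (fmul (Lgen b q) (Lgen a p))))"

inductive_set fideal :: "(('i \<times> 'i) list \<Rightarrow>\<^sub>0 'k::comm_ring_1) set \<Rightarrow> (('i \<times> 'i) list \<Rightarrow>\<^sub>0 'k) set" for G where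
  fid_gen: "g \<in> G \<Longrightarrow> g \<in> fideal G"
| fid_zero: "0 \<in> fideal G"
| fid_add: "p \<in> fideal G \<Longrightarrow> q \<in> fideal G \<Longrightarrow> p + q \<in> fideal G"
| fid_lmul: "p \<in> fideal G \<Longrightarrow> fmul a p \<in> fideal G"
| fid_rmul: "p \<in> fideal G \<Longrightarrow> fmul p a \<in> fideal G"

definition IR :: "(('i::finite \<times> 'i) \<times> ('i \<times> 'i) \<Rightarrow> 'k::comm_ring_1) \<Rightarrow> (('i \<times> 'i) list \<Rightarrow>\<^sub>0 'k) set" where
  "IR R = fideal (range (frt_rel R))"

text \<open>Linear functionals \<phi> : H_R \<rightarrow> k, represented by \<psi> = \<phi> \<circ> (F \<rightarrow> F/I_R), i.e. linear \<psi> on F vanishing on I_R.\<close>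
definition HR_functional :: "(('i::finite \<times> 'i) \<times> ('i \<times> 'i) \<Rightarrow> 'k::comm_ring_1) \<Rightarrow> ((('i \<times> 'i) list \<Rightarrow>\<^sub>0 'k) \<Rightarrow> 'k) \<Rightarrow> bool" where
  "HR_functional R \<psi> \<longleftrightarrow> (\<forall>p q. \<psi> (p + q) = \<psi> p + \<psi> q) \<and> (\<forall>c p. \<psi> (fscal c p) = c * \<psi> p)
     \<and> (\<forall>p\<in>IR R. \<psi> p = 0)"

text \<open>(id \<otimes> \<phi>) \<circ> \<Delta> on V^{\<otimes>m}, where \<Delta>(e_J) = \<Sum>_I e_I \<otimes> L_{IJ}.\<close>
definition hrmap :: "nat \<Rightarrow> ((('i \<times> 'i) list \<Rightarrow>\<^sub>0 'k::comm_ring_1) \<Rightarrow> 'k) \<Rightarrow> ('i list \<times> 'i list \<Rightarrow> 'k)" where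
  "hrmap m \<psi> = (\<lambda>(I,J). if length I = m \<and> length J = m then \<psi> (Lword I J) else 0)"

definition HRm :: "nat \<Rightarrow> (('i::finite \<times> 'i) \<times> ('i \<times> 'i) \<Rightarrow> 'k::field) \<Rightarrow> ('i list \<times> 'i list \<Rightarrow> 'k) set" where
  "HRm m R = kspan {hrmap m \<psi> | \<psi>. HR_functional R \<psi>}"

definition commutant :: "nat \<Rightarrow> ('i::finite list \<times> 'i list \<Rightarrow> 'k::comm_ring_1) set \<Rightarrow> ('i list \<times> 'i list \<Rightarrow> 'k) set" where
  "commutant m S = {A \<in> mats m. \<forall>B\<in>S. mmul m A B = mmul m B A}"

text \<open>H_R-subcomodules of V^{\<otimes>m}: subspaces W with \<Delta>(W) \<subseteq> W \<otimes> H_R, where an element of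
  V^{\<otimes>m} \<otimes> H_R is a family (indexed by I) of elements of F/I_R.\<close>
definition subcomodule :: "nat \<Rightarrow> (('i::finite \<times> 'i) \<times> ('i \<times> 'i) \<Rightarrow> 'k::field) \<Rightarrow> ('i list \<Rightarrow> 'k) set \<Rightarrow> bool" where
  "subcomodule m R W \<longleftrightarrow> W \<subseteq> vecs m \<and> ksubspace W \<and>
     (\<forall>w\<in>W. \<exists>ws hs. length ws = length hs \<and> set ws \<subseteq> W \<and>
        (\<forall>I\<in>tidx m. (\<Sum>J\<in>tidx m. fscal (w J) (Lword I J)) - (\<Sum>k<length ws. fscal ((ws!k) I) (hs!k)) \<in> IR R))"

definition irreducible_comodule :: "nat \<Rightarrow> (('i::finite \<times> 'i) \<times> ('i \<times> 'i) \<Rightarrow> 'k::field) \<Rightarrow> ('i list \<Rightarrow> 'k) set \<Rightarrow> bool" where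
  "irreducible_comodule m R W \<longleftrightarrow> subcomodule m R W \<and> W \<noteq> {\<lambda>_. 0} \<and>
     (\<forall>U. subcomodule m R U \<and> U \<subseteq> W \<longrightarrow> U = {\<lambda>_. 0} \<or> U = W)"

definition dsum :: "nat \<Rightarrow> (('i::finite \<times> 'i) \<times> ('i \<times> 'i) \<Rightarrow> 'k::field) \<Rightarrow> (nat list \<times> (nat \<Rightarrow> nat) \<times> 'i list \<Rightarrow> 'k) set" where
  "dsum m R = {f. \<forall>p. (is_partition m p \<longrightarrow> (\<lambda>(\<pi>,I). f (p,\<pi>,I)) \<in> ktensor (specht m p) (rhoH m R p))
                    \<and> (\<not> is_partition m p \<longrightarrow> (\<forall>\<pi> I. f (p,\<pi>,I) = 0))}"

definition dsum_comp :: "nat \<Rightarrow> (('i::finite \<times> 'i) \<times> ('i \<times> 'i) \<Rightarrow> 'k::field) \<Rightarrow> nat list \<Rightarrow> (nat list \<times> (nat \<Rightarrow> nat) \<times> 'i list \<Rightarrow> 'k) set" where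
  "dsum_comp m R p = {f \<in> dsum m R. \<forall>p' \<pi> I. p' \<noteq> p \<longrightarrow> f (p',\<pi>,I) = 0}"

text \<open>S_m acts on the first tensor factor (left multiplication in k[S_m]).\<close>
definition sact :: "(nat \<Rightarrow> nat) \<Rightarrow> (nat list \<times> (nat \<Rightarrow> nat) \<times> 'i list \<Rightarrow> 'k) \<Rightarrow> (nat list \<times> (nat \<Rightarrow> nat) \<times> 'i list \<Rightarrow> 'k)" where
  "sact \<sigma> f = (\<lambda>(p,\<pi>,I). f (p, inv \<sigma> \<circ> \<pi>, I))"

definition hact :: "nat \<Rightarrow> ('i::finite list \<times> 'i list \<Rightarrow> 'k::comm_ring_1) \<Rightarrow> (nat list \<times> (nat \<Rightarrow> nat) \<times> 'i list \<Rightarrow> 'k) \<Rightarrow> (nat list \<times> (nat \<Rightarrow> nat) \<times> 'i list \<Rightarrow> 'k)" where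
  "hact m h f = (\<lambda>(p,\<pi>,I). \<Sum>J\<in>tidx m. h (I,J) * f (p,\<pi>,J))"

definition invariant_under :: "nat \<Rightarrow> ('i::finite list \<times> 'i list \<Rightarrow> 'k::comm_ring_1) set \<Rightarrow> ('i list \<Rightarrow> 'k) set \<Rightarrow> bool" where
  "invariant_under m Ms U \<longleftrightarrow> (\<forall>A\<in>Ms. \<forall>u\<in>U. mapp m A u \<in> U)"

text \<open>Irreducible as a module over SR_m \<otimes> HR_m (acting on V^{\<otimes>m}).\<close>
definition irreducible_SH :: "nat \<Rightarrow> (('i::finite \<times> 'i) \<times> ('i \<times> 'i) \<Rightarrow> 'k::field) \<Rightarrow> ('i list \<Rightarrow> 'k) set \<Rightarrow> bool" where
  "irreducible_SH m R W \<longleftrightarrow> ksubspace W \<and> W \<noteq> {\<lambda>_. 0} \<and> invariant_under m (SRm m R \<union> HRm m R) W \<and>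
     (\<forall>U. ksubspace U \<and> U \<subseteq> W \<and> invariant_under m (SRm m R \<union> HRm m R) U \<longrightarrow> U = {\<lambda>_. 0} \<or> U = W)"

definition iso_SH :: "nat \<Rightarrow> (('i::finite \<times> 'i) \<times> ('i \<times> 'i) \<Rightarrow> 'k::field) \<Rightarrow> ('i list \<Rightarrow> 'k) set \<Rightarrow> ('i list \<Rightarrow> 'k) set \<Rightarrow> bool" where
  "iso_SH m R W W' \<longleftrightarrow> (\<exists>T. bij_betw T W W' \<and> klinear_on W T \<and>
     (\<forall>A\<in>SRm m R \<union> HRm m R. \<forall>w\<in>W. T (mapp m A w) = mapp m A (T w)))"

end

(*
  Write s_b for the operator tau R in positions b, b+1. The defining relations of H_R say exactly
  that the matrix of a functional on the degree m part of H_R commutes with every s_b, so HR_m is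
  the commutant of SR_m. Unitarity and the Yang-Baxter equation are the Coxeter relations for the
  s_b, so the tensor power W is a k[S_m]-module.

  The rest is explicit computation with Young symmetrizers c = c_p. One has c x c = alpha(x) c,
  c_p x c_q = 0 for p <> q, and c c = n c with n <> 0. The elements z_p = sum_g g c_p g^-1 are
  central with z_p c_q = 0 for p <> q and z_p c_p = n^2 c_p; hence they are linearly independent, and
  since there are at most as many cycle types as partitions, 1 = sum_p A_p z_p for some A_p.

  For u, w in c W and a coordinate I0, the averaged rank one operator
  h = sum_g g^-1 (w (x) e_I0^* ) g lies in HR_m and satisfies h u = n u(I0) w. This gives the
  irreducibility of c W. It also gives the double commutant: if T commutes with all such h, then
  n u(I0) T g w = h (T g u), and the right-hand side is an element of k[S_m], independent of w,
  applied to w; now sum over g and p using 1 = sum_p A_p sum_g g c_p g^-1.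

  The isomorphism sends y (x) w to y w. Its inverse is read off from
  c_q g^-1 y w = n^2 y(g) w if p = q, and 0 otherwise, for y in k[S_m] c_p and w in c_p W.
*)
theory Submission
  imports Defs "HOL-Library.Function_Algebras"
begin

section \<open>The Coxeter presentation of the symmetric group\<close>

text \<open>Over a field known only to have characteristic zero, every scalar is computed
  explicitly, and one device does it: the coefficient at the identity is a trace on k[S_m], and
  c(id) = 1. Hence alpha(x) = (c x c)(id) = (c c x)(id) = n (c x)(id). This is the origin of the
  powers of n in z_p c_p, in h u = n u(I0) w and in the inverse of the decomposition map.

  The rule c x c = alpha(x) c is combinatorial: a function that is invariant under row permutations
  on the left and changes by the sign under column permutations on the right vanishes wherever two
  entries share a row and a column, and elsewhere is determined by its value at id. That n <> 0 is a
  positivity statement, so it is proved over the integers and carried into k.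

  The action \<open>Ract\<close> picks an arbitrary word for each permutation. For it to be
  multiplicative, the Coxeter relations must hold for the s_b and must also account for every
  coincidence between words; the latter is the word problem solved below.

  Some c_p W may be zero; this is why irreducibility is claimed only for nonzero ones.\<close>

inductive weq :: "nat \<Rightarrow> nat list \<Rightarrow> nat list \<Rightarrow> bool" for m where
  weq_refl: "weq m u u"
| weq_sym: "weq m u v \<Longrightarrow> weq m v u"
| weq_trans: "weq m u v \<Longrightarrow> weq m v w \<Longrightarrow> weq m u w"
| weq_sq: "Suc b < m \<Longrightarrow> weq m (u @ [b, b] @ v) (u @ v)"
| weq_comm: "Suc b < c \<Longrightarrow> Suc c < m \<Longrightarrow> weq m (u @ [b, c] @ v) (u @ [c, b] @ v)"
| weq_braid: "Suc (Suc b) < m \<Longrightarrow> weq m (u @ [b, Suc b, b] @ v) (u @ [Suc b, b, Suc b] @ v)"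

lemma weq_context: "weq m u v \<Longrightarrow> weq m (x @ u @ y) (x @ v @ y)"
proof (induction rule: weq.induct)
  case (weq_sq b u v)
  then show ?case using weq.weq_sq[of b m "x @ u" "v @ y"] by simp
next
  case (weq_comm b c u v)
  then show ?case using weq.weq_comm[of b c m "x @ u" "v @ y"] by simp
next
  case (weq_braid b u v)
  then show ?case using weq.weq_braid[of b m "x @ u" "v @ y"] by simp
qed (rule weq_refl, blast intro: weq_sym, blast intro: weq_trans)

lemma weq_append_left: "weq m u v \<Longrightarrow> weq m (x @ u) (x @ v)"
  using weq_context[of m u v x "[]"] by simp

lemma weq_append_right: "weq m u v \<Longrightarrow> weq m (u @ y) (v @ y)"
  using weq_context[of m u v "[]" y] by simp

lemma weq_move_right:
  "Suc b < m \<Longrightarrow> (\<forall>c\<in>set u. Suc c < m \<and> (Suc b < c \<or> Suc c < b)) \<Longrightarrow> weq m (b # u) (u @ [b])"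
proof (induction u)
  case Nil
  show ?case by (simp add: weq_refl)
next
  case (Cons c u)
  have "weq m ([b, c] @ u) ([c, b] @ u)"
    using Cons.prems weq_comm[of b c m "[]" u] weq_comm[of c b m "[]" u] weq_sym by auto
  moreover have "weq m ([c] @ b # u) ([c] @ u @ [b])"
    using Cons by (intro weq_append_left) auto
  ultimately show ?case using weq_trans[of m "[b, c] @ u"] by simp
qed

definition descent :: "nat \<Rightarrow> nat \<Rightarrow> nat list" where
  "descent n k = rev [k..<n]"

lemma descent_snoc: "k < n \<Longrightarrow> descent n k = descent n (Suc k) @ [k]"
  by (simp add: descent_def upt_conv_Cons)

lemma set_descent: "set (descent n k) = {k..<n}"
  by (simp add: descent_def)

lemma descent_split: "k \<le> j \<Longrightarrow> j \<le> n \<Longrightarrow> descent n k = descent n j @ descent j k"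
  by (metis descent_def rev_append upt_add_eq_append le_add_diff_inverse)

text \<open>The words \<open>descent n k\<close> represent the cosets of \<open>S\<^sub>n\<close> in \<open>S\<^sub>n\<^sub>+\<^sub>1\<close>; appending a generator
  either changes the coset or passes through to the left factor.\<close>
lemma word_normal_form:
  "n < m \<Longrightarrow> \<forall>b\<in>set ws. b < n \<Longrightarrow>
    \<exists>w k. k \<le> n \<and> (\<forall>b\<in>set w. Suc b < n) \<and> weq m ws (w @ descent n k)"
proof (induction ws rule: rev_induct)
  case Nil
  show ?case
    by (rule exI[of _ "[]"], rule exI[of _ n]) (simp add: descent_def weq_refl)
next
  case (snoc b ws)
  then obtain w k where k: "k \<le> n" and w: "\<forall>b\<in>set w. Suc b < n"
    and eq: "weq m ws (w @ descent n k)" by auto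
  have b: "b < n" and bm: "Suc b < m" using snoc.prems by simp_all
  have eq': "weq m (ws @ [b]) (w @ descent n k @ [b])"
    using weq_append_right[OF eq, of "[b]"] by simp
  \<comment> \<open>The letters of \<open>descent n k\<close> run from \<open>n - 1\<close> down to
    \<open>k\<close>. So \<open>b\<close> extends the word, cancels its last letter, commutes with
    all of it, or meets a braid inside it.\<close>
  consider "Suc b = k" | "b = k" | "Suc b < k" | "k < b" by linarith
  then show ?case
  proof cases
    case 1
    then have "descent n k @ [b] = descent n b" using b descent_snoc by auto
    then show ?thesis using eq' w b by (intro exI[of _ w] exI[of _ b]) auto
  next
    case 2
    then have "descent n k @ [b] = descent n (Suc k) @ [b,b] @ []" using b descent_snoc by auto
    then have "weq m (w @ descent n k @ [b]) (w @ descent n (Suc k))"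
      using weq_sq[of b m "w @ descent n (Suc k)" "[]"] bm by simp
    then show ?thesis using weq_trans[OF eq'] w b 2
      by (intro exI[of _ w] exI[of _ "Suc k"]) auto
  next
    case 3
    have "weq m (b # descent n k) (descent n k @ [b])"
      using 3 b bm snoc.prems by (intro weq_move_right) (auto simp: set_descent)
    then have "weq m (w @ b # descent n k) (w @ descent n k @ [b])" by (rule weq_append_left)
    then have "weq m (ws @ [b]) ((w @ [b]) @ descent n k)"
      using weq_trans[OF eq' weq_sym] by simp
    then show ?thesis using w 3 k by (intro exI[of _ "w @ [b]"] exI[of _ k]) auto
  next
    case 4
    then obtain a where a: "b = Suc a" "k \<le> a" by (cases b) auto
    \<comment> \<open>\<open>b\<close> commutes with \<open>?E\<close>, the braid relation turns
      \<open>b a b\<close> into \<open>a b a\<close>, and the leading \<open>a\<close> commutes with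
      \<open>?D\<close>. The appended letter thus leaves on the left as \<open>a\<close>, and the
      descent is unchanged.\<close>
    let ?D = "descent n (Suc b)" and ?E = "descent a k"
    have D: "descent n k = ?D @ [b, a] @ ?E"
      using a b descent_split[of k "Suc b" n] descent_split[of k a "Suc b"]
        descent_snoc[of b n] descent_snoc[of a "Suc b"] descent_snoc[of b "Suc b"]
      by (simp add: descent_def)
    have "weq m (b # ?E) (?E @ [b])"
      using a b bm snoc.prems by (intro weq_move_right) (auto simp: set_descent)
    then have "weq m (descent n k @ [b]) (?D @ [b, a] @ b # ?E)"
      unfolding D using weq_append_left[of m _ _ "?D @ [b, a]"] weq_sym by fastforce
    moreover have "weq m (?D @ [b, a] @ b # ?E) (?D @ [a, b, a] @ ?E)"
      using weq_braid[of a m ?D ?E] a bm weq_sym by simp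
    moreover have "weq m (a # ?D) (?D @ [a])"
      using a b bm snoc.prems by (intro weq_move_right) (auto simp: set_descent)
    then have "weq m (?D @ [a, b, a] @ ?E) (a # ?D @ [b, a] @ ?E)"
      using weq_append_right[of m _ _ "[b, a] @ ?E"] weq_sym by fastforce
    ultimately have "weq m (descent n k @ [b]) (a # ?D @ [b, a] @ ?E)"
      by (rule weq_trans[OF weq_trans])
    then have "weq m (descent n k @ [b]) ([a] @ descent n k)"
      unfolding D by simp
    then have "weq m (w @ descent n k @ [b]) ((w @ [a]) @ descent n k)"
      using weq_append_left[of m _ _ w] by fastforce
    then show ?thesis using weq_trans[OF eq'] w a b k
      by (intro exI[of _ "w @ [a]"] exI[of _ k]) auto
  qed
qed

lemma word_perm_append: "word_perm (u @ v) = word_perm u \<circ> word_perm v"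
  by (induction u) (auto simp: fun_eq_iff)

lemma word_perm_weq: "weq m u v \<Longrightarrow> word_perm u = word_perm v"
proof (induction rule: weq.induct)
  case (weq_comm b c u v)
  then have "transpose b (Suc b) \<circ> transpose c (Suc c) = transpose c (Suc c) \<circ> transpose b (Suc b)"
    by (auto simp: fun_eq_iff transpose_def)
  then show ?case by (simp add: word_perm_append fun_eq_iff)
next
  case (weq_braid b u v)
  have "transpose b (Suc b) \<circ> transpose (Suc b) (Suc (Suc b)) \<circ> transpose b (Suc b) =
    transpose (Suc b) (Suc (Suc b)) \<circ> transpose b (Suc b) \<circ> transpose (Suc b) (Suc (Suc b))"
    by (auto simp: fun_eq_iff transpose_def)
  then show ?case by (simp add: word_perm_append fun_eq_iff)
qed (auto simp: word_perm_append fun_eq_iff)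

lemma word_perm_permutes: "\<forall>b\<in>set ws. Suc b < m \<Longrightarrow> word_perm ws permutes {..<m}"
  by (induction ws) (auto intro!: permutes_compose permutes_swap_id simp: permutes_id[unfolded id_def] id_def)

text \<open>The rightmost letter acts first and raises \<open>k\<close> by one, and each further
  letter raises it again. The index of a normal form can therefore be read off from its
  permutation.\<close>

lemma word_perm_descent: "k \<le> n \<Longrightarrow> word_perm (descent n k) k = n"
proof (induction "n - k" arbitrary: k)
  case 0
  then show ?case by (simp add: descent_def)
next
  case (Suc d)
  then have "word_perm (descent n (Suc k)) (Suc k) = n" by simp
  with Suc show ?case by (simp add: descent_snoc word_perm_append)
qed

lemma bij_word_perm: "bij (word_perm ws)"
proof (induction ws)
  case (Cons b ws)
  then show ?case unfolding word_perm.simps by (intro bij_comp) auto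
qed (simp add: bij_id[unfolded id_def] id_def)

text \<open>The completeness half of the Coxeter presentation. In a normal form the left factor
  fixes \<open>n\<close>, so the index of the descent is the preimage of \<open>n\<close> under the
  permutation. Equal permutations have the same descent; cancelling it leaves left factors to which
  induction applies.\<close>

lemma word_perm_eq_imp_weq:
  "\<lbrakk>n \<le> m; \<forall>b\<in>set u. Suc b < n; \<forall>b\<in>set v. Suc b < n; word_perm u = word_perm v\<rbrakk> \<Longrightarrow> weq m u v"
proof (induction n arbitrary: u v)
  case 0
  then have "u = []" "v = []" by (auto simp: set_empty[symmetric] simp del: set_empty)
  then show ?case by (simp add: weq_refl)
next
  case (Suc n)
  obtain u' k where k: "k \<le> n" "\<forall>b\<in>set u'. Suc b < n" "weq m u (u' @ descent n k)"
    using word_normal_form[of n m u] Suc.prems by auto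
  obtain v' l where l: "l \<le> n" "\<forall>b\<in>set v'. Suc b < n" "weq m v (v' @ descent n l)"
    using word_normal_form[of n m v] Suc.prems by auto
  have eq: "word_perm u' \<circ> word_perm (descent n k) = word_perm v' \<circ> word_perm (descent n l)"
    using k(3) l(3) Suc.prems(4) by (metis word_perm_append word_perm_weq)
  have "word_perm u' n = n" "word_perm v' n = n"
    using word_perm_permutes[OF k(2)] word_perm_permutes[OF l(2)] by (auto simp: permutes_def)
  then have "word_perm u k = n" "word_perm v l = n"
    using word_perm_weq[OF k(3)] word_perm_weq[OF l(3)] word_perm_descent[OF k(1)] word_perm_descent[OF l(1)]
    by (auto simp: word_perm_append)
  then have kl: "k = l" using Suc.prems(4) bij_word_perm[of u] by (metis bij_pointE)
  have "word_perm u' = word_perm v'"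
  proof
    fix x
    obtain y where "x = word_perm (descent n k) y" using bij_word_perm by (metis bij_pointE)
    then show "word_perm u' x = word_perm v' x" using eq kl by (metis comp_apply)
  qed
  then have "weq m u' v'" using Suc.IH Suc.prems(1) k l by simp
  then have "weq m (u' @ descent n k) (v' @ descent n l)" using kl weq_append_right by blast
  then show ?case by (rule weq_trans[OF k(3) weq_trans[OF _ weq_sym[OF l(3)]]])
qed

text \<open>Dividing on the right by the descent that starts at the preimage of \<open>n\<close>
  leaves a permutation fixing \<open>n\<close>: the coset decomposition of the normal form
  again.\<close>

lemma permutes_word_perm:
  "\<sigma> permutes {..<m} \<Longrightarrow> \<exists>ws. (\<forall>b\<in>set ws. Suc b < m) \<and> word_perm ws = \<sigma>"
proof (induction m arbitrary: \<sigma>)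
  case 0
  then show ?case by (auto intro!: exI[of _ "[]"])
next
  case (Suc n)
  define k where "k = inv \<sigma> n"
  have sk: "\<sigma> k = n" using Suc.prems by (simp add: k_def permutes_inverses)
  have kn: "k \<le> n" using Suc.prems sk by (metis lessI lessThan_iff less_Suc_eq_le permutes_in_image)
  let ?d = "word_perm (descent n k)"
  have d: "?d permutes {..<Suc n}"
    by (rule word_perm_permutes) (auto simp: set_descent)
  have *: "\<sigma> \<circ> inv ?d permutes {..<Suc n}"
    using Suc.prems d by (intro permutes_compose permutes_inv)
  have "inv ?d n = k" using word_perm_descent[OF kn] bij_word_perm by (metis bij_inv_eq_iff)
  then have fix_n: "(\<sigma> \<circ> inv ?d) n = n" using sk by simp
  have "\<sigma> \<circ> inv ?d permutes {..<n}"
    by (rule permutes_superset[OF *]) (use fix_n in auto)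
  then obtain w where w: "\<forall>b\<in>set w. Suc b < n" "word_perm w = \<sigma> \<circ> inv ?d" using Suc.IH by blast
  have "word_perm (w @ descent n k) = \<sigma> \<circ> inv ?d \<circ> ?d"
    by (simp add: word_perm_append w)
  also have "\<dots> = \<sigma>" using bij_word_perm[of "descent n k"] by (auto simp: fun_eq_iff bij_is_inj)
  finally show ?case using w by (intro exI[of _ "w @ descent n k"]) (auto simp: set_descent)
qed

section \<open>Local operators on tensor powers\<close>

lemma finite_tidx [simp]: "finite (tidx m :: 'i::finite list set)"
  using finite_lists_length_eq[of "UNIV :: 'i set" m] by (simp add: tidx_def)

lemma mmul_assoc: "mmul m (mmul m A B) C = mmul m A (mmul m B C)"
proof (rule ext, clarify)
  fix I J
  show "mmul m (mmul m A B) C (I, J) = mmul m A (mmul m B C) (I, J)"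
    unfolding mmul_def prod.case sum_distrib_left sum_distrib_right mult.assoc by (rule sum.swap)
qed

lemma mmul_in_mats: "A \<in> mats m \<Longrightarrow> B \<in> mats m \<Longrightarrow> mmul m A B \<in> mats m"
  by (auto simp: mats_def mmul_def intro!: sum.neutral)

lemma mid_in_mats: "mid m \<in> mats m"
  by (auto simp: mats_def mid_def)

lemma mmul_mid_left:
  assumes "A \<in> mats m"
  shows "mmul m (mid m) A = A"
proof (rule ext, clarify)
  fix I J :: "'a list"
  have "mmul m (mid m) A (I, J) = (\<Sum>K\<in>tidx m. if K = I then A (I, J) else 0)"
    unfolding mmul_def prod.case by (intro sum.cong) (auto simp: mid_def tidx_def)
  then show "mmul m (mid m) A (I, J) = A (I, J)"
    using assms by (simp add: mats_def) (auto simp: tidx_def)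
qed

lemma mmul_mid_right:
  assumes "A \<in> mats m"
  shows "mmul m A (mid m) = A"
proof (rule ext, clarify)
  fix I J :: "'a list"
  have "mmul m A (mid m) (I, J) = (\<Sum>K\<in>tidx m. if K = J then A (I, J) else 0)"
    unfolding mmul_def prod.case by (intro sum.cong) (auto simp: mid_def tidx_def)
  then show "mmul m A (mid m) (I, J) = A (I, J)"
    using assms by (simp add: mats_def) (auto simp: tidx_def)
qed

lemma mapp_mmul: "mapp m (mmul m A B) v = mapp m A (mapp m B v)"
proof
  fix I
  show "mapp m (mmul m A B) v I = mapp m A (mapp m B v) I"
    by (simp add: mapp_def mmul_def tidx_def sum_distrib_left sum_distrib_right mult.assoc) (rule impI, rule sum.swap)
qed

lemma mapp_in_vecs: "mapp m A v \<in> vecs m"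
  by (auto simp: mapp_def vecs_def)

lemma mapp_mid:
  assumes "v \<in> vecs m"
  shows "mapp m (mid m) v = v"
proof
  fix I
  have "(\<Sum>J\<in>tidx m. mid m (I, J) * v J) = (\<Sum>J\<in>tidx m. if J = I then v I else 0)"
    by (intro sum.cong) (auto simp: mid_def tidx_def)
  then show "mapp m (mid m) v I = v I"
    using assms by (simp add: mapp_def vecs_def) (auto simp: tidx_def)
qed

lemma mapp_add: "mapp m A (\<lambda>x. u x + v x) = (\<lambda>x. mapp m A u x + mapp m A v x)"
  by (auto simp: mapp_def fun_eq_iff algebra_simps sum.distrib)

lemma mapp_scale: "mapp m A (\<lambda>x. c * v x) = (\<lambda>x. c * mapp m A v x)"
  by (auto simp: mapp_def fun_eq_iff sum_distrib_left algebra_simps)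

text \<open>An operator at positions \<open>b\<close>, \<open>b + 1\<close> connects only indices
  with the same outer letters, so matrix products with it collapse to a double sum over the two
  inner letters.\<close>

lemma sum_tidx_local:
  assumes "length u = b" "b + 2 + length v = m"
    and "\<And>J. J \<in> tidx m \<Longrightarrow> \<nexists>p q. J = u @ [p, q] @ v \<Longrightarrow> G J = 0"
  shows "(\<Sum>J\<in>tidx m. G (J :: 'i::finite list)) = (\<Sum>p\<in>UNIV. \<Sum>q\<in>UNIV. G (u @ [p, q] @ v))"
proof -
  have "(\<Sum>J\<in>tidx m. G J) = (\<Sum>J\<in>(\<lambda>(p, q). u @ [p, q] @ v) ` (UNIV \<times> UNIV). G J)"
    using assms by (intro sum.mono_neutral_right finite_tidx) (auto simp: tidx_def image_iff)
  also have "\<dots> = (\<Sum>x\<in>UNIV \<times> UNIV. G ((\<lambda>(p, q). u @ [p, q] @ v) x))"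
    by (rule sum.reindex_cong[of "\<lambda>(p, q). u @ [p, q] @ v"]) (auto simp: inj_on_def)
  finally show ?thesis by (simp add: sum.cartesian_product case_prod_beta)
qed

lemma Rpos_in_mats: "Rpos m S b \<in> mats m"
  by (auto simp: mats_def Rpos_def)

lemma list_split_at2:
  assumes "Suc b < length I"
  obtains u x y v where "I = u @ [x, y] @ v" "length u = b" "b + 2 + length v = length I"
proof
  show "I = take b I @ [I ! b, I ! Suc b] @ drop (Suc (Suc b)) I"
    using assms by (metis Cons_nth_drop_Suc Suc_lessD append_Cons append_Nil append_take_drop_id)
qed (use assms in auto)

lemma Rpos_local:
  assumes "length u = b" "b + 2 + length v = m"
  shows "Rpos m S b (u @ [x, y] @ v, u @ [p, q] @ v) = S ((x, y), (p, q))"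
proof -
  have "(u @ [x, y] @ v) ! k = (u @ [p, q] @ v) ! k" if "k \<noteq> b" "k \<noteq> Suc b" for k
    using that assms by (auto simp: nth_append nth_Cons' )
  then show ?thesis using assms by (simp add: Rpos_def nth_append)
qed

lemma Rpos_eq_0:
  assumes "length u = b" "b + 2 + length v = m" "\<nexists>p q. J = u @ [p, q] @ v"
  shows "Rpos m S b (u @ [x, y] @ v, J) = 0"
proof (rule ccontr)
  assume "Rpos m S b (u @ [x, y] @ v, J) \<noteq> 0"
  then have *: "length J = m" "\<And>k. k < m \<Longrightarrow> k \<noteq> b \<Longrightarrow> k \<noteq> Suc b \<Longrightarrow> (u @ [x, y] @ v) ! k = J ! k"
    by (auto simp: Rpos_def split: if_splits)
  have "J = u @ [J ! b, J ! Suc b] @ v"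
  proof (rule nth_equalityI)
    fix k assume k: "k < length J"
    consider "k < b" | "k = b" | "k = Suc b" | "Suc (Suc b) \<le> k" by linarith
    then show "J ! k = (u @ [J ! b, J ! Suc b] @ v) ! k"
      using *(2)[of k] *(1) assms(1,2) k by cases (auto simp: nth_append nth_Cons' split: if_splits)
  qed (use * assms in auto)
  with assms(3) show False by blast
qed

lemma Rpos_eq_0':
  assumes "length u = b" "b + 2 + length v = m" "\<nexists>p q. J = u @ [p, q] @ v"
  shows "Rpos m S b (J, u @ [x, y] @ v) = 0"
proof -
  have "Rpos m S b (J, I) = Rpos m (\<lambda>(x, y). S (y, x)) b (I, J)" for I
    by (auto simp: Rpos_def)
  then show ?thesis using Rpos_eq_0[OF assms] by simp
qed

lemma mmul_Rpos:
  assumes "length u = b" "b + 2 + length v = m"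
  shows "mmul m (Rpos m S b) B (u @ [x, y] @ v, J) =
    (\<Sum>p\<in>UNIV. \<Sum>q\<in>UNIV. S ((x, y), (p, q)) * B (u @ [p, q] @ v, J))"
  unfolding mmul_def prod.case
proof (subst sum_tidx_local[OF assms], goal_cases)
  case (1 J)
  then show ?case by (simp only: Rpos_eq_0[OF assms 1(2)] mult_zero_left)
qed (simp only: Rpos_local[OF assms])

lemma mmul_Rpos_right:
  assumes "length u = b" "b + 2 + length v = m"
  shows "mmul m B (Rpos m S b) (J, u @ [x, y] @ v) =
    (\<Sum>p\<in>UNIV. \<Sum>q\<in>UNIV. B (J, u @ [p, q] @ v) * S ((p, q), (x, y)))"
  unfolding mmul_def prod.case
proof (subst sum_tidx_local[OF assms], goal_cases)
  case (1 J)
  then show ?case by (simp only: Rpos_eq_0'[OF assms 1(2)] mult_zero_right)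
qed (simp only: Rpos_local[OF assms])

lemma mats_eqI:
  assumes "A \<in> mats m" "B \<in> mats m"
    and "\<And>I J. length I = m \<Longrightarrow> length J = m \<Longrightarrow> A (I, J) = B (I, J)"
  shows "A = B"
proof (rule ext, clarify)
  fix I J
  show "A (I, J) = B (I, J)"
    using assms by (cases "length I = m \<and> length J = m") (auto simp: mats_def)
qed

section \<open>The generators as two-site operators, and their Coxeter relations\<close>

definition tauR :: "(('i \<times> 'i) \<times> ('i \<times> 'i) \<Rightarrow> 'k) \<Rightarrow> (('i \<times> 'i) \<times> ('i \<times> 'i) \<Rightarrow> 'k)" where
  "tauR R = (\<lambda>((a, b), (c, d)). R ((b, a), (c, d)))"

lemma tswap_eq_Rpos:
  assumes "Suc b < m"
  shows "(tswap m b :: 'i list \<times> 'i list \<Rightarrow> 'k::comm_ring_1) = Rpos m (tauR tid) b"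
proof (rule mats_eqI)
  fix I J :: "'i list"
  assume len: "length I = m" "length J = m"
  have "I = J[b := J ! Suc b, Suc b := J ! b] \<longleftrightarrow> (\<forall>k<m. I ! k = J[b := J ! Suc b, Suc b := J ! b] ! k)"
    using len by (auto simp: list_eq_iff_nth_eq)
  also have "\<dots> \<longleftrightarrow> (\<forall>k<m. k \<noteq> b \<and> k \<noteq> Suc b \<longrightarrow> I ! k = J ! k) \<and> I ! b = J ! Suc b \<and> I ! Suc b = J ! b"
    using assms len by (simp only: nth_list_update length_list_update) (metis Suc_lessD n_not_Suc_n)
  finally show "(tswap m b (I, J) :: 'k) = Rpos m (tauR tid) b (I, J)"
    using len by (auto simp: tswap_def Rpos_def tauR_def tid_def)
qed (auto simp: tswap_def mats_def Rpos_def)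

text \<open>Absorbs the flip into the two-site matrix: \<open>tauR R\<close> is the flip after
  \<open>R\<close>, and \<open>tauR tid\<close> is the flip itself. The Coxeter relations become
  statements about \<open>Rpos\<close> of a single matrix.\<close>

lemma sgen_eq_Rpos:
  fixes R :: "('i::finite \<times> 'i) \<times> ('i \<times> 'i) \<Rightarrow> 'k::comm_ring_1"
  assumes "Suc b < m"
  shows "sgen m R b = Rpos m (tauR R) b"
proof (rule mats_eqI)
  show "sgen m R b \<in> mats m"
    unfolding sgen_def tswap_eq_Rpos[OF assms] by (intro mmul_in_mats Rpos_in_mats)
  fix I J :: "'i list"
  assume I: "length I = m" "length J = m"
  then obtain u x y v where I: "I = u @ [x, y] @ v" "length u = b" "b + 2 + length v = m"
    using assms list_split_at2[of b I] by metis
  show "sgen m R b (I, J) = Rpos m (tauR R) b (I, J)"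
  proof (cases "\<exists>p q. J = u @ [p, q] @ v")
    case True
    then obtain p q where J: "J = u @ [p, q] @ v" by blast
    have "sgen m R b (I, J) = (\<Sum>p'\<in>UNIV. \<Sum>q'\<in>UNIV. tauR tid ((x, y), (p', q')) * R ((p', q'), (p, q)))"
      unfolding sgen_def tswap_eq_Rpos[OF assms] I(1) J
      by (subst mmul_Rpos[OF I(2,3)]) (simp only: Rpos_local[OF I(2,3)])
    also have "\<dots> = (\<Sum>p'\<in>UNIV. \<Sum>q'\<in>UNIV. if q' = x then (if p' = y then R ((p', q'), (p, q)) else 0) else 0)"
      by (intro sum.cong refl) (auto simp: tauR_def tid_def)
    also have "\<dots> = Rpos m (tauR R) b (I, J)"
      unfolding I(1) J Rpos_local[OF I(2,3)] by (simp add: tauR_def)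
    finally show ?thesis .
  next
    case False
    then show ?thesis
      unfolding sgen_def tswap_eq_Rpos[OF assms] I(1)
      by (subst mmul_Rpos[OF I(2,3)]) (simp only: Rpos_eq_0[OF I(2,3) False] mult_zero_right sum.neutral_const)
  qed
qed (rule Rpos_in_mats)

lemma sgen_in_mats: "sgen m R b \<in> mats m"
  unfolding sgen_def by (intro mmul_in_mats Rpos_in_mats) (auto simp: tswap_def mats_def)

lemma Rpos_square:
  fixes S :: "('i::finite \<times> 'i) \<times> ('i \<times> 'i) \<Rightarrow> 'k::comm_ring_1"
  assumes "Suc b < m"
    and "\<And>x y c d. (\<Sum>p\<in>UNIV. \<Sum>q\<in>UNIV. S ((x, y), (p, q)) * S ((p, q), (c, d))) = (if x = c \<and> y = d then 1 else 0)"
  shows "mmul m (Rpos m S b) (Rpos m S b) = mid m"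
proof (rule mats_eqI)
  fix I J :: "'i list"
  assume I: "length I = m" "length J = m"
  then obtain u x y v where I: "I = u @ [x, y] @ v" "length u = b" "b + 2 + length v = m"
    using assms list_split_at2[of b I] by metis
  show "mmul m (Rpos m S b) (Rpos m S b) (I, J) = mid m (I, J)"
  proof (cases "\<exists>p q. J = u @ [p, q] @ v")
    case True
    then obtain p q where J: "J = u @ [p, q] @ v" by blast
    show ?thesis
      unfolding I(1) J mmul_Rpos[OF I(2,3)] Rpos_local[OF I(2,3)] assms(2)
      using I by (simp add: mid_def)
  next
    case False
    then show ?thesis
      unfolding I(1) mmul_Rpos[OF I(2,3)] Rpos_eq_0[OF I(2,3) False] by (auto simp: mid_def)
  qed
qed (intro mmul_in_mats Rpos_in_mats mid_in_mats)+

lemma sum_UNIV_pair: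
  "(\<Sum>y\<in>UNIV. f y) = (\<Sum>a\<in>UNIV. \<Sum>b\<in>UNIV. f (a :: 'a::finite, b :: 'b::finite))"
  by (simp add: sum.cartesian_product flip: UNIV_Times_UNIV)

lemma sum_rotate:
  "(\<Sum>a\<in>A. \<Sum>b\<in>B. \<Sum>c\<in>C. f a b c) = (\<Sum>c\<in>C. \<Sum>a\<in>A. \<Sum>b\<in>B. f a b c)"
proof -
  have "(\<Sum>a\<in>A. \<Sum>b\<in>B. \<Sum>c\<in>C. f a b c) = (\<Sum>a\<in>A. \<Sum>c\<in>C. \<Sum>b\<in>B. f a b c)"
    by (intro sum.cong refl) (rule sum.swap)
  also have "\<dots> = (\<Sum>c\<in>C. \<Sum>a\<in>A. \<Sum>b\<in>B. f a b c)"
    by (rule sum.swap)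
  finally show ?thesis .
qed

lemma Rpos_commute:
  fixes S :: "('i::finite \<times> 'i) \<times> ('i \<times> 'i) \<Rightarrow> 'k::comm_ring_1"
  assumes "Suc b < c" "Suc c < m"
  shows "mmul m (Rpos m S b) (Rpos m T c) = mmul m (Rpos m T c) (Rpos m S b)"
proof (rule mats_eqI)
  fix I J :: "'i list"
  assume "length I = m" "length J = m"
  then obtain w x' y' t where I1: "I = w @ [x', y'] @ t" "length w = c" "c + 2 + length t = m"
    using assms list_split_at2[of c I] by metis
  then obtain u x y v where I2: "w = u @ [x, y] @ v" "length u = b" "b + 2 + length v = c"
    using assms list_split_at2[of b w] by metis
  have b: "b + 2 + length (v @ [p, q] @ t) = m" for p q
    using I1 I2 by simp
  have c: "length (u @ [p, q] @ v) = c" for p q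
    using I1 I2 by simp
  have e1: "mmul m (Rpos m S b) B (u @ [p, q] @ v @ [p', q'] @ t, J) =
     (\<Sum>r\<in>UNIV. \<Sum>s\<in>UNIV. S ((p, q), (r, s)) * B (u @ [r, s] @ v @ [p', q'] @ t, J))" for B p q p' q' J
    using mmul_Rpos[OF I2(2) b] by simp
  have e2: "mmul m (Rpos m T c) B (u @ [p, q] @ v @ [p', q'] @ t, J) =
     (\<Sum>r\<in>UNIV. \<Sum>s\<in>UNIV. T ((p', q'), (r, s)) * B (u @ [p, q] @ v @ [r, s] @ t, J))" for B p q p' q' J
    using mmul_Rpos[OF c I1(3)] by simp
  \<comment> \<open>The trailing \<open>mid m\<close> allows the row formulas \<open>e1\<close> and
    \<open>e2\<close> to be applied one after the other; both products then become the same double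
    sum against \<open>D\<close>.\<close>
  define D where "D = (\<lambda>(p, q) (p', q'). mid m (u @ [p, q] @ v @ [p', q'] @ t, J) :: 'k)"
  have eq: "I = u @ [x, y] @ v @ [x', y'] @ t" using I1 I2 by simp
  have mS: "mmul m (Rpos m S b) (mid m) = Rpos m S b" "mmul m (Rpos m T c) (mid m) = Rpos m T c"
    by (intro mmul_mid_right Rpos_in_mats)+
  have "mmul m (Rpos m S b) (mmul m (Rpos m T c) (mid m)) (I, J) =
    (\<Sum>p\<in>UNIV. \<Sum>q\<in>UNIV. S ((x, y), p) * (T ((x', y'), q) * D p q))"
    unfolding eq e1 e2 D_def by (simp add: sum_UNIV_pair sum_distrib_left)
  also have "\<dots> = (\<Sum>q\<in>UNIV. \<Sum>p\<in>UNIV. T ((x', y'), q) * (S ((x, y), p) * D p q))"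
    by (subst sum.swap) (simp add: mult.left_commute)
  also have "\<dots> = mmul m (Rpos m T c) (mmul m (Rpos m S b) (mid m)) (I, J)"
    unfolding eq e1 e2 D_def by (simp add: sum_UNIV_pair sum_distrib_left)
  finally show "mmul m (Rpos m S b) (Rpos m T c) (I, J) = mmul m (Rpos m T c) (Rpos m S b) (I, J)"
    unfolding mS .
qed (intro mmul_in_mats Rpos_in_mats)+

lemma list_split_at3:
  assumes "Suc (Suc b) < length I"
  obtains u x y z v where "I = u @ [x, y, z] @ v" "length u = b" "b + 3 + length v = length I"
proof
  show "I = take b I @ [I ! b, I ! Suc b, I ! Suc (Suc b)] @ drop (Suc (Suc (Suc b))) I"
    using assms by (metis Cons_nth_drop_Suc Suc_lessD append_Cons append_Nil append_take_drop_id)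
qed (use assms in auto)

text \<open>Both sides change only three adjacent letters, so the braid relation on three tensor
  factors, written in coordinates as the second assumption, suffices.\<close>

lemma Rpos_braid:
  fixes S :: "('i::finite \<times> 'i) \<times> ('i \<times> 'i) \<Rightarrow> 'k::comm_ring_1"
  assumes "Suc (Suc b) < m"
    and "\<And>x y z a b c.
      (\<Sum>p\<in>UNIV. \<Sum>q\<in>UNIV. \<Sum>r\<in>UNIV. S ((x, y), (p, q)) * (S ((q, z), (r, c)) * S ((p, r), (a, b)))) =
      (\<Sum>p\<in>UNIV. \<Sum>q\<in>UNIV. \<Sum>s\<in>UNIV. S ((y, z), (p, q)) * (S ((x, p), (a, s)) * S ((s, q), (b, c))))"
  shows "mmul m (Rpos m S b) (mmul m (Rpos m S (Suc b)) (Rpos m S b)) =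
    mmul m (Rpos m S (Suc b)) (mmul m (Rpos m S b) (Rpos m S (Suc b)))" (is "?L = ?R")
proof (rule mats_eqI)
  fix I J :: "'i list"
  assume I: "length I = m" "length J = m"
  then obtain u x y z v where I: "I = u @ [x, y, z] @ v" "length u = b" "b + 3 + length v = m"
    using assms list_split_at3[of b I] by metis
  have l1: "b + 2 + length (c # v) = m" and l2: "length (u @ [c]) = Suc b" "Suc b + 2 + length v = m" for c
    using I by auto
  have e1: "mmul m (Rpos m S b) B (u @ [x, y, z] @ v, J) =
     (\<Sum>p\<in>UNIV. \<Sum>q\<in>UNIV. S ((x, y), (p, q)) * B (u @ [p, q, z] @ v, J))" for B x y z
    using mmul_Rpos[OF I(2) l1] by simp
  have e2: "mmul m (Rpos m S (Suc b)) B (u @ [x, y, z] @ v, J) =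
     (\<Sum>p\<in>UNIV. \<Sum>q\<in>UNIV. S ((y, z), (p, q)) * B (u @ [x, p, q] @ v, J))" for B x y z
    using mmul_Rpos[OF l2(1) l2(2)] by simp
  show "?L (I, J) = ?R (I, J)"
  proof (cases "\<exists>a b c. J = u @ [a, b, c] @ v")
    case True
    then obtain a' b' c' where J: "J = u @ [a', b', c'] @ v" by blast
    have f1: "Rpos m S b (u @ [x, y, z] @ v, J) = (if z = c' then S ((x, y), (a', b')) else 0)" for x y z
      using Rpos_local[OF I(2) l1, of S x y z a' b'] Rpos_eq_0[OF I(2) l1[of z], of J S x y] J by auto
    have f2: "Rpos m S (Suc b) (u @ [x, y, z] @ v, J) = (if x = a' then S ((y, z), (b', c')) else 0)" for x y z
      using Rpos_local[OF l2(1)[of x] l2(2), of S y z b' c'] Rpos_eq_0[OF l2(1)[of x] l2(2), of J S y z] J by auto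
    have "?L (I, J) = (\<Sum>p\<in>UNIV. \<Sum>q\<in>UNIV. \<Sum>r\<in>UNIV. S ((x, y), (p, q)) * (S ((q, z), (r, c')) * S ((p, r), (a', b'))))"
      unfolding I(1) e1 e2 f1 by (simp add: if_distrib[of "\<lambda>x. _ * x"] sum_distrib_left cong: if_cong)
    moreover have "?R (I, J) = (\<Sum>p\<in>UNIV. \<Sum>q\<in>UNIV. \<Sum>s\<in>UNIV. S ((y, z), (p, q)) * (S ((x, p), (a', s)) * S ((s, q), (b', c'))))"
    proof -
      have "(\<Sum>r\<in>UNIV. \<Sum>s\<in>UNIV. S ((x, p), (r, s)) * (if r = a' then S ((s, q), (b', c')) else 0)) =
        (\<Sum>s\<in>UNIV. S ((x, p), (a', s)) * S ((s, q), (b', c')))" for p q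
        by (subst sum.swap) (simp add: if_distrib[of "\<lambda>x. _ * x"] cong: if_cong)
      then show ?thesis
        unfolding I(1) e1 e2 f2 by (simp add: sum_distrib_left)
    qed
    ultimately show ?thesis using assms(2) by simp
  next
    case False
    then have f1: "Rpos m S b (u @ [x, y, z] @ v, J) = 0" for x y z
      using Rpos_eq_0[OF I(2) l1[of z], of J S x y] by auto
    have f2: "Rpos m S (Suc b) (u @ [x, y, z] @ v, J) = 0" for x y z
      using False Rpos_eq_0[OF l2(1)[of x] l2(2), of J S y z] by auto
    show ?thesis unfolding I(1) e1 e2 f1 f2 by simp
  qed
qed (intro mmul_in_mats Rpos_in_mats)+

text \<open>With \<open>tau\<close> the flip, \<open>(tau R)(tau R) = (tau R tau) R = R21 R\<close>,
  so unitarity is exactly the quadratic Coxeter relation.\<close>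

lemma sgen_square:
  assumes "unitary_R R" "Suc b < m"
  shows "mmul m (sgen m R b) (sgen m R b) = mid m"
  unfolding sgen_eq_Rpos[OF assms(2)]
proof (rule Rpos_square[OF assms(2)])
  fix x y c d
  have "tmul (R21 R) R ((x, y), (c, d)) = tid ((x, y), (c, d))"
    using assms(1) by (simp add: unitary_R_def)
  then have "(\<Sum>p\<in>UNIV. \<Sum>q\<in>UNIV. R ((y, x), (q, p)) * R ((p, q), (c, d))) = (if x = c \<and> y = d then 1 else 0)"
    by (simp add: tmul_def R21_def tid_def sum_UNIV_pair)
  then show "(\<Sum>p\<in>UNIV. \<Sum>q\<in>UNIV. tauR R ((x, y), (p, q)) * tauR R ((p, q), (c, d))) = (if x = c \<and> y = d then 1 else 0)"
    unfolding tauR_def prod.case by (subst sum.swap)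
qed

lemma sum_UNIV_triple:
  "(\<Sum>y\<in>UNIV. f y) = (\<Sum>a\<in>UNIV. \<Sum>b\<in>UNIV. \<Sum>c\<in>UNIV. f (a :: 'a::finite, b :: 'b::finite, c :: 'c::finite))"
  by (simp add: sum.cartesian_product flip: UNIV_Times_UNIV)

lemma sum_UNIV_delta:
  "(\<Sum>y\<in>UNIV. (if y = (a :: 'a::finite) then f y else 0)) = f a"
  "(\<Sum>y\<in>UNIV. (if a = y then f y else 0)) = f a"
  by auto

text \<open>Moving all flips to the left, each side of the braid relation becomes the reversal of
  three tensor factors followed on its right by one side of the Yang-Baxter equation. This is why
  the entries \<open>A\<close> and \<open>B\<close> are taken at the reversed row index
  \<open>(z, y, x)\<close>.\<close>

lemma sgen_braid:
  assumes "QYBE R" "Suc (Suc b) < m"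
  shows "mmul m (sgen m R b) (mmul m (sgen m R (Suc b)) (sgen m R b)) =
    mmul m (sgen m R (Suc b)) (mmul m (sgen m R b) (sgen m R (Suc b)))"
proof -
  have "Suc b < m" using assms(2) by simp
  note eqs = sgen_eq_Rpos[OF this] sgen_eq_Rpos[OF assms(2)]
  show ?thesis unfolding eqs
  proof (rule Rpos_braid[OF assms(2)])
    fix x y z a b c
    have i: "(if P then s else 0) * t = (if P then s * t else 0)"
      "t * (if P then s else 0) = (if P then t * s else 0)" for P and s t :: 'b
      by auto
    have ii: "(\<Sum>x\<in>UNIV. if P then f x else 0) = (if P then \<Sum>x\<in>UNIV. f x else 0)" for P and f :: "'a \<Rightarrow> 'b"
      by auto
    note ev = tmul_def prod.case R12_def R13_def R23_def sum_UNIV_triple i ii sum_UNIV_delta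
    have "tmul (R12 R) (R13 R) ((z, y, x), (a, q, s)) = (\<Sum>p\<in>UNIV. R ((z, y), (p, q)) * R ((p, x), (a, s)))" for q s
      by (simp only: ev)
    then have "tmul (tmul (R12 R) (R13 R)) (R23 R) ((z, y, x), (a, b, c)) =
      (\<Sum>q\<in>UNIV. \<Sum>s\<in>UNIV. (\<Sum>p\<in>UNIV. R ((z, y), (p, q)) * R ((p, x), (a, s))) * R ((q, s), (b, c)))"
      by (subst tmul_def) (simp only: ev(2,5-))
    then have A: "tmul (tmul (R12 R) (R13 R)) (R23 R) ((z, y, x), (a, b, c)) =
      (\<Sum>p\<in>UNIV. \<Sum>q\<in>UNIV. \<Sum>s\<in>UNIV. R ((z, y), (p, q)) * (R ((p, x), (a, s)) * R ((q, s), (b, c))))"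
      by (simp only: sum_distrib_right mult.assoc) (rule sum_rotate)
    have "tmul (R23 R) (R13 R) ((z, y, x), (u, v, c)) = (\<Sum>w\<in>UNIV. R ((y, x), (v, w)) * R ((z, w), (u, c)))" for u v
      by (simp only: ev)
    then have "tmul (tmul (R23 R) (R13 R)) (R12 R) ((z, y, x), (a, b, c)) =
      (\<Sum>u\<in>UNIV. \<Sum>v\<in>UNIV. (\<Sum>w\<in>UNIV. R ((y, x), (v, w)) * R ((z, w), (u, c))) * R ((u, v), (a, b)))"
      by (subst tmul_def) (simp only: ev(2,3,6-))
    then have B: "tmul (tmul (R23 R) (R13 R)) (R12 R) ((z, y, x), (a, b, c)) =
      (\<Sum>p\<in>UNIV. \<Sum>q\<in>UNIV. \<Sum>r\<in>UNIV. R ((y, x), (p, q)) * (R ((z, q), (r, c)) * R ((r, p), (a, b))))"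
      by (simp only: sum_distrib_right mult.assoc) (rule sum_rotate[symmetric])
    show "(\<Sum>p\<in>UNIV. \<Sum>q\<in>UNIV. \<Sum>r\<in>UNIV. tauR R ((x, y), (p, q)) * (tauR R ((q, z), (r, c)) * tauR R ((p, r), (a, b)))) =
      (\<Sum>p\<in>UNIV. \<Sum>q\<in>UNIV. \<Sum>s\<in>UNIV. tauR R ((y, z), (p, q)) * (tauR R ((x, p), (a, s)) * tauR R ((s, q), (b, c))))"
      using A B assms(1) unfolding tauR_def prod.case QYBE_def by simp
  qed
qed

section \<open>The action of the group algebra\<close>

lemma word_mat_in_mats: "word_mat m R ws \<in> mats m"
  by (induction ws) (auto intro: mid_in_mats mmul_in_mats sgen_in_mats)

lemma word_mat_append: "word_mat m R (u @ v) = mmul m (word_mat m R u) (word_mat m R v)"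
  by (induction u) (simp_all add: mmul_mid_left word_mat_in_mats mmul_assoc)

abbreviation perms :: "nat \<Rightarrow> (nat \<Rightarrow> nat) set" where
  "perms m \<equiv> {\<pi>. \<pi> permutes {..<m}}"

locale unitary_QYBE =
  fixes R :: "('i::finite \<times> 'i) \<times> ('i \<times> 'i) \<Rightarrow> 'k::field_char_0" and m :: nat
  assumes unitary: "unitary_R R" and qybe: "QYBE R"
begin

lemma word_mat_weq: "weq m u v \<Longrightarrow> word_mat m R u = word_mat m R v"
proof (induction rule: weq.induct)
  case (weq_sq b u v)
  then show ?case
    by (simp add: word_mat_append sgen_square[OF unitary] mmul_mid_left word_mat_in_mats flip: mmul_assoc)
next
  case (weq_comm b c u v)
  then have "mmul m (sgen m R b) (sgen m R c) = mmul m (sgen m R c) (sgen m R b)"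
    using Rpos_commute[of b c m "tauR R" "tauR R"] by (simp add: sgen_eq_Rpos)
  then show ?case by (simp add: word_mat_append flip: mmul_assoc)
next
  case (weq_braid b u v)
  then show ?case using sgen_braid[OF qybe, of b m]
    by (simp add: word_mat_append flip: mmul_assoc)
qed simp_all

text \<open>Independence of the word chosen by \<open>SOME\<close>: the chosen word and
  \<open>ws\<close> have the same permutation, hence are related by Coxeter moves, which
  \<open>word_mat\<close> respects.\<close>

lemma Ract_word_perm:
  assumes "\<forall>b\<in>set ws. Suc b < m"
  shows "Ract m R (word_perm ws) = word_mat m R ws"
proof -
  define us where "us = (SOME us. (\<forall>b\<in>set us. Suc b < m) \<and> word_perm us = word_perm ws)"
  have "(\<forall>b\<in>set us. Suc b < m) \<and> word_perm us = word_perm ws"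
    unfolding us_def by (rule someI[of _ ws]) (use assms in auto)
  then have "weq m us ws" using word_perm_eq_imp_weq[of m m us ws] assms by blast
  then show ?thesis unfolding Ract_def us_def[symmetric] by (rule word_mat_weq)
qed

lemma Ract_in_mats: "Ract m R \<sigma> \<in> mats m"
  by (simp add: Ract_def word_mat_in_mats)

lemma Ract_id: "Ract m R id = mid m"
  using Ract_word_perm[of "[]"] by simp

lemma Ract_compose:
  assumes "\<sigma> \<in> perms m" "\<tau> \<in> perms m"
  shows "Ract m R (\<sigma> \<circ> \<tau>) = mmul m (Ract m R \<sigma>) (Ract m R \<tau>)"
proof -
  obtain u v where u: "\<forall>b\<in>set u. Suc b < m" "word_perm u = \<sigma>" and v: "\<forall>b\<in>set v. Suc b < m" "word_perm v = \<tau>"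
    using assms permutes_word_perm by blast
  have "Ract m R (word_perm (u @ v)) = word_mat m R (u @ v)"
    using u v by (intro Ract_word_perm) auto
  also have "\<dots> = mmul m (Ract m R \<sigma>) (Ract m R \<tau>)"
    using u v Ract_word_perm word_mat_append by metis
  finally show ?thesis using u v by (simp add: word_perm_append)
qed

end

section \<open>Permutations and convolution in the group algebra\<close>

lemma finite_perms [simp]: "finite (perms m)"
  by (simp add: finite_permutations)

lemma perms_inv: "\<pi> \<in> perms m \<Longrightarrow> inv \<pi> \<in> perms m"
  by (simp add: permutes_inv)

lemma perms_compose: "\<pi> \<in> perms m \<Longrightarrow> \<sigma> \<in> perms m \<Longrightarrow> \<pi> \<circ> \<sigma> \<in> perms m"
  by (simp add: permutes_compose)

lemma perms_id: "id \<in> perms m"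
  by (simp add: permutes_id)

lemma perms_inv_o: "\<pi> \<in> perms m \<Longrightarrow> inv \<pi> \<circ> \<pi> = id" "\<pi> \<in> perms m \<Longrightarrow> \<pi> \<circ> inv \<pi> = id"
  by (simp_all add: permutes_inv_o)

lemma perms_inv_o_cancel:
  "\<pi> \<in> perms m \<Longrightarrow> inv \<pi> \<circ> (\<pi> \<circ> \<sigma>) = \<sigma>" "\<pi> \<in> perms m \<Longrightarrow> \<pi> \<circ> (inv \<pi> \<circ> \<sigma>) = \<sigma>"
  by (simp_all add: permutes_inv_o flip: comp_assoc)

lemma perms_inv_inv: "\<pi> \<in> perms m \<Longrightarrow> inv (inv \<pi>) = \<pi>"
  by (simp add: permutes_inv_inv)

lemma perms_inv_compose: "\<pi> \<in> perms m \<Longrightarrow> \<sigma> \<in> perms m \<Longrightarrow> inv (\<pi> \<circ> \<sigma>) = inv \<sigma> \<circ> inv \<pi>"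
  by (simp add: o_inv_distrib permutes_bij)

lemma perms_compose_left_iff: "\<pi> \<in> perms m \<Longrightarrow> \<pi> \<circ> \<sigma> \<in> perms m \<longleftrightarrow> \<sigma> \<in> perms m"
  by (metis perms_compose perms_inv perms_inv_o_cancel(1))

lemma perms_inv_eq_iff: "\<pi> \<in> perms m \<Longrightarrow> inv \<pi> \<circ> \<sigma> = \<tau> \<longleftrightarrow> \<sigma> = \<pi> \<circ> \<tau>"
  by (metis perms_inv_o_cancel)

lemma sum_perms_inv: "(\<Sum>\<pi>\<in>perms m. f (inv \<pi>)) = (\<Sum>\<pi>\<in>perms m. f \<pi>)"
  by (rule sum.reindex_bij_witness[of _ inv inv]) (auto simp: permutes_inv permutes_inv_inv)

lemma sum_perms_left: "\<sigma> \<in> perms m \<Longrightarrow> (\<Sum>\<pi>\<in>perms m. f (\<sigma> \<circ> \<pi>)) = (\<Sum>\<pi>\<in>perms m. f \<pi>)"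
  by (rule sum.reindex_bij_witness[of _ "\<lambda>\<pi>. inv \<sigma> \<circ> \<pi>" "\<lambda>\<pi>. \<sigma> \<circ> \<pi>"])
     (simp_all add: perms_inv_o_cancel[simplified] permutes_compose permutes_inv)

lemma sum_perms_right:
  assumes "\<sigma> \<in> perms m"
  shows "(\<Sum>\<pi>\<in>perms m. f (\<pi> \<circ> \<sigma>)) = (\<Sum>\<pi>\<in>perms m. f \<pi>)"
  by (rule sum.reindex_bij_witness[of _ "\<lambda>\<pi>. \<pi> \<circ> inv \<sigma>" "\<lambda>\<pi>. \<pi> \<circ> \<sigma>"])
     (use assms in \<open>simp_all add: comp_assoc permutes_inv_o permutes_compose permutes_inv\<close>)

lemma galgD: "x \<in> galg m \<Longrightarrow> \<sigma> \<notin> perms m \<Longrightarrow> x \<sigma> = 0"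
  by (simp add: galg_def)

lemma gmul_in_galg: "y \<in> galg m \<Longrightarrow> gmul m x y \<in> galg m"
  unfolding galg_def gmul_def
  by (auto intro!: sum.neutral simp: perms_compose_left_iff[OF perms_inv, simplified])

lemma gmul_assoc: "gmul m (gmul m x y) z = gmul m x (gmul m y z)"
proof
  fix \<sigma>
  have "gmul m (gmul m x y) z \<sigma> =
      (\<Sum>\<pi>\<in>perms m. \<Sum>\<rho>\<in>perms m. x \<pi> * (y (inv \<pi> \<circ> \<rho>) * z (inv \<rho> \<circ> \<sigma>)))"
    unfolding gmul_def sum_distrib_right mult.assoc by (rule sum.swap)
  also have "\<dots> = (\<Sum>\<pi>\<in>perms m. \<Sum>\<tau>\<in>perms m. x \<pi> * (y \<tau> * z (inv \<tau> \<circ> (inv \<pi> \<circ> \<sigma>))))"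
  proof (rule sum.cong[OF refl])
    fix \<pi> assume \<pi>: "\<pi> \<in> perms m"
    show "(\<Sum>\<rho>\<in>perms m. x \<pi> * (y (inv \<pi> \<circ> \<rho>) * z (inv \<rho> \<circ> \<sigma>))) =
        (\<Sum>\<tau>\<in>perms m. x \<pi> * (y \<tau> * z (inv \<tau> \<circ> (inv \<pi> \<circ> \<sigma>))))"
      using sum_perms_left[OF \<pi>, of "\<lambda>\<rho>. x \<pi> * (y (inv \<pi> \<circ> \<rho>) * z (inv \<rho> \<circ> \<sigma>))", symmetric] \<pi>
      by (simp add: perms_inv_o_cancel[simplified] perms_inv_compose[simplified] comp_assoc)
  qed
  also have "\<dots> = gmul m x (gmul m y z) \<sigma>"
    by (simp add: gmul_def sum_distrib_left)
  finally show "gmul m (gmul m x y) z \<sigma> = gmul m x (gmul m y z) \<sigma>" .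
qed

definition gdelta :: "(nat \<Rightarrow> nat) \<Rightarrow> (nat \<Rightarrow> nat) \<Rightarrow> 'k::comm_ring_1" where
  "gdelta g = (\<lambda>\<sigma>. if \<sigma> = g then 1 else 0)"

lemma gdelta_in_galg: "g \<in> perms m \<Longrightarrow> gdelta g \<in> galg m"
  by (auto simp: galg_def gdelta_def)

lemma gmul_gdelta_left: "g \<in> perms m \<Longrightarrow> gmul m (gdelta g) x = (\<lambda>\<sigma>. x (inv g \<circ> \<sigma>))"
  by (rule ext) (simp add: gmul_def gdelta_def if_distrib[of "\<lambda>x. x * _"] finite_permutations cong: if_cong)

lemma gmul_gdelta_right:
  assumes "g \<in> perms m" "x \<in> galg m"
  shows "gmul m x (gdelta g) = (\<lambda>\<sigma>. x (\<sigma> \<circ> inv g))"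
proof
  fix \<sigma>
  have "inv \<pi> \<circ> \<sigma> = g \<longleftrightarrow> \<pi> = \<sigma> \<circ> inv g" if "\<pi> \<in> perms m" for \<pi>
  proof -
    have "inv \<pi> \<circ> \<sigma> = g \<longleftrightarrow> \<sigma> = \<pi> \<circ> g" using that by (rule perms_inv_eq_iff)
    also have "\<dots> \<longleftrightarrow> \<pi> = \<sigma> \<circ> inv g" using assms(1)
      by (metis comp_assoc comp_id perms_inv_o)
    finally show ?thesis .
  qed
  then have "gmul m x (gdelta g) \<sigma> = (\<Sum>\<pi>\<in>perms m. if \<pi> = \<sigma> \<circ> inv g then x \<pi> else 0)"
    unfolding gmul_def gdelta_def by (intro sum.cong) auto
  then show "gmul m x (gdelta g) \<sigma> = x (\<sigma> \<circ> inv g)"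
    using galgD[OF assms(2), of "\<sigma> \<circ> inv g"] by (auto simp: finite_permutations)
qed

lemma gmul_scale_left: "gmul m (\<lambda>\<sigma>. c * x \<sigma>) z = (\<lambda>\<sigma>. c * gmul m x z \<sigma>)"
  by (simp add: gmul_def fun_eq_iff algebra_simps sum_distrib_left)

lemma gmul_scale_right: "gmul m z (\<lambda>\<sigma>. c * x \<sigma>) = (\<lambda>\<sigma>. c * gmul m z x \<sigma>)"
  by (simp add: gmul_def fun_eq_iff algebra_simps sum_distrib_left)

lemma gmul_sum_left: "gmul m (\<lambda>\<sigma>. \<Sum>i\<in>A. x i \<sigma>) z = (\<lambda>\<sigma>. \<Sum>i\<in>A. gmul m (x i) z \<sigma>)"
  unfolding gmul_def fun_eq_iff sum_distrib_right by (intro allI sum.swap)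

lemma gmul_zero_left: "gmul m (\<lambda>_. 0) z = (\<lambda>_. 0)"
  by (simp add: gmul_def)

lemma gmul_zero_right: "gmul m z (\<lambda>_. 0) = (\<lambda>_. 0)"
  by (simp add: gmul_def)

lemma gmul_at_id: "gmul m x y id = (\<Sum>\<pi>\<in>perms m. x \<pi> * y (inv \<pi>))"
  by (simp add: gmul_def)

text \<open>The coefficient at the identity is a trace. It evaluates every scalar in the identities
  for Young symmetrizers.\<close>

lemma gmul_trace: "gmul m x y id = gmul m y x id"
  unfolding gmul_at_id by (subst sum_perms_inv[symmetric]) (auto intro!: sum.cong simp: permutes_inv_inv mult.commute)

text \<open>The anti-involution of k[S_m] that inverts group elements. It fixes the row and column
  symmetrizers and so exchanges their order in a product.\<close>

definition gstar :: "nat \<Rightarrow> ((nat \<Rightarrow> nat) \<Rightarrow> 'k::zero) \<Rightarrow> (nat \<Rightarrow> nat) \<Rightarrow> 'k" where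
  "gstar m x = (\<lambda>\<sigma>. if \<sigma> \<in> perms m then x (inv \<sigma>) else 0)"

lemma gstar_gmul:
  assumes "x \<in> galg m" "y \<in> galg m"
  shows "gstar m (gmul m x y) = gmul m (gstar m y) (gstar m x)"
proof
  fix \<sigma>
  show "gstar m (gmul m x y) \<sigma> = gmul m (gstar m y) (gstar m x) \<sigma>"
  proof (cases "\<sigma> \<in> perms m")
    case True
    have "gmul m (gstar m y) (gstar m x) \<sigma> = (\<Sum>\<pi>\<in>perms m. y (inv \<pi>) * x (inv (inv \<pi> \<circ> \<sigma>)))"
      unfolding gmul_def gstar_def using True
      by (intro sum.cong) (auto simp: permutes_compose permutes_inv)
    also have "\<dots> = (\<Sum>\<pi>\<in>perms m. y (inv (\<sigma> \<circ> \<pi>)) * x (inv (inv (\<sigma> \<circ> \<pi>) \<circ> \<sigma>)))"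
      by (subst sum_perms_left[OF True, symmetric]) simp
    also have "\<dots> = (\<Sum>\<pi>\<in>perms m. x \<pi> * y (inv \<pi> \<circ> inv \<sigma>))"
    proof (rule sum.cong[OF refl])
      fix \<pi> assume "\<pi> \<in> perms m"
      then show "y (inv (\<sigma> \<circ> \<pi>)) * x (inv (inv (\<sigma> \<circ> \<pi>) \<circ> \<sigma>)) = x \<pi> * y (inv \<pi> \<circ> inv \<sigma>)"
        using True by (simp add: perms_inv_compose[simplified] comp_assoc permutes_inv_o permutes_inv_inv mult.commute)
    qed
    finally show ?thesis using True by (simp add: gstar_def gmul_def)
  next
    case False
    then have "gmul m (gstar m y) (gstar m x) \<sigma> = 0"
      unfolding gmul_def gstar_def
      by (intro sum.neutral) (auto simp: perms_compose_left_iff[OF perms_inv, simplified])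
    then show ?thesis using False by (simp add: gstar_def)
  qed
qed

lemma grep_gdelta: "g \<in> perms m \<Longrightarrow> grep m R (gdelta g) = Ract m R g"
  by (rule ext) (simp add: grep_def gdelta_def if_distrib[of "\<lambda>x. x * _"] finite_permutations cong: if_cong)

lemma mapp_grep: "mapp m (grep m R x) v I = (\<Sum>\<sigma>\<in>perms m. x \<sigma> * mapp m (Ract m R \<sigma>) v I)"
  by (simp add: mapp_def grep_def sum_distrib_left sum_distrib_right mult.assoc) (rule impI, rule sum.swap)

lemma mmul_grep_left: "mmul m (grep m R x) B IJ = (\<Sum>\<sigma>\<in>perms m. x \<sigma> * mmul m (Ract m R \<sigma>) B IJ)"
  unfolding mmul_def grep_def case_prod_beta sum_distrib_left sum_distrib_right mult.assoc by (rule sum.swap)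

lemma mmul_grep_right: "mmul m B (grep m R x) IJ = (\<Sum>\<sigma>\<in>perms m. x \<sigma> * mmul m B (Ract m R \<sigma>) IJ)"
  unfolding mmul_def grep_def case_prod_beta sum_distrib_left sum_distrib_right
  by (subst sum.swap) (simp add: mult_ac)

context unitary_QYBE
begin

lemma grep_in_mats: "grep m R x \<in> mats m"
  using Ract_in_mats by (auto simp: mats_def grep_def intro!: sum.neutral)

lemma grep_gmul: "grep m R (gmul m x y) = mmul m (grep m R x) (grep m R y)"
proof
  fix IJ
  have "grep m R (gmul m x y) IJ = (\<Sum>\<pi>\<in>perms m. \<Sum>\<sigma>\<in>perms m. x \<pi> * (y (inv \<pi> \<circ> \<sigma>) * Ract m R \<sigma> IJ))"
    unfolding grep_def gmul_def sum_distrib_right mult.assoc by (rule sum.swap)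
  also have "\<dots> = (\<Sum>\<pi>\<in>perms m. \<Sum>\<sigma>\<in>perms m. x \<pi> * (y \<sigma> * mmul m (Ract m R \<pi>) (Ract m R \<sigma>) IJ))"
  proof (rule sum.cong[OF refl])
    fix \<pi> assume \<pi>: "\<pi> \<in> perms m"
    show "(\<Sum>\<sigma>\<in>perms m. x \<pi> * (y (inv \<pi> \<circ> \<sigma>) * Ract m R \<sigma> IJ)) =
        (\<Sum>\<sigma>\<in>perms m. x \<pi> * (y \<sigma> * mmul m (Ract m R \<pi>) (Ract m R \<sigma>) IJ))"
      using sum_perms_left[OF \<pi>, of "\<lambda>\<sigma>. x \<pi> * (y (inv \<pi> \<circ> \<sigma>) * Ract m R \<sigma> IJ)", symmetric] \<pi>
      by (simp add: perms_inv_o_cancel[simplified] Ract_compose[simplified])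
  qed
  also have "\<dots> = mmul m (grep m R x) (grep m R y) IJ"
    by (subst mmul_grep_left) (simp only: mmul_grep_right sum_distrib_left)
  finally show "grep m R (gmul m x y) IJ = mmul m (grep m R x) (grep m R y) IJ" .
qed

text \<open>Products of generators are the operators of permutations, so the generated algebra is
  the image of k[S_m]; from here on its elements are handled through their coefficients.\<close>

lemma SRm_eq_grep: "SRm m R = range (grep m R)"
proof
  have gd: "\<exists>x. Ract m R \<sigma> = grep m R x" if "\<sigma> \<in> perms m" for \<sigma>
    using grep_gdelta[OF that] by metis
  show "SRm m R \<subseteq> range (grep m R)"
  proof
    fix A assume "A \<in> SRm m R"
    then show "A \<in> range (grep m R)"
    proof induction
      case SR_id
      show ?case using gd[OF perms_id] Ract_id by auto
    next
      case (SR_gen b)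
      have "sgen m R b = word_mat m R [b]"
        by (simp add: mmul_mid_right sgen_in_mats)
      also have "\<dots> = Ract m R (word_perm [b])"
        using SR_gen by (intro Ract_word_perm[symmetric]) simp
      finally show ?case using SR_gen word_perm_permutes[of "[b]" m] gd[of "word_perm [b]"] by auto
    next
      case (SR_add A B)
      then obtain x y where "A = grep m R x" "B = grep m R y" by auto
      then have "(\<lambda>z. A z + B z) = grep m R (\<lambda>\<sigma>. x \<sigma> + y \<sigma>)"
        by (simp add: grep_def algebra_simps sum.distrib)
      then show ?case by blast
    next
      case (SR_scal A c)
      then obtain x where "A = grep m R x" by auto
      then have "(\<lambda>z. c * A z) = grep m R (\<lambda>\<sigma>. c * x \<sigma>)"
        by (simp add: grep_def algebra_simps sum_distrib_left)
      then show ?case by blast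
    next
      case (SR_mul A B)
      then obtain x y where "A = grep m R x" "B = grep m R y" by auto
      then have "mmul m A B = grep m R (gmul m x y)" by (simp add: grep_gmul)
      then show ?case by blast
    qed
  qed
  have W: "word_mat m R ws \<in> SRm m R" if "\<forall>b\<in>set ws. Suc b < m" for ws
    using that by (induction ws) (auto intro: SRm.intros)
  have *: "Ract m R \<sigma> \<in> SRm m R" if "\<sigma> \<in> perms m" for \<sigma>
    using that permutes_word_perm W Ract_word_perm by (metis mem_Collect_eq)
  have "(\<lambda>IJ. \<Sum>\<sigma>\<in>F. x \<sigma> * Ract m R \<sigma> IJ) \<in> SRm m R" if "finite F" "F \<subseteq> perms m" for F and x :: "_ \<Rightarrow> 'k"
    using that
  proof (induction F rule: finite_induct)
    case empty
    show ?case using SR_scal[OF SR_id[of m R], of 0] by simp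
  next
    case (insert \<sigma> F)
    then show ?case using SR_add[OF SR_scal[OF *[of \<sigma>], of "x \<sigma>"]] by simp
  qed
  from this[OF finite_perms] show "range (grep m R) \<subseteq> SRm m R"
    by (auto simp: grep_def)
qed

end

section \<open>Young symmetrizers\<close>

lemma finite_downclosed_nat:
  assumes "finite S" "\<And>x i. x \<in> S \<Longrightarrow> i \<le> x \<Longrightarrow> (i::nat) \<in> S"
  shows "S = {..<card S}"
proof (cases "S = {}")
  case False
  have "S = {..Max S}"
  proof
    show "S \<subseteq> {..Max S}" using Max_ge[OF assms(1)] by blast
    show "{..Max S} \<subseteq> S" using assms(2)[OF Max_in[OF assms(1) False]] by blast
  qed
  then have "S = {..<Suc (Max S)}" by (simp only: lessThan_Suc_atMost)
  then show ?thesis by (metis card_lessThan)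
qed simp

lemma card_fibres:
  assumes "finite A" "finite J" "f ` A \<subseteq> J"
  shows "card A = (\<Sum>j\<in>J. card {k\<in>A. f k = j})"
  using sum.group[OF assms, of "\<lambda>_. 1::nat"] by simp

text \<open>Here \<open>(\<rho>', \<gamma>')\<close> are the row and column of an entry in a Young diagram, while \<open>\<rho>\<close> is the row in
  a second diagram and \<open>\<gamma>\<close> the column in a rearrangement of the first one, such that no two entries
  agree in both. Counting by columns shows that the second shape is dominated by the first, and that
  for equal shapes every cell \<open>(\<rho> k, \<gamma> k)\<close> belongs to the diagram.\<close>
context
  fixes X :: "'a set" and \<rho> \<gamma> \<rho>' \<gamma>' :: "'a \<Rightarrow> nat"
  assumes fin: "finite X"
    and inj: "inj_on (\<lambda>k. (\<rho> k, \<gamma> k)) X" and inj': "inj_on (\<lambda>k. (\<rho>' k, \<gamma>' k)) X"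
    and down: "\<And>k i. k \<in> X \<Longrightarrow> i \<le> \<rho>' k \<Longrightarrow> \<exists>k'\<in>X. \<rho>' k' = i \<and> \<gamma>' k' = \<gamma>' k"
    and cols: "\<And>j. card {k\<in>X. \<gamma> k = j} = card {k\<in>X. \<gamma>' k = j}"
begin

text \<open>Entries of one column have distinct values of \<open>\<rho>\<close>, so at most
  \<open>r\<close> of them lie in the first \<open>r\<close> rows. The diagram itself attains this
  bound in every column.\<close>

lemma filling_column_le:
  "card {k\<in>X. \<rho> k < r \<and> \<gamma> k = j} \<le> min r (card {k\<in>X. \<gamma>' k = j})"
proof -
  have "card {k\<in>X. \<rho> k < r \<and> \<gamma> k = j} \<le> card {..<r}"
    by (rule card_inj_on_le[of \<rho>]) (use inj in \<open>auto simp: inj_on_def\<close>)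
  moreover have "card {k\<in>X. \<rho> k < r \<and> \<gamma> k = j} \<le> card {k\<in>X. \<gamma> k = j}"
    by (rule card_mono) (use fin in auto)
  ultimately show ?thesis using cols by simp
qed

lemma diagram_column: "\<rho>' ` {k\<in>X. \<gamma>' k = j} = {..<card {k\<in>X. \<gamma>' k = j}}"
proof -
  have "inj_on \<rho>' {k\<in>X. \<gamma>' k = j}" using inj' by (auto simp: inj_on_def)
  then have "card (\<rho>' ` {k\<in>X. \<gamma>' k = j}) = card {k\<in>X. \<gamma>' k = j}" by (rule card_image)
  moreover have "\<rho>' ` {k\<in>X. \<gamma>' k = j} = {..<card (\<rho>' ` {k\<in>X. \<gamma>' k = j})}"
  proof (rule finite_downclosed_nat)
    fix x i assume "x \<in> \<rho>' ` {k\<in>X. \<gamma>' k = j}" "i \<le> x"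
    then obtain k where "k \<in> X" "\<gamma>' k = j" "i \<le> \<rho>' k" by blast
    then show "i \<in> \<rho>' ` {k\<in>X. \<gamma>' k = j}" using down[of k i] by auto
  qed (use fin in simp)
  ultimately show ?thesis by simp
qed

lemma diagram_column_card:
  "card {k\<in>X. \<rho>' k < r \<and> \<gamma>' k = j} = min r (card {k\<in>X. \<gamma>' k = j})"
proof -
  have "inj_on \<rho>' {k\<in>X. \<rho>' k < r \<and> \<gamma>' k = j}" using inj' by (auto simp: inj_on_def)
  then have "card {k\<in>X. \<rho>' k < r \<and> \<gamma>' k = j} = card (\<rho>' ` {k\<in>X. \<rho>' k < r \<and> \<gamma>' k = j})"
    by (simp add: card_image)
  also have "\<rho>' ` {k\<in>X. \<rho>' k < r \<and> \<gamma>' k = j} = {..<r} \<inter> \<rho>' ` {k\<in>X. \<gamma>' k = j}" by auto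
  also have "\<dots> = {..<min r (card {k\<in>X. \<gamma>' k = j})}" unfolding diagram_column by auto
  finally show ?thesis by simp
qed

lemma rows_card_eq:
  "card {k\<in>X. \<rho> k < r} = (\<Sum>j\<in>\<gamma> ` X \<union> \<gamma>' ` X. card {k\<in>X. \<rho> k < r \<and> \<gamma> k = j})"
  "card {k\<in>X. \<rho>' k < r} = (\<Sum>j\<in>\<gamma> ` X \<union> \<gamma>' ` X. card {k\<in>X. \<rho>' k < r \<and> \<gamma>' k = j})"
  using card_fibres[of "{k\<in>X. \<rho> k < r}" "\<gamma> ` X \<union> \<gamma>' ` X" \<gamma>]
    card_fibres[of "{k\<in>X. \<rho>' k < r}" "\<gamma> ` X \<union> \<gamma>' ` X" \<gamma>'] fin
  by (auto simp: conj_assoc)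

lemma filling_rows_le: "card {k\<in>X. \<rho> k < r} \<le> card {k\<in>X. \<rho>' k < r}"
  unfolding rows_card_eq diagram_column_card by (intro sum_mono filling_column_le)

text \<open>Equal totals force equality in each column bound. Since \<open>k\<close> itself makes
  the count in its column grow from \<open>r = \<rho> k\<close> to the next \<open>r\<close>, the
  row \<open>\<rho> k\<close> must be smaller than the length of that column.\<close>

lemma filling_in_diagram:
  assumes eq: "\<And>r. card {k\<in>X. \<rho> k < r} = card {k\<in>X. \<rho>' k < r}" and k: "k \<in> X"
  shows "\<exists>k'\<in>X. \<rho>' k' = \<rho> k \<and> \<gamma>' k' = \<gamma> k"
proof -
  let ?N = "card {l\<in>X. \<gamma>' l = \<gamma> k}"
  have c: "card {l\<in>X. \<rho> l < r \<and> \<gamma> l = \<gamma> k} = min r ?N" for r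
    using sum_mono_inv[OF eq[of r, unfolded rows_card_eq diagram_column_card] filling_column_le] k fin by auto
  have "{l\<in>X. \<rho> l < \<rho> k \<and> \<gamma> l = \<gamma> k} \<subset> {l\<in>X. \<rho> l < Suc (\<rho> k) \<and> \<gamma> l = \<gamma> k}" using k by auto
  then have "min (\<rho> k) ?N < min (Suc (\<rho> k)) ?N"
    unfolding c[symmetric] by (rule psubset_card_mono[rotated]) (use fin in auto)
  then have "\<rho> k \<in> {..<?N}" by auto
  then show ?thesis unfolding diagram_column[symmetric] by auto
qed

end

lemma sum_list_take_mono: "r \<le> s \<Longrightarrow> sum_list (take r p) \<le> sum_list (take s (p::nat list))"
  by (metis le_add1 le_add_diff_inverse sum_list.append take_add)

context
  fixes m :: nat and p :: "nat list"
  assumes part: "is_partition m p"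
begin

lemma rowof_less_iff:
  assumes "k < m"
  shows "rowof p k < r \<longleftrightarrow> k < sum_list (take r p)"
proof
  have ex: "k < sum_list (take (Suc (rowof p k)) p)"
    unfolding rowof_def by (rule LeastI[of _ "length p"]) (use part assms in \<open>simp add: is_partition_def\<close>)
  then show "k < sum_list (take r p)" if "rowof p k < r"
    using sum_list_take_mono[of "Suc (rowof p k)" r p] that by simp
  show "rowof p k < r" if "k < sum_list (take r p)"
  proof (cases r)
    case (Suc r')
    then show ?thesis using that by (auto simp: rowof_def less_Suc_eq_le intro: Least_le)
  qed (use that in simp)
qed

lemma card_rowof_less: "card {k\<in>{..<m}. rowof p k < r} = sum_list (take r p)"
proof -
  have "sum_list (take r p) \<le> m"
    using part sum_list_take_mono[of r "r + length p" p] by (simp add: is_partition_def)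
  then have "{k\<in>{..<m}. rowof p k < r} = {..<sum_list (take r p)}"
    by (auto simp: rowof_less_iff)
  then show ?thesis by simp
qed

lemma rowof_length: "k < m \<Longrightarrow> rowof p k < length p"
  using part by (simp add: rowof_less_iff is_partition_def)

lemma rowof_bounds:
  assumes "k < m"
  shows "sum_list (take (rowof p k) p) \<le> k" "k < sum_list (take (rowof p k) p) + p ! rowof p k"
  using rowof_less_iff[OF assms, of "rowof p k"] rowof_less_iff[OF assms, of "Suc (rowof p k)"]
    rowof_length[OF assms] by (auto simp: take_Suc_conv_app_nth)

lemma colof_less: "k < m \<Longrightarrow> colof p k < p ! rowof p k"
  using rowof_bounds[of k] by (simp add: colof_def)

lemma inj_row_col: "inj_on (\<lambda>k. (rowof p k, colof p k)) {..<m}"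
proof (rule inj_onI)
  fix k l assume "k \<in> {..<m}" "l \<in> {..<m}" "(rowof p k, colof p k) = (rowof p l, colof p l)"
  then have "k < m" "l < m" "rowof p k = rowof p l" "colof p k = colof p l" by auto
  then show "k = l" using rowof_bounds(1)[of k] rowof_bounds(1)[of l] by (auto simp: colof_def)
qed

lemma cell_exists:
  assumes "r < length p" "c < p ! r"
  shows "\<exists>k<m. rowof p k = r \<and> colof p k = c"
proof -
  let ?k = "sum_list (take r p) + c"
  have k: "?k < sum_list (take (Suc r) p)" using assms by (simp add: take_Suc_conv_app_nth)
  also have "\<dots> \<le> m" using sum_list_take_mono[of "Suc r" "Suc r + length p" p] part by (simp add: is_partition_def)
  finally have km: "?k < m" .
  have "rowof p ?k = r"
    using rowof_less_iff[OF km, of r] rowof_less_iff[OF km, of "Suc r"] k by simp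
  then show ?thesis using km by (intro exI[of _ ?k]) (simp add: colof_def)
qed

lemma partition_antimono: "i \<le> j \<Longrightarrow> j < length p \<Longrightarrow> p ! j \<le> p ! i"
proof (induction j rule: dec_induct)
  case (step j)
  then show ?case using part unfolding is_partition_def by (meson Suc_lessD le_trans)
qed simp

lemma diagram_downclosed:
  assumes "k < m" "i \<le> rowof p k"
  shows "\<exists>l<m. rowof p l = i \<and> colof p l = colof p k"
  using assms rowof_length[of k] colof_less[of k] partition_antimono[of i "rowof p k"]
  by (intro cell_exists) auto

end

section \<open>Row and column groups and their symmetrizers\<close>

definition fibre_perms :: "nat \<Rightarrow> (nat \<Rightarrow> nat) \<Rightarrow> (nat \<Rightarrow> nat) set" where
  "fibre_perms m f = {\<sigma>. \<sigma> permutes {..<m} \<and> (\<forall>k<m. f (\<sigma> k) = f k)}"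

lemma row_group_eq: "row_group m p = fibre_perms m (rowof p)"
  and col_group_eq: "col_group m p = fibre_perms m (colof p)"
  by (auto simp: row_group_def col_group_def fibre_perms_def)

lemma fibre_perms_perms: "\<sigma> \<in> fibre_perms m f \<Longrightarrow> \<sigma> \<in> perms m"
  by (simp add: fibre_perms_def)

lemma fibre_perms_apply: "\<sigma> \<in> fibre_perms m f \<Longrightarrow> f (\<sigma> k) = f k"
  by (cases "k < m") (auto simp: fibre_perms_def permutes_def)

lemma fibre_perms_id: "id \<in> fibre_perms m f"
  by (simp add: fibre_perms_def permutes_id)

lemma fibre_perms_compose: "\<sigma> \<in> fibre_perms m f \<Longrightarrow> \<tau> \<in> fibre_perms m f \<Longrightarrow> \<sigma> \<circ> \<tau> \<in> fibre_perms m f"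
  using fibre_perms_apply[of \<sigma> m f] fibre_perms_apply[of \<tau> m f] by (auto simp: fibre_perms_def permutes_compose)

lemma fibre_perms_inv: "\<sigma> \<in> fibre_perms m f \<Longrightarrow> inv \<sigma> \<in> fibre_perms m f"
  using fibre_perms_apply[of \<sigma> m f "inv \<sigma> _"] by (auto simp: fibre_perms_def permutes_inv permutes_inverses)

lemma fibre_perms_compose_left_iff:
  "\<sigma> \<in> fibre_perms m f \<Longrightarrow> \<sigma> \<circ> \<tau> \<in> fibre_perms m f \<longleftrightarrow> \<tau> \<in> fibre_perms m f"
  by (metis fibre_perms_compose fibre_perms_inv fibre_perms_perms perms_inv_o_cancel(1))

lemma fibre_perms_compose_right_iff:
  assumes "\<sigma> \<in> fibre_perms m f"
  shows "\<tau> \<circ> \<sigma> \<in> fibre_perms m f \<longleftrightarrow> \<tau> \<in> fibre_perms m f"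
proof
  assume "\<tau> \<circ> \<sigma> \<in> fibre_perms m f"
  moreover have "(\<tau> \<circ> \<sigma>) \<circ> inv \<sigma> = \<tau>"
    using fibre_perms_perms[OF assms] by (simp add: comp_assoc permutes_inv_o)
  ultimately show "\<tau> \<in> fibre_perms m f" by (metis assms fibre_perms_compose fibre_perms_inv)
qed (use assms fibre_perms_compose in blast)

lemma fibre_perms_inv_iff: "\<sigma> \<in> perms m \<Longrightarrow> inv \<sigma> \<in> fibre_perms m f \<longleftrightarrow> \<sigma> \<in> fibre_perms m f"
  by (metis fibre_perms_inv perms_inv_inv)

lemma transpose_in_fibre_perms: "k < m \<Longrightarrow> l < m \<Longrightarrow> f k = f l \<Longrightarrow> transpose k l \<in> fibre_perms m f"
  by (auto simp: fibre_perms_def permutes_swap_id transpose_def)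

text \<open>Young's row symmetrizer a; \<open>col_sym\<close> is the signed column symmetrizer b.
  The Young symmetrizer is the product ab.\<close>

definition row_sym :: "nat \<Rightarrow> nat list \<Rightarrow> (nat \<Rightarrow> nat) \<Rightarrow> 'k::comm_ring_1" where
  "row_sym m p = (\<lambda>\<sigma>. if \<sigma> \<in> row_group m p then 1 else 0)"

definition col_sym :: "nat \<Rightarrow> nat list \<Rightarrow> (nat \<Rightarrow> nat) \<Rightarrow> 'k::comm_ring_1" where
  "col_sym m p = (\<lambda>\<sigma>. if \<sigma> \<in> col_group m p then of_int (sign \<sigma>) else 0)"

lemma row_sym_in_galg: "row_sym m p \<in> galg m" and col_sym_in_galg: "col_sym m p \<in> galg m"
  by (auto simp: galg_def row_sym_def col_sym_def row_group_def col_group_def)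

lemma finite_fibre_perms: "finite (fibre_perms m f)"
  by (rule finite_subset[OF _ finite_perms[of m]]) (auto simp: fibre_perms_def)

lemma young_sym_eq: "young_sym m p = gmul m (row_sym m p) (col_sym m p)"
proof
  fix \<sigma>
  have "gmul m (row_sym m p) (col_sym m p) \<sigma> = (\<Sum>r\<in>row_group m p. col_sym m p (inv r \<circ> \<sigma>))"
    unfolding gmul_def by (rule sum.mono_neutral_cong_right)
      (auto simp: row_sym_def row_group_def finite_permutations)
  also have "\<dots> = young_sym m p \<sigma>"
    unfolding young_sym_def
  proof (rule sum.cong[OF refl])
    fix r assume "r \<in> row_group m p"
    then have "r \<in> perms m" by (simp add: row_group_def)
    then have "r \<circ> q = \<sigma> \<longleftrightarrow> q = inv r \<circ> \<sigma>" for q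
      using perms_inv_eq_iff by metis
    then show "col_sym m p (inv r \<circ> \<sigma>) = (\<Sum>q\<in>col_group m p. if r \<circ> q = \<sigma> then of_int (sign q) else 0)"
      by (simp add: col_sym_def col_group_eq finite_fibre_perms)
  qed
  finally show "young_sym m p \<sigma> = gmul m (row_sym m p) (col_sym m p) \<sigma>" ..
qed

lemma young_sym_in_galg: "young_sym m p \<in> galg m"
  unfolding young_sym_eq by (rule gmul_in_galg[OF col_sym_in_galg])

lemma sign_perms_compose: "\<sigma> \<in> perms m \<Longrightarrow> \<tau> \<in> perms m \<Longrightarrow> sign (\<sigma> \<circ> \<tau>) = sign \<sigma> * sign \<tau>"
  by (rule sign_compose) (auto intro: permutes_imp_permutation)

lemma sign_perms_inv: "\<sigma> \<in> perms m \<Longrightarrow> sign (inv \<sigma>) = sign \<sigma>"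
  by (rule sign_inverse) (auto intro: permutes_imp_permutation)

lemma gstar_row_sym: "gstar m (row_sym m p) = row_sym m p"
  by (auto simp: gstar_def row_sym_def fun_eq_iff row_group_eq fibre_perms_inv_iff[simplified] dest: fibre_perms_perms)

lemma gstar_col_sym: "gstar m (col_sym m p) = col_sym m p"
  by (auto simp: gstar_def col_sym_def fun_eq_iff col_group_eq fibre_perms_inv_iff[simplified] sign_perms_inv[simplified]
      dest: fibre_perms_perms)

lemma gmul_row_sym_invariant:
  assumes "r \<in> row_group m p"
  shows "gmul m (row_sym m p) x (r \<circ> \<sigma>) = gmul m (row_sym m p) x \<sigma>"
proof -
  have r: "r \<in> perms m" "r \<in> fibre_perms m (rowof p)" using assms fibre_perms_perms by (auto simp only: row_group_eq)
  have "gmul m (row_sym m p) x (r \<circ> \<sigma>) = (\<Sum>\<pi>\<in>perms m. row_sym m p (r \<circ> \<pi>) * x (inv (r \<circ> \<pi>) \<circ> (r \<circ> \<sigma>)))"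
    unfolding gmul_def by (rule sum_perms_left[OF r(1), symmetric])
  also have "\<dots> = (\<Sum>\<pi>\<in>perms m. row_sym m p \<pi> * x (inv \<pi> \<circ> \<sigma>))"
  proof (rule sum.cong[OF refl])
    fix \<pi> assume \<pi>: "\<pi> \<in> perms m"
    have "inv (r \<circ> \<pi>) \<circ> (r \<circ> \<sigma>) = inv \<pi> \<circ> \<sigma>"
      unfolding perms_inv_compose[OF r(1) \<pi>] comp_assoc perms_inv_o_cancel(1)[OF r(1)] ..
    then show "row_sym m p (r \<circ> \<pi>) * x (inv (r \<circ> \<pi>) \<circ> (r \<circ> \<sigma>)) = row_sym m p \<pi> * x (inv \<pi> \<circ> \<sigma>)"
      by (simp add: row_sym_def row_group_eq fibre_perms_compose_left_iff[OF r(2)])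
  qed
  finally show ?thesis by (simp add: gmul_def)
qed

lemma gmul_col_sym_invariant:
  assumes "s \<in> col_group m p" and \<sigma>: "\<sigma> \<in> perms m"
  shows "gmul m x (col_sym m p) (\<sigma> \<circ> s) = of_int (sign s) * gmul m x (col_sym m p) \<sigma>"
proof -
  have s: "s \<in> perms m" "s \<in> fibre_perms m (colof p)" using assms fibre_perms_perms by (auto simp only: col_group_eq)
  have "col_sym m p (inv \<pi> \<circ> (\<sigma> \<circ> s)) = of_int (sign s) * (col_sym m p (inv \<pi> \<circ> \<sigma>) :: 'a)"
    if "\<pi> \<in> perms m" for \<pi>
    using fibre_perms_compose_right_iff[OF s(2), of "inv \<pi> \<circ> \<sigma>"] sign_perms_compose[OF perms_compose[OF perms_inv[OF that] \<sigma>] s(1)]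
    by (simp add: col_sym_def col_group_eq comp_assoc)
  then show ?thesis unfolding gmul_def sum_distrib_left
    by (intro sum.cong) (simp_all add: mult.left_commute)
qed

text \<open>If two entries share a row and a column, the transposition exchanging them yields \<open>y \<sigma> = - y \<sigma>\<close>.\<close>
lemma row_col_dichotomy:
  fixes y :: "(nat \<Rightarrow> nat) \<Rightarrow> 'k::{idom,ring_char_0}"
  assumes p: "is_partition m p" and q: "is_partition m q"
    and left: "\<And>r \<sigma>. r \<in> row_group m p \<Longrightarrow> \<sigma> \<in> perms m \<Longrightarrow> y (r \<circ> \<sigma>) = y \<sigma>"
    and right: "\<And>s \<sigma>. s \<in> col_group m q \<Longrightarrow> \<sigma> \<in> perms m \<Longrightarrow> y (\<sigma> \<circ> s) = of_int (sign s) * y \<sigma>"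
    and \<sigma>: "\<sigma> \<in> perms m"
  shows "y \<sigma> = 0 \<or> inj_on (\<lambda>k. (rowof p k, colof q (inv \<sigma> k))) {..<m}"
proof (cases "inj_on (\<lambda>k. (rowof p k, colof q (inv \<sigma> k))) {..<m}")
  assume "\<not> inj_on (\<lambda>k. (rowof p k, colof q (inv \<sigma> k))) {..<m}"
  then obtain k l where kl: "k < m" "l < m" "k \<noteq> l" "rowof p k = rowof p l" "colof q (inv \<sigma> k) = colof q (inv \<sigma> l)"
    by (auto simp: inj_on_def)
  have inv_less: "inv \<sigma> k < m" "inv \<sigma> l < m"
    using kl permutes_in_image[OF permutes_inv[of \<sigma> "{..<m}"]] \<sigma> by auto
  let ?t = "transpose k l" and ?s = "transpose (inv \<sigma> k) (inv \<sigma> l)"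
  have t: "?t \<in> row_group m p" and s: "?s \<in> col_group m q"
    using kl inv_less by (auto simp: row_group_eq col_group_eq intro: transpose_in_fibre_perms)
  have ne: "inv \<sigma> k \<noteq> inv \<sigma> l"
    using kl \<sigma> by (metis mem_Collect_eq permutes_inverses(1))
  have eq: "?t \<circ> \<sigma> = \<sigma> \<circ> ?s"
    using \<sigma> by (intro ext, unfold comp_apply mem_Collect_eq) (rule transpose_apply_commute[OF permutes_bij])
  have "y \<sigma> = y (\<sigma> \<circ> ?s)" unfolding eq[symmetric] by (rule left[OF t \<sigma>, symmetric])
  also have "\<dots> = - y \<sigma>" using right[OF s \<sigma>] ne by (simp add: sign_swap_id)
  finally have "2 * y \<sigma> = 0" using mult_2[of "y \<sigma>"] add.left_inverse[of "y \<sigma>"] by argo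
  then show ?thesis by simp
qed simp

lemma colof_inv_fibre_card:
  assumes "\<sigma> \<in> perms m"
  shows "card {k\<in>{..<m}. colof q (inv \<sigma> k) = j} = card {k\<in>{..<m}. colof q k = j}"
proof -
  have "bij_betw (inv \<sigma>) {k\<in>{..<m}. colof q (inv \<sigma> k) = j} {k\<in>{..<m}. colof q k = j}"
    using assms permutes_in_image[of \<sigma> "{..<m}"] permutes_in_image[OF permutes_inv[of \<sigma> "{..<m}"]]
    by (intro bij_betwI[of _ _ _ \<sigma>]) (auto simp: permutes_inverses)
  then show ?thesis by (rule bij_betw_same_card)
qed

text \<open>If \<open>y \<sigma>\<close> were nonzero, no two entries would share a row of
  \<open>p\<close> and a column of \<open>q\<close> moved by \<open>\<sigma>\<close>. Counting by
  columns then puts at most as many entries into the first \<open>r\<close> rows of \<open>p\<close>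
  as into those of \<open>q\<close>, contrary to \<open>gt\<close>.\<close>

lemma row_col_vanish:
  fixes y :: "(nat \<Rightarrow> nat) \<Rightarrow> 'k::{idom,ring_char_0}"
  assumes p: "is_partition m p" and q: "is_partition m q" and y: "y \<in> galg m"
    and left: "\<And>r \<sigma>. r \<in> row_group m p \<Longrightarrow> \<sigma> \<in> perms m \<Longrightarrow> y (r \<circ> \<sigma>) = y \<sigma>"
    and right: "\<And>s \<sigma>. s \<in> col_group m q \<Longrightarrow> \<sigma> \<in> perms m \<Longrightarrow> y (\<sigma> \<circ> s) = of_int (sign s) * y \<sigma>"
    and gt: "sum_list (take r q) < sum_list (take r p)"
  shows "y = (\<lambda>_. 0)"
proof
  fix \<sigma>
  show "y \<sigma> = 0"
  proof (cases "\<sigma> \<in> perms m")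
    case True
    have "\<not> inj_on (\<lambda>k. (rowof p k, colof q (inv \<sigma> k))) {..<m}"
    proof
      assume "inj_on (\<lambda>k. (rowof p k, colof q (inv \<sigma> k))) {..<m}"
      from filling_rows_le[OF _ this inj_row_col[OF q], of r]
      have "card {k \<in> {..<m}. rowof p k < r} \<le> card {k \<in> {..<m}. rowof q k < r}"
        using diagram_downclosed[OF q] colof_inv_fibre_card[OF True] by (simp add: Bex_def)
      then show False using gt by (simp only: card_rowof_less[OF p] card_rowof_less[OF q])
    qed
    then show ?thesis using row_col_dichotomy[OF p q left right True] by blast
  qed (rule galgD[OF y])
qed

text \<open>Without collisions, the row of \<open>k\<close> and the column of
  \<open>inv \<sigma> k\<close> always meet in a cell of the diagram. Sending \<open>k\<close> to
  that cell is a row permutation \<open>\<tau>\<close>, and \<open>\<tau> \<circ> \<sigma>\<close>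
  preserves columns, so \<open>\<sigma>\<close> is the product of \<open>inv \<tau>\<close> and
  \<open>\<tau> \<circ> \<sigma>\<close>.\<close>

lemma row_col_factor:
  assumes p: "is_partition m p" and \<sigma>: "\<sigma> \<in> perms m"
    and inj: "inj_on (\<lambda>k. (rowof p k, colof p (inv \<sigma> k))) {..<m}"
  obtains r s where "r \<in> row_group m p" "s \<in> col_group m p" "\<sigma> = r \<circ> s"
proof -
  have ex: "\<exists>l<m. rowof p l = rowof p k \<and> colof p l = colof p (inv \<sigma> k)" if "k < m" for k
    using filling_in_diagram[OF _ inj inj_row_col[OF p], of k] diagram_downclosed[OF p] colof_inv_fibre_card[OF \<sigma>] that
    by (simp add: Bex_def)
  define \<tau> where "\<tau> k = (if k < m then SOME l. l < m \<and> rowof p l = rowof p k \<and> colof p l = colof p (inv \<sigma> k) else k)" for k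
  have \<tau>: "\<tau> k < m" "rowof p (\<tau> k) = rowof p k" "colof p (\<tau> k) = colof p (inv \<sigma> k)" if "k < m" for k
    using someI_ex[OF ex[OF that]] that unfolding \<tau>_def by auto
  have "inj_on \<tau> {..<m}"
  proof (rule inj_onI)
    fix k l assume "k \<in> {..<m}" "l \<in> {..<m}" "\<tau> k = \<tau> l"
    then show "k = l" using \<tau>[of k] \<tau>[of l] inj by (auto simp: inj_on_def)
  qed
  moreover have "\<tau> ` {..<m} \<subseteq> {..<m}" using \<tau> by auto
  ultimately have "bij_betw \<tau> {..<m} {..<m}"
    by (simp add: bij_betw_def endo_inj_surj)
  then have perm: "\<tau> permutes {..<m}" by (rule bij_imp_permutes) (auto simp: \<tau>_def)
  have r: "\<tau> \<in> row_group m p" using perm \<tau> by (simp add: row_group_def)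
  have "\<tau> \<circ> \<sigma> \<in> perms m" using perm \<sigma> by (simp add: permutes_compose)
  moreover have "colof p (\<tau> (\<sigma> k)) = colof p k" if "k < m" for k
    using \<tau>(3)[of "\<sigma> k"] that \<sigma> permutes_in_image[of \<sigma> "{..<m}" k] by (simp add: permutes_inverses)
  ultimately have s: "\<tau> \<circ> \<sigma> \<in> col_group m p" by (simp add: col_group_def)
  show ?thesis
  proof
    show "inv \<tau> \<in> row_group m p" using r fibre_perms_inv by (simp add: row_group_eq)
    show "\<sigma> = inv \<tau> \<circ> (\<tau> \<circ> \<sigma>)" using perm perms_inv_o_cancel(1)[of \<tau> m \<sigma>] by simp
  qed (rule s)
qed

lemma row_col_inter: "is_partition m p \<Longrightarrow> \<sigma> \<in> row_group m p \<Longrightarrow> \<sigma> \<in> col_group m p \<Longrightarrow> \<sigma> = id"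
proof
  fix k
  assume p: "is_partition m p" and \<sigma>: "\<sigma> \<in> row_group m p" "\<sigma> \<in> col_group m p"
  show "\<sigma> k = id k"
  proof (cases "k < m")
    case True
    then have "\<sigma> k < m" using \<sigma>(1) permutes_in_image[of \<sigma> "{..<m}" k] by (simp add: row_group_def)
    then show ?thesis using True \<sigma> inj_row_col[OF p] by (auto simp: inj_on_def row_group_def col_group_def)
  next
    case False
    then show ?thesis using \<sigma> by (auto simp: row_group_def permutes_def)
  qed
qed

text \<open>Row and column group meet only in the identity. This normalises c: a multiple of c is
  identified by its coefficient at the identity.\<close>

lemma young_sym_id:
  assumes "is_partition m p"
  shows "young_sym m p id = 1"
proof -
  have "row_sym m p \<pi> * col_sym m p (inv \<pi>) = (if \<pi> = id then 1 else 0 :: 'a)" if "\<pi> \<in> perms m" for \<pi>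
    using row_col_inter[OF assms, of \<pi>] fibre_perms_inv_iff[OF that, of "colof p"] fibre_perms_id[of m]
    by (auto simp: row_sym_def col_sym_def row_group_eq col_group_eq)
  then have "young_sym m p id = (\<Sum>\<pi>\<in>perms m. if \<pi> = id then 1 else 0 :: 'a)"
    unfolding young_sym_eq gmul_at_id by (intro sum.cong) auto
  then show ?thesis using perms_id[of m] by (simp add: finite_permutations)
qed

text \<open>The left side is invariant under rows and alternating under columns. By the dichotomy it
  vanishes unless \<open>\<sigma> = r \<circ> s\<close> with \<open>r\<close> in the row and
  \<open>s\<close> in the column group, and there it equals \<open>sign s\<close> times its value at
  the identity. The Young symmetrizer is the function of this kind with value 1 at the
  identity.\<close>

lemma row_col_multiple:
  fixes x :: "(nat \<Rightarrow> nat) \<Rightarrow> 'k::{idom,ring_char_0}"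
  assumes p: "is_partition m p"
  shows "gmul m (row_sym m p) (gmul m x (col_sym m p)) =
    (\<lambda>\<sigma>. gmul m (row_sym m p) (gmul m x (col_sym m p)) id * young_sym m p \<sigma>)"
proof -
  have ra: "gmul m (row_sym m p) z (r \<circ> \<sigma>) = gmul m (row_sym m p) z \<sigma>" if "r \<in> row_group m p"
    for r \<sigma> and z :: "(nat \<Rightarrow> nat) \<Rightarrow> 'k" using gmul_row_sym_invariant[OF that] .
  have cb: "gmul m (row_sym m p) (gmul m z (col_sym m p)) (\<sigma> \<circ> s) = of_int (sign s) * gmul m (row_sym m p) (gmul m z (col_sym m p)) \<sigma>"
    if "s \<in> col_group m p" "\<sigma> \<in> perms m" for s \<sigma> and z :: "(nat \<Rightarrow> nat) \<Rightarrow> 'k"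
    unfolding gmul_assoc[symmetric] using gmul_col_sym_invariant[OF that] .
  have cc: "young_sym m p (\<sigma> \<circ> s) = of_int (sign s) * (young_sym m p \<sigma> :: 'k)"
    if "s \<in> col_group m p" "\<sigma> \<in> perms m" for s \<sigma>
    unfolding young_sym_eq using gmul_col_sym_invariant[OF that] .
  let ?y = "gmul m (row_sym m p) (gmul m x (col_sym m p))"
  have "?y \<sigma> = ?y id * young_sym m p \<sigma>" for \<sigma>
  proof (cases "\<sigma> \<in> perms m")
    case True
    show ?thesis
    proof (cases "inj_on (\<lambda>k. (rowof p k, colof p (inv \<sigma> k))) {..<m}")
      case inj: True
      obtain r s where rs: "r \<in> row_group m p" "s \<in> col_group m p" "\<sigma> = r \<circ> s"
        using row_col_factor[OF p True inj] .
      have "?y \<sigma> = of_int (sign s) * ?y id"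
        unfolding rs(3) ra[OF rs(1)] using cb[OF rs(2) perms_id, of x] by simp
      moreover have "young_sym m p \<sigma> = (of_int (sign s) :: 'k)"
        using ra[OF rs(1), of "col_sym m p" s] cc[OF rs(2) perms_id] young_sym_id[OF p, where 'a='k]
        unfolding rs(3) young_sym_eq by simp
      ultimately show ?thesis by simp
    next
      case False
      have "?y \<sigma> = 0 \<or> inj_on (\<lambda>k. (rowof p k, colof p (inv \<sigma> k))) {..<m}"
        by (rule row_col_dichotomy[OF p p _ _ True]) (erule ra, erule (1) cb)
      with False have "?y \<sigma> = 0" by blast
      moreover have "young_sym m p \<sigma> = (0 :: 'k) \<or> inj_on (\<lambda>k. (rowof p k, colof p (inv \<sigma> k))) {..<m}"
        by (rule row_col_dichotomy[OF p p _ _ True]) (unfold young_sym_eq, erule ra, fold young_sym_eq, erule (1) cc)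
      with False have "young_sym m p \<sigma> = (0 :: 'k)" by blast
      ultimately show ?thesis by simp
    qed
  next
    case False
    have "?y \<sigma> = 0" "young_sym m p \<sigma> = (0 :: 'k)"
      by (rule galgD[OF _ False], intro gmul_in_galg col_sym_in_galg young_sym_in_galg)+
    then show ?thesis by simp
  qed
  then show ?thesis by blast
qed

lemma partition_eqI:
  assumes p: "is_partition m p" and q: "is_partition m q"
    and eq: "\<And>r. sum_list (take r p) = sum_list (take r q)"
  shows "p = q"
proof -
  have aux: "length q \<le> length p" if "is_partition m p" "is_partition m q" "\<And>r. sum_list (take r p) = sum_list (take r q)" for p q
  proof (rule ccontr)
    assume "\<not> length q \<le> length p"
    then have less: "length p < length q" by simp
    have "sum_list (take (length p) q) = m" "sum_list (take (Suc (length p)) q) = m"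
      using that(3)[of "length p"] that(3)[of "Suc (length p)"] that(1) by (auto simp: is_partition_def)
    \<comment> \<open>The partial sums of \<open>q\<close> have already reached \<open>m\<close>, so
      a further part would be zero, which partitions exclude.\<close>
    then have "q ! length p = 0" using less by (simp add: take_Suc_conv_app_nth)
    then show False using that(2) less by (metis is_partition_def nth_mem)
  qed
  have len: "length p = length q" using aux[OF p q eq] aux[OF q p eq[symmetric]] by simp
  show ?thesis
  proof (rule nth_equalityI[OF len])
    fix i assume "i < length p"
    then show "p ! i = q ! i" using eq[of i] eq[of "Suc i"] len by (simp add: take_Suc_conv_app_nth)
  qed
qed

text \<open>Write the product as \<open>a_p b_p x a_q b_q\<close>. If some partial sum of
  \<open>p\<close> exceeds that of \<open>q\<close>, then \<open>a_p z b_q = 0\<close> for all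
  \<open>z\<close>. In the opposite case the middle part \<open>b_p x a_q\<close> already vanishes,
  because \<open>gstar\<close> turns it into a product of the form \<open>a_q z b_p\<close>.\<close>

lemma young_sym_orthogonal:
  fixes x :: "(nat \<Rightarrow> nat) \<Rightarrow> 'k::{idom,ring_char_0}"
  assumes p: "is_partition m p" and q: "is_partition m q" and "p \<noteq> q" and x: "x \<in> galg m"
  shows "gmul m (gmul m (young_sym m p) x) (young_sym m q) = (\<lambda>_. 0)"
proof -
  have van: "gmul m (row_sym m p) (gmul m z (col_sym m q)) = (\<lambda>_. 0)"
    if "is_partition m p" "is_partition m q" "sum_list (take r q) < sum_list (take r p)"
    for p q r and z :: "(nat \<Rightarrow> nat) \<Rightarrow> 'k"
  proof (rule row_col_vanish[OF that(1,2) _ _ _ that(3)])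
    show "gmul m (row_sym m p) (gmul m z (col_sym m q)) \<in> galg m"
      by (intro gmul_in_galg col_sym_in_galg)
  next
    show "gmul m (row_sym m p) (gmul m z (col_sym m q)) (r \<circ> \<sigma>) = gmul m (row_sym m p) (gmul m z (col_sym m q)) \<sigma>"
      if "r \<in> row_group m p" for r \<sigma> using gmul_row_sym_invariant[OF that] .
  next
    show "gmul m (row_sym m p) (gmul m z (col_sym m q)) (\<sigma> \<circ> s) =
        of_int (sign s) * gmul m (row_sym m p) (gmul m z (col_sym m q)) \<sigma>"
      if "s \<in> col_group m q" "\<sigma> \<in> perms m" for s \<sigma>
      unfolding gmul_assoc[symmetric] using gmul_col_sym_invariant[OF that] .
  qed
  obtain r where "sum_list (take r p) \<noteq> sum_list (take r q)" using partition_eqI[OF p q] assms(3) by blast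
  then consider "sum_list (take r q) < sum_list (take r p)" | "sum_list (take r p) < sum_list (take r q)"
    by linarith
  then show ?thesis
  proof cases
    case 1
    have "gmul m (gmul m (young_sym m p) x) (young_sym m q) =
      gmul m (row_sym m p) (gmul m (gmul m (gmul m (col_sym m p) x) (row_sym m q)) (col_sym m q))"
      by (simp add: young_sym_eq gmul_assoc)
    then show ?thesis using van[OF p q 1] by simp
  next
    case 2
    let ?y = "gmul m (gmul m (col_sym m p) x) (row_sym m q)"
    have y: "?y \<in> galg m" by (intro gmul_in_galg row_sym_in_galg)
    have "gstar m ?y = gmul m (row_sym m q) (gmul m (gstar m x) (col_sym m p))"
      using x by (simp add: gstar_gmul gmul_in_galg row_sym_in_galg col_sym_in_galg gstar_row_sym gstar_col_sym)
    also have "\<dots> = (\<lambda>_. 0)" by (rule van[OF q p 2])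
    finally have st: "gstar m ?y = (\<lambda>_. 0)" .
    have "?y \<sigma> = 0" for \<sigma>
    proof (cases "\<sigma> \<in> perms m")
      case True
      then show ?thesis using fun_cong[OF st, of "inv \<sigma>"] by (simp add: gstar_def permutes_inv permutes_inv_inv)
    qed (rule galgD[OF y])
    then have "?y = (\<lambda>_. 0)" by blast
    then have "gmul m (row_sym m p) (gmul m ?y (col_sym m q)) = (\<lambda>_. 0)"
      by (simp add: gmul_zero_left gmul_zero_right)
    then show ?thesis by (simp add: young_sym_eq gmul_assoc)
  qed
qed

lemma young_sym_sandwich:
  fixes x :: "(nat \<Rightarrow> nat) \<Rightarrow> 'k::{idom,ring_char_0}"
  assumes p: "is_partition m p"
  shows "gmul m (gmul m (young_sym m p) x) (young_sym m p) =
    (\<lambda>\<sigma>. gmul m (gmul m (young_sym m p) x) (young_sym m p) id * young_sym m p \<sigma>)"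
  using row_col_multiple[OF p, of "gmul m (gmul m (col_sym m p) x) (row_sym m p)"]
  by (simp add: young_sym_eq gmul_assoc)

lemma row_sym_square:
  "gmul m (row_sym m p) (row_sym m p) = (\<lambda>\<sigma>. of_nat (card (row_group m p)) * (row_sym m p \<sigma> :: 'k::comm_ring_1))"
proof
  fix \<sigma>
  have "gmul m (row_sym m p) (row_sym m p) \<sigma> = (\<Sum>r\<in>row_group m p. row_sym m p (inv r \<circ> \<sigma>) :: 'k)"
    unfolding gmul_def by (rule sum.mono_neutral_cong_right)
      (auto simp: row_sym_def row_group_def finite_permutations)
  also have "\<dots> = (\<Sum>r\<in>row_group m p. row_sym m p \<sigma>)"
    by (rule sum.cong) (auto simp: row_sym_def row_group_eq fibre_perms_compose_left_iff[OF fibre_perms_inv])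
  also have "\<dots> = of_nat (card (row_group m p)) * row_sym m p \<sigma>" by (rule sum_constant)
  finally show "gmul m (row_sym m p) (row_sym m p) \<sigma> = of_nat (card (row_group m p)) * (row_sym m p \<sigma> :: 'k)" .
qed

text \<open>The scalar n with c c = n c, classically \<open>m!\<close> divided by the dimension of
  the Specht module. It is defined over any commutative ring so that it can be studied over the
  integers.\<close>

definition young_norm :: "nat \<Rightarrow> nat list \<Rightarrow> 'k::comm_ring_1" where
  "young_norm m p = gmul m (young_sym m p) (young_sym m p) id"

text \<open>With \<open>a\<close>, \<open>b\<close> the row and column symmetrizers, \<open>y = aba\<close> is fixed by the anti-involution \<open>gstar\<close>, so the
  coefficient of \<open>yy\<close> at the identity is a sum of squares; it is also a multiple of \<open>young_norm\<close>.\<close>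
lemma young_norm_int_nonzero:
  assumes p: "is_partition m p"
  shows "young_norm m p \<noteq> (0 :: int)"
proof -
  let ?a = "row_sym m p :: _ \<Rightarrow> int" and ?b = "col_sym m p :: _ \<Rightarrow> int" and ?N = "of_nat (card (row_group m p)) :: int"
  let ?y = "gmul m (gmul m ?a ?b) ?a"
  have aa: "gmul m ?a (gmul m ?a z) = (\<lambda>\<sigma>. ?N * gmul m ?a z \<sigma>)" for z
    by (simp add: row_sym_square gmul_scale_left flip: gmul_assoc)
  have "?y id = gmul m ?a (gmul m ?a ?b) id" by (rule gmul_trace)
  then have y1: "?y id = ?N"
    using young_sym_id[OF p, where 'a=int] by (simp add: aa young_sym_eq)
  have N: "?N > 0" using fibre_perms_id finite_fibre_perms by (fastforce simp: row_group_eq card_gt_0_iff)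
  have "gstar m ?y = ?y"
    by (simp add: gstar_gmul gmul_in_galg row_sym_in_galg col_sym_in_galg gstar_row_sym gstar_col_sym gmul_assoc)
  from fun_cong[OF this] have "?y \<pi> = ?y (inv \<pi>)" if "\<pi> \<in> perms m" for \<pi>
    using that unfolding gstar_def by metis
  then have "gmul m ?y ?y id = (\<Sum>\<pi>\<in>perms m. (?y \<pi>)\<^sup>2)"
    unfolding gmul_at_id by (intro sum.cong) (auto simp: power2_eq_square)
  also have "\<dots> > 0"
    by (rule sum_pos2[of _ id]) (use y1 N perms_id in auto)
  also have "gmul m ?y ?y id = ?N * gmul m (gmul m ?a (gmul m ?b (gmul m ?a ?b))) ?a id"
    by (simp add: gmul_assoc aa gmul_scale_right)
  also have "\<dots> = ?N * gmul m ?a (gmul m ?a (gmul m ?b (gmul m ?a ?b))) id"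
    by (subst gmul_trace) simp
  also have "\<dots> = ?N * (?N * young_norm m p)"
    by (simp only: aa) (simp add: young_norm_def young_sym_eq gmul_assoc)
  finally show ?thesis by auto
qed

text \<open>The sum-of-squares argument needs an ordered ring. The coefficients of c are integers,
  so the integral result passes to k through the embedding of the integers in characteristic
  zero.\<close>

lemma young_norm_nonzero:
  assumes "is_partition m p"
  shows "young_norm m p \<noteq> (0 :: 'k::field_char_0)"
proof -
  have "young_sym m p \<sigma> = (of_int (young_sym m p \<sigma>) :: 'k)" for \<sigma>
    by (simp add: young_sym_def of_int_sum if_distrib[of of_int] cong: if_cong)
  then have "young_norm m p = (of_int (young_norm m p) :: 'k)"
    by (simp add: young_norm_def gmul_def)
  then show ?thesis using young_norm_int_nonzero[OF assms] by (metis of_int_eq_0_iff)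
qed

lemma young_sym_square:
  assumes "is_partition m p"
  shows "gmul m (young_sym m p) (young_sym m p) = (\<lambda>\<sigma>. young_norm m p * (young_sym m p \<sigma> :: 'k::{idom,ring_char_0}))"
  using young_sym_sandwich[OF assms, of "gdelta id :: _ \<Rightarrow> 'k"]
  by (simp add: gmul_assoc gmul_gdelta_left[OF perms_id] young_norm_def)

section \<open>The identity as a combination of central elements\<close>

definition cycles_of_on :: "nat set \<Rightarrow> (nat \<Rightarrow> nat) \<Rightarrow> nat list list \<Rightarrow> bool" where
  "cycles_of_on T \<sigma> cs \<longleftrightarrow> distinct (concat cs) \<and> set (concat cs) = T \<and> [] \<notin> set cs \<and>
     (\<forall>c\<in>set cs. \<forall>i<length c. \<sigma> (c ! i) = c ! (Suc i mod length c))"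

lemma support_rotate:
  assumes "permutation \<sigma>" "i < length (support \<sigma> a)"
  shows "\<sigma> (support \<sigma> a ! i) = support \<sigma> a ! (Suc i mod length (support \<sigma> a))"
proof (cases "Suc i < length (support \<sigma> a)")
  case False
  then have "Suc i = least_power \<sigma> a" using assms by simp
  then have "\<sigma> ((\<sigma> ^^ i) a) = a"
    using least_power_of_permutation(1)[OF assms(1), of a] by (metis comp_apply funpow.simps(2))
  then show ?thesis using \<open>Suc i = least_power \<sigma> a\<close> assms by simp
qed (use assms in simp)

text \<open>Induction by splitting off one orbit. The rest of \<open>T\<close> stays invariant
  because the orbit also contains all preimages of its points.\<close>

lemma cycles_exist:
  assumes "permutation \<sigma>" "finite T" "\<sigma> ` T \<subseteq> T"
  shows "\<exists>cs. cycles_of_on T \<sigma> cs"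
  using assms(2,3)
proof (induction "card T" arbitrary: T rule: less_induct)
  case less
  show ?case
  proof (cases "T = {}")
    case True
    then show ?thesis by (intro exI[of _ "[]"]) (simp add: cycles_of_on_def)
  next
    case False
    then obtain a where a: "a \<in> T" by blast
    define c where "c = support \<sigma> a"
    note lp = least_power_of_permutation[OF assms(1), of a]
    have setc: "set c = range (\<lambda>i. (\<sigma> ^^ i) a)"
      unfolding c_def by (rule support_set[OF assms(1)])
    have "(\<sigma> ^^ i) a \<in> T" for i using a less.prems(2) by (induction i) auto
    then have sub: "set c \<subseteq> T" unfolding setc by blast
    have ac: "a \<in> set c" unfolding setc by (metis funpow_0 rangeI)
    have preimage: "x \<in> set c" if x: "\<sigma> x \<in> set c" for x
    proof -
      obtain i where i: "\<sigma> x = (\<sigma> ^^ i) a" using x unfolding setc by blast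
      \<comment> \<open>For exponent 0 the period of the orbit supplies a positive exponent instead,
        so that one application of \<open>\<sigma>\<close> can be cancelled.\<close>
      obtain j where j: "\<sigma> x = (\<sigma> ^^ Suc j) a"
      proof (cases i)
        case 0
        then show ?thesis using i lp that[of "least_power \<sigma> a - 1"] by simp
      qed (use i that in blast)
      have "inj \<sigma>" using assms(1) by (simp add: permutation_bijective bij_is_inj)
      then have "x = (\<sigma> ^^ j) a" using j by (simp add: inj_eq)
      then show ?thesis unfolding setc by blast
    qed
    have "\<sigma> ` (T - set c) \<subseteq> T - set c" using less.prems(2) preimage by auto
    moreover have "card (T - set c) < card T"
      using less.prems(1) a ac by (intro psubset_card_mono) auto
    ultimately obtain cs where cs: "cycles_of_on (T - set c) \<sigma> cs" using less.hyps less.prems(1) by blast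
    have "distinct c" unfolding c_def by (rule cycle_of_permutation[OF assms(1)])
    moreover have "\<forall>i<length c. \<sigma> (c ! i) = c ! (Suc i mod length c)"
      using support_rotate[OF assms(1)] unfolding c_def by blast
    moreover have "c \<noteq> []" using ac by auto
    ultimately have "cycles_of_on T \<sigma> (c # cs)" using cs sub by (auto simp: cycles_of_on_def)
    then show ?thesis by blast
  qed
qed

definition has_cycle_type :: "nat \<Rightarrow> (nat \<Rightarrow> nat) \<Rightarrow> nat list \<Rightarrow> bool" where
  "has_cycle_type m \<sigma> p \<longleftrightarrow> (\<exists>cs. cycles_of_on {..<m} \<sigma> cs \<and> map length cs = p)"

lemma cycle_type_exists:
  assumes "\<sigma> \<in> perms m"
  shows "\<exists>p. is_partition m p \<and> has_cycle_type m \<sigma> p"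
proof -
  have "permutation \<sigma>" using assms by (auto intro: permutes_imp_permutation)
  moreover have "\<sigma> ` {..<m} \<subseteq> {..<m}" using assms permutes_image by auto
  ultimately obtain cs where cs: "cycles_of_on {..<m} \<sigma> cs" using cycles_exist by blast
  \<comment> \<open>Parts of a partition decrease weakly, so the cycles are listed by decreasing
    length.\<close>
  define ds where "ds = rev (sort_key length cs)"
  have mset: "mset ds = mset cs" by (simp add: ds_def)
  have "mset (concat xs) = \<Sum>\<^sub># (image_mset mset (mset xs))" for xs :: "nat list list"
    by (induction xs) auto
  then have "mset (concat ds) = mset (concat cs)" by (simp only: mset)
  then have "distinct (concat ds)" using cs mset_eq_imp_distinct_iff cycles_of_on_def by blast
  moreover have "set ds = set cs" using mset by (rule mset_eq_setD)
  ultimately have ds: "cycles_of_on {..<m} \<sigma> ds" using cs by (auto simp: cycles_of_on_def)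
  have "length (concat ds) = m"
    using ds distinct_card[of "concat ds"] by (simp add: cycles_of_on_def)
  then have "sum_list (map length ds) = m" by (simp add: length_concat)
  moreover have "0 \<notin> set (map length ds)" using ds by (auto simp: cycles_of_on_def)
  moreover have "sorted (rev (map length ds))" by (simp add: ds_def rev_map)
  then have "map length ds ! Suc i \<le> map length ds ! i" if "Suc i < length (map length ds)" for i
    using sorted_rev_nth_mono[of "map length ds" i "Suc i"] that by simp
  ultimately have "is_partition m (map length ds)" by (simp add: is_partition_def)
  then show ?thesis using ds by (auto simp: has_cycle_type_def)
qed

lemma concat_index:
  assumes "x \<in> set (concat cs)"
  obtains a i where "a < length cs" "i < length (cs ! a)" "x = cs ! a ! i"
proof -
  obtain c where "c \<in> set cs" "x \<in> set c" using assms by auto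
  then show ?thesis using that by (metis in_set_conv_nth)
qed

lemma nth_concat:
  assumes "a < length xss" "i < length (xss ! a)"
  shows "sum_list (map length (take a xss)) + i < length (concat xss)"
    and "concat xss ! (sum_list (map length (take a xss)) + i) = xss ! a ! i"
  using assms by (induction xss arbitrary: a) (auto simp: less_Suc_eq_0_disj nth_append)

text \<open>Write the cycles of both permutations one after the other and let \<open>g\<close> match
  the two lists position by position. As the lengths agree, \<open>g\<close> carries each cycle to a
  cycle and respects the cyclic successor.\<close>

lemma cycle_type_conjugate:
  assumes "\<sigma> \<in> perms m" "\<tau> \<in> perms m" "has_cycle_type m \<sigma> p" "has_cycle_type m \<tau> p"
  shows "\<exists>g\<in>perms m. \<tau> = g \<circ> \<sigma> \<circ> inv g"
proof -
  obtain cs ds where cs: "cycles_of_on {..<m} \<sigma> cs" and ds: "cycles_of_on {..<m} \<tau> ds"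
    and len: "map length cs = map length ds" using assms(3,4) by (auto simp: has_cycle_type_def)
  let ?F = "concat cs" and ?G = "concat ds"
  have F: "distinct ?F" "set ?F = {..<m}" and G: "distinct ?G" "set ?G = {..<m}"
    using cs ds by (auto simp only: cycles_of_on_def)
  have lF: "length ?F = m" and lG: "length ?G = m"
    using F G distinct_card[of ?F] distinct_card[of ?G] by simp_all
  define g where "g x = (if x < m then the (map_of (zip ?F ?G) x) else x)" for x
  have gnth: "g (?F ! k) = ?G ! k" if "k < m" for k
  proof -
    have "?F ! k < m" using F(2) lF that by (metis lessThan_iff nth_mem)
    then show ?thesis using map_of_zip_nth[of ?F ?G k] that F lF lG by (simp add: g_def)
  qed
  have "g ` {..<m} = {..<m}"
  proof -
    have "g ` {..<m} = g ` set ?F" using F by simp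
    also have "\<dots> = (\<lambda>k. g (?F ! k)) ` {..<m}" by (auto simp: set_conv_nth lF)
    also have "\<dots> = (\<lambda>k. ?G ! k) ` {..<m}" using gnth by auto
    also have "\<dots> = set ?G" by (auto simp: set_conv_nth lG)
    finally show ?thesis using G by simp
  qed
  then have "bij_betw g {..<m} {..<m}" by (simp add: bij_betw_def eq_card_imp_inj_on)
  then have g: "g permutes {..<m}" by (rule bij_imp_permutes) (simp add: g_def)
  have cell: "g (cs ! a ! i) = ds ! a ! i" if "a < length cs" "i < length (cs ! a)" for a i
  proof -
    have a: "a < length ds" "i < length (ds ! a)"
      using that len by (metis length_map, metis length_map nth_map)
    let ?k = "sum_list (map length (take a cs)) + i"
    have k: "?k = sum_list (map length (take a ds)) + i"
      using len by (metis take_map)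
    have "?F ! ?k = cs ! a ! i" "?G ! ?k = ds ! a ! i"
      using nth_concat(2)[OF that] nth_concat(2)[OF a] k by simp_all
    moreover have "?k < m" using nth_concat(1)[OF that] lF by simp
    ultimately show ?thesis using gnth by metis
  qed
  have "\<tau> \<circ> g = g \<circ> \<sigma>"
  proof
    fix x
    show "(\<tau> \<circ> g) x = (g \<circ> \<sigma>) x"
    proof (cases "x < m")
      case True
      then obtain a i where a: "a < length cs" "i < length (cs ! a)" "x = cs ! a ! i"
        using F(2) concat_index by (metis lessThan_iff)
      have l: "length (cs ! a) = length (ds ! a)" "a < length ds"
        using a(1) len by (metis length_map nth_map, metis length_map)
      have "\<tau> (g x) = \<tau> (ds ! a ! i)" using cell a by simp
      also have "\<dots> = ds ! a ! (Suc i mod length (ds ! a))"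
        using ds a l by (simp add: cycles_of_on_def)
      also have "\<dots> = g (cs ! a ! (Suc i mod length (cs ! a)))"
        using cell[OF a(1), of "Suc i mod length (cs ! a)"] a(2) l(1) by (metis less_nat_zero_code mod_less_divisor neq0_conv)
      also have "\<dots> = g (\<sigma> x)" using cs a by (simp add: cycles_of_on_def)
      finally show ?thesis by simp
    next
      case False
      then show ?thesis using assms(1,2) by (simp add: g_def permutes_def)
    qed
  qed
  then have "\<tau> \<circ> (g \<circ> inv g) = g \<circ> \<sigma> \<circ> inv g" by (metis comp_assoc)
  then have "\<tau> = g \<circ> \<sigma> \<circ> inv g" using g by (simp add: permutes_inv_o)
  then show ?thesis using g by blast
qed

lemma finite_partitions: "finite {p. is_partition m p}"
proof (rule finite_subset)
  have "length p \<le> sum_list p" if "0 \<notin> set p" for p :: "nat list"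
    using that by (induction p) (auto simp: Suc_le_eq)
  then show "{p. is_partition m p} \<subseteq> {p. set p \<subseteq> {..m} \<and> length p \<le> m}"
    using member_le_sum_list by (fastforce simp: is_partition_def)
qed (rule finite_lists_length_le, simp)

lemma sum_fun_apply: "(\<Sum>i\<in>A. f i) x = (\<Sum>i\<in>A. f i x :: 'b::comm_monoid_add)"
  by (induction A rule: infinite_finite_induct) auto

text \<open>A dimension count: as many independent vectors as there are spanning ones already span.
  Independence is assumed for the family indexed by \<open>P\<close>, so it also yields that
  \<open>z\<close> is injective on \<open>P\<close>.\<close>

lemma span_by_independent_family:
  fixes z e :: "'p \<Rightarrow> 'x \<Rightarrow> 'k::field"
  assumes P: "finite P"
    and z: "\<And>p. p \<in> P \<Longrightarrow> \<exists>c. z p = (\<lambda>x. \<Sum>q\<in>P. c q * e q x)"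
    and f: "f = (\<lambda>x. \<Sum>q\<in>P. c q * e q x)"
    and indep: "\<And>a p. (\<And>x. (\<Sum>p\<in>P. a p * z p x) = 0) \<Longrightarrow> p \<in> P \<Longrightarrow> a p = 0"
  shows "\<exists>A. f = (\<lambda>x. \<Sum>p\<in>P. A p * z p x)"
proof -
  interpret vs: vector_space "\<lambda>(c::'k) (f::'x \<Rightarrow> 'k) x. c * f x"
    by standard (auto simp: fun_eq_iff algebra_simps)
  have spanI: "(\<lambda>x. \<Sum>q\<in>P. c q * e q x) \<in> vs.span (e ` P)" for c
  proof -
    have "(\<lambda>x. \<Sum>q\<in>P. c q * e q x) = (\<Sum>q\<in>P. (\<lambda>x. c q * e q x))"
      by (simp add: fun_eq_iff sum_fun_apply)
    also have "\<dots> \<in> vs.span (e ` P)"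
      by (intro vs.span_sum vs.span_scale vs.span_base imageI)
    finally show ?thesis .
  qed
  have inj: "inj_on z P"
  proof (rule inj_onI, rule ccontr)
    fix p q assume pq: "p \<in> P" "q \<in> P" "z p = z q" "p \<noteq> q"
    \<comment> \<open>If two members coincided, the coefficients 1 and -1 would give a nontrivial
      relation.\<close>
    let ?a = "\<lambda>r. if r = p then 1 else if r = q then - 1 else 0 :: 'k"
    have "(\<Sum>r\<in>P. ?a r * z r x) = 0" for x
    proof -
      have "(\<Sum>r\<in>P. ?a r * z r x) = (\<Sum>r\<in>P. (if r = p then z p x else 0) - (if r = q then z q x else 0))"
        using pq by (intro sum.cong) auto
      then show ?thesis using pq P by (simp add: sum_subtractf)
    qed
    from indep[OF this pq(1)] show False by simp
  qed
  have ind: "vs.independent (z ` P)"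
  proof
    assume "vs.dependent (z ` P)"
    then obtain u v where u: "v \<in> z ` P" "u v \<noteq> 0" "(\<Sum>v\<in>z ` P. (\<lambda>x. u v * v x)) = 0"
      using vs.dependent_finite[of "z ` P"] P by auto
    have "(\<Sum>p\<in>P. u (z p) * z p x) = 0" for x
      using fun_cong[OF u(3), of x] by (simp add: sum_fun_apply sum.reindex[OF inj])
    from indep[OF this] u show False by auto
  qed
  have zs: "z ` P \<subseteq> vs.span (e ` P)" using z spanI by force
  have "f \<in> vs.span (z ` P)"
  proof (rule ccontr)
    assume nf: "f \<notin> vs.span (z ` P)"
    then have "vs.independent (insert f (z ` P))" using ind by (rule vs.independent_insertI)
    moreover have "insert f (z ` P) \<subseteq> vs.span (e ` P)" using zs spanI f by simp
    ultimately have "card (insert f (z ` P)) \<le> card (e ` P)"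
      using vs.independent_span_bound P by blast
    moreover have "f \<notin> z ` P" using nf vs.span_base by blast
    ultimately show False using P card_image[OF inj] card_image_le[OF P, of e] by simp
  qed
  then obtain u where "f = (\<Sum>v\<in>z ` P. (\<lambda>x. u v * v x))"
    using vs.span_finite[of "z ` P"] P by auto
  then have "f = (\<lambda>x. \<Sum>p\<in>P. u (z p) * z p x)"
    by (simp add: fun_eq_iff sum_fun_apply sum.reindex[OF inj])
  then show ?thesis by (rule exI[of _ "\<lambda>p. u (z p)"])
qed

section \<open>The central elements z_p and the identity of k[S_m]\<close>

definition young_central :: "nat \<Rightarrow> nat list \<Rightarrow> (nat \<Rightarrow> nat) \<Rightarrow> 'k::comm_ring_1" where
  "young_central m p = (\<lambda>\<sigma>. \<Sum>g\<in>perms m. gmul m (gmul m (gdelta g) (young_sym m p)) (gdelta (inv g)) \<sigma>)"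

lemma young_central_in_galg: "young_central m p \<in> galg m"
proof -
  have "gmul m (gmul m (gdelta g) (young_sym m p)) (gdelta (inv g)) \<in> galg m" if "g \<in> perms m" for g
    using that by (intro gmul_in_galg gdelta_in_galg perms_inv)
  then show ?thesis by (auto simp: young_central_def galg_def intro!: sum.neutral)
qed

lemma young_central_eq:
  "young_central m p \<sigma> = (\<Sum>g\<in>perms m. young_sym m p (inv g \<circ> (\<sigma> \<circ> g)))"
  unfolding young_central_def
proof (rule sum.cong[OF refl])
  fix g assume g: "g \<in> perms m"
  show "gmul m (gmul m (gdelta g) (young_sym m p)) (gdelta (inv g)) \<sigma> = young_sym m p (inv g \<circ> (\<sigma> \<circ> g))"
    unfolding gmul_gdelta_right[OF perms_inv[OF g] gmul_in_galg[OF young_sym_in_galg]]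
    unfolding gmul_gdelta_left[OF g] perms_inv_inv[OF g] ..
qed

lemma young_central_conjugate:
  assumes \<tau>: "\<tau> \<in> perms m"
  shows "young_central m p (\<tau> \<circ> \<sigma> \<circ> inv \<tau>) = young_central m p \<sigma>"
proof -
  have "young_central m p (\<tau> \<circ> \<sigma> \<circ> inv \<tau>) =
      (\<Sum>g\<in>perms m. young_sym m p (inv (\<tau> \<circ> g) \<circ> ((\<tau> \<circ> \<sigma> \<circ> inv \<tau>) \<circ> (\<tau> \<circ> g))))"
    unfolding young_central_eq by (rule sum_perms_left[OF \<tau>, symmetric])
  also have "\<dots> = young_central m p \<sigma>"
    unfolding young_central_eq
  proof (rule sum.cong[OF refl])
    fix g assume g: "g \<in> perms m"
    have "inv (\<tau> \<circ> g) \<circ> ((\<tau> \<circ> \<sigma> \<circ> inv \<tau>) \<circ> (\<tau> \<circ> g)) = inv g \<circ> (\<sigma> \<circ> g)"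
      unfolding perms_inv_compose[OF \<tau> g] comp_assoc perms_inv_o_cancel(1)[OF \<tau>] ..
    then show "young_sym m p (inv (\<tau> \<circ> g) \<circ> ((\<tau> \<circ> \<sigma> \<circ> inv \<tau>) \<circ> (\<tau> \<circ> g))) = young_sym m p (inv g \<circ> (\<sigma> \<circ> g))"
      by simp
  qed
  finally show ?thesis .
qed

lemma young_central_mult_other:
  assumes "is_partition m p" "is_partition m q" "p \<noteq> q"
  shows "gmul m (young_central m p) (young_sym m q) = (\<lambda>_. 0 :: 'k::{idom,ring_char_0})"
proof -
  have "gmul m (gmul m (gmul m (gdelta g) (young_sym m p)) (gdelta (inv g))) (young_sym m q) = (\<lambda>_. 0 :: 'k)"
    if "g \<in> perms m" for g
  proof -
    have "gmul m (gmul m (gmul m (gdelta g) (young_sym m p)) (gdelta (inv g))) (young_sym m q) =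
        gmul m (gdelta g) (gmul m (gmul m (young_sym m p) (gdelta (inv g))) (young_sym m q :: _ \<Rightarrow> 'k))"
      by (simp only: gmul_assoc)
    also have "\<dots> = (\<lambda>_. 0)"
      unfolding young_sym_orthogonal[OF assms gdelta_in_galg[OF perms_inv[OF that]]] gmul_zero_right ..
    finally show ?thesis .
  qed
  then show ?thesis unfolding young_central_def gmul_sum_left by simp
qed

text \<open>By the trace, \<open>c g^-1 c = n c(g) c\<close>. Hence the summand for \<open>g\<close>
  contributes \<open>n c(g)\<close> times the translate \<open>g c\<close>, and summing over
  \<open>g\<close> rebuilds \<open>n\<close> times the convolution \<open>c c\<close>.\<close>

lemma young_central_mult_same:
  assumes p: "is_partition m p"
  shows "gmul m (young_central m p) (young_sym m p) = (\<lambda>\<sigma>. (young_norm m p)\<^sup>2 * (young_sym m p \<sigma> :: 'k::{idom,ring_char_0}))"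
proof
  fix \<sigma>
  let ?c = "young_sym m p :: _ \<Rightarrow> 'k" and ?n = "young_norm m p :: 'k"
  have *: "gmul m (gmul m (gmul m (gdelta g) ?c) (gdelta (inv g))) ?c \<sigma> = ?n * (?c g * ?c (inv g \<circ> \<sigma>))"
    if g: "g \<in> perms m" for g
  proof -
    have "gmul m (gmul m ?c (gdelta (inv g))) ?c id = gmul m ?c (gmul m ?c (gdelta (inv g))) id"
      by (rule gmul_trace)
    also have "\<dots> = ?n * ?c g"
      unfolding gmul_assoc[symmetric] young_sym_square[OF p] gmul_scale_left
      unfolding gmul_gdelta_right[OF perms_inv[OF g] young_sym_in_galg] perms_inv_inv[OF g] by simp
    finally have "gmul m (gmul m ?c (gdelta (inv g))) ?c = (\<lambda>\<sigma>. ?n * ?c g * ?c \<sigma>)"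
      using young_sym_sandwich[OF p, of "gdelta (inv g) :: _ \<Rightarrow> 'k"] by metis
    moreover have "gmul m (gmul m (gmul m (gdelta g) ?c) (gdelta (inv g))) ?c =
        gmul m (gdelta g) (gmul m (gmul m ?c (gdelta (inv g))) ?c)"
      by (simp only: gmul_assoc)
    ultimately show ?thesis by (simp only: gmul_gdelta_left[OF g] mult.assoc)
  qed
  have "gmul m (young_central m p) ?c \<sigma> = (\<Sum>g\<in>perms m. ?n * (?c g * ?c (inv g \<circ> \<sigma>)))"
    unfolding young_central_def gmul_sum_left by (rule sum.cong[OF refl]) (rule *)
  also have "\<dots> = ?n * gmul m ?c ?c \<sigma>" by (simp add: gmul_def sum_distrib_left)
  finally show "gmul m (young_central m p) ?c \<sigma> = ?n\<^sup>2 * ?c \<sigma>"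
    by (simp add: young_sym_square[OF p] power2_eq_square)
qed

text \<open>\<open>ty\<close> selects a cycle type for each permutation. Permutations with the same
  selection are conjugate, so \<open>f\<close> is constant on the fibres of \<open>ty\<close>. For a
  partition that is not selected, the \<open>SOME\<close> is arbitrary, but its coefficient
  multiplies 0.\<close>

lemma class_function_span:
  fixes f :: "(nat \<Rightarrow> nat) \<Rightarrow> 'k::comm_ring_1"
  assumes f: "f \<in> galg m" "\<And>\<sigma> \<tau>. \<tau> \<in> perms m \<Longrightarrow> \<sigma> \<in> perms m \<Longrightarrow> f (\<tau> \<circ> \<sigma> \<circ> inv \<tau>) = f \<sigma>"
    and ty: "\<And>\<sigma>. \<sigma> \<in> perms m \<Longrightarrow> is_partition m (ty \<sigma>) \<and> has_cycle_type m \<sigma> (ty \<sigma>)"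
  shows "f = (\<lambda>\<sigma>. \<Sum>q\<in>{p. is_partition m p}. f (SOME \<tau>. \<tau> \<in> perms m \<and> ty \<tau> = q) * (if \<sigma> \<in> perms m \<and> ty \<sigma> = q then 1 else 0))"
proof
  fix \<sigma>
  let ?rep = "\<lambda>q. SOME \<tau>. \<tau> \<in> perms m \<and> ty \<tau> = q"
  show "f \<sigma> = (\<Sum>q\<in>{p. is_partition m p}. f (?rep q) * (if \<sigma> \<in> perms m \<and> ty \<sigma> = q then 1 else 0))"
  proof (cases "\<sigma> \<in> perms m")
    case True
    have r: "?rep (ty \<sigma>) \<in> perms m \<and> ty (?rep (ty \<sigma>)) = ty \<sigma>"
      by (rule someI[of _ \<sigma>]) (use True in simp)
    have "has_cycle_type m (?rep (ty \<sigma>)) (ty \<sigma>)"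
      using ty[OF conjunct1[OF r]] unfolding conjunct2[OF r] by (rule conjunct2)
    from cycle_type_conjugate[OF True conjunct1[OF r] conjunct2[OF ty[OF True]] this]
    obtain g where g: "g \<in> perms m" and eq: "?rep (ty \<sigma>) = g \<circ> \<sigma> \<circ> inv g" by (rule bexE)
    have "f (?rep (ty \<sigma>)) = f \<sigma>" unfolding eq by (rule f(2)[OF g True])
    moreover have "(\<Sum>q\<in>{p. is_partition m p}. f (?rep q) * (if \<sigma> \<in> perms m \<and> ty \<sigma> = q then 1 else 0)) =
        (\<Sum>q\<in>{p. is_partition m p}. if q = ty \<sigma> then f (?rep (ty \<sigma>)) else 0)"
      using True by (intro sum.cong) auto
    ultimately show ?thesis using ty[OF True] finite_partitions[of m] by simp
  next
    case False
    then show ?thesis using galgD[OF f(1)] by simp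
  qed
qed

lemma id_eq_sum_young_central:
  "\<exists>A. gdelta id = (\<lambda>\<sigma>. \<Sum>p\<in>{p. is_partition m p}. A p * (young_central m p \<sigma> :: 'k::field_char_0))"
proof -
  obtain ty where ty: "\<And>\<sigma>. \<sigma> \<in> perms m \<Longrightarrow> is_partition m (ty \<sigma>) \<and> has_cycle_type m \<sigma> (ty \<sigma>)"
    using someI_ex[OF cycle_type_exists] by (rule that[of "\<lambda>\<sigma>. SOME p. is_partition m p \<and> has_cycle_type m \<sigma> p"])
  show ?thesis
  proof (rule span_by_independent_family[OF finite_partitions])
    have "gdelta id (\<tau> \<circ> \<sigma> \<circ> inv \<tau>) = (gdelta id \<sigma> :: 'k)" if "\<tau> \<in> perms m" for \<sigma> \<tau>
    proof -
      have "\<sigma> = inv \<tau> \<circ> (\<tau> \<circ> \<sigma> \<circ> inv \<tau>) \<circ> \<tau>"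
        using that by (simp add: comp_assoc perms_inv_o_cancel[OF that] permutes_inv_o)
      then have "\<tau> \<circ> \<sigma> \<circ> inv \<tau> = id \<longleftrightarrow> \<sigma> = id"
        using perms_inv_o[OF that] by auto
      then show ?thesis by (simp add: gdelta_def)
    qed
    from class_function_span[OF gdelta_in_galg[OF perms_id] this ty]
    show "gdelta id = (\<lambda>\<sigma>. \<Sum>q\<in>{p. is_partition m p}. gdelta id (SOME \<tau>. \<tau> \<in> perms m \<and> ty \<tau> = q) * (if \<sigma> \<in> perms m \<and> ty \<sigma> = q then 1 else 0 :: 'k))" .
  next
    fix p
    show "\<exists>c. young_central m p = (\<lambda>\<sigma>. \<Sum>q\<in>{p. is_partition m p}. c q * (if \<sigma> \<in> perms m \<and> ty \<sigma> = q then 1 else 0 :: 'k))"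
      by (rule exI, rule class_function_span[of "young_central m p :: _ \<Rightarrow> 'k" m ty])
        (rule young_central_in_galg, erule young_central_conjugate, erule ty)
  next
    fix a q assume z: "\<And>\<sigma>. (\<Sum>p\<in>{p. is_partition m p}. a p * (young_central m p \<sigma> :: 'k)) = 0"
      and q: "q \<in> {p. is_partition m p}"
    \<comment> \<open>Independence: multiplying the relation by c_q kills all terms but one, and the
      coefficient at the identity is then \<open>a q\<close> times n^2.\<close>
    have "(\<lambda>\<sigma>. \<Sum>p\<in>{p. is_partition m p}. a p * (young_central m p \<sigma> :: 'k)) = (\<lambda>_. 0)"
      using z by simp
    then have "gmul m (\<lambda>\<sigma>. \<Sum>p\<in>{p. is_partition m p}. a p * (young_central m p \<sigma> :: 'k)) (young_sym m q) id = 0"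
      by (simp only: gmul_zero_left)
    then have "(\<Sum>p\<in>{p. is_partition m p}. a p * gmul m (young_central m p) (young_sym m q :: _ \<Rightarrow> 'k) id) = 0"
      by (simp only: gmul_sum_left gmul_scale_left)
    moreover have "(\<Sum>p\<in>{p. is_partition m p}. a p * gmul m (young_central m p) (young_sym m q :: _ \<Rightarrow> 'k) id) =
        (\<Sum>p\<in>{p. is_partition m p}. if p = q then a q * (young_norm m q)\<^sup>2 else 0)"
      using q by (intro sum.cong) (auto simp: young_central_mult_same young_central_mult_other young_sym_id)
    ultimately have "a q * (young_norm m q)\<^sup>2 = 0" using q finite_partitions[of m] by simp
    moreover have "young_norm m q \<noteq> (0 :: 'k)" using q by (intro young_norm_nonzero) simp
    ultimately show "a q = 0" by simp
  qed
qed

section \<open>The bialgebra relations and the commutant\<close>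

definition word_lin :: "('a \<Rightarrow> 'k) \<Rightarrow> ('a \<Rightarrow>\<^sub>0 'k) \<Rightarrow> 'k::comm_ring_1" where
  "word_lin g p = (\<Sum>t\<in>Poly_Mapping.keys p. Poly_Mapping.lookup p t * g t)"

lemma word_lin_superset:
  "finite A \<Longrightarrow> Poly_Mapping.keys p \<subseteq> A \<Longrightarrow> word_lin g p = (\<Sum>t\<in>A. Poly_Mapping.lookup p t * g t)"
  unfolding word_lin_def by (rule sum.mono_neutral_left) (auto simp: in_keys_iff)

lemma word_lin_add: "word_lin g (p + q) = word_lin g p + word_lin g q"
proof -
  let ?A = "Poly_Mapping.keys p \<union> Poly_Mapping.keys q"
  have "word_lin g (p + q) = (\<Sum>t\<in>?A. Poly_Mapping.lookup (p + q) t * g t)"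
    using Poly_Mapping.keys_add[of p q] by (intro word_lin_superset) auto
  also have "\<dots> = word_lin g p + word_lin g q"
    by (simp add: word_lin_superset[of ?A] lookup_add algebra_simps sum.distrib)
  finally show ?thesis .
qed

lemma word_lin_zero [simp]: "word_lin g 0 = 0"
  by (simp add: word_lin_def)

lemma word_lin_minus: "word_lin g (- p) = - word_lin g p"
  using word_lin_add[of g p "- p"] by (simp add: eq_neg_iff_add_eq_0 add.commute)

lemma word_lin_diff: "word_lin g (p - q) = word_lin g p - word_lin g q"
  using word_lin_add[of g p "- q"] by (simp add: word_lin_minus)

lemma word_lin_sum: "word_lin g (\<Sum>i\<in>A. f i) = (\<Sum>i\<in>A. word_lin g (f i))"
  by (induction A rule: infinite_finite_induct) (auto simp: word_lin_add)

lemma word_lin_single [simp]: "word_lin g (Poly_Mapping.single t c) = c * g t"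
  by (simp add: word_lin_def)

lemma word_lin_zero_fun: "word_lin (\<lambda>_. 0) p = 0"
  by (simp add: word_lin_def)

lemma word_lin_fmul: "word_lin g (fmul p q) = word_lin (\<lambda>s. word_lin (\<lambda>t. g (s @ t)) q) p"
  by (simp add: fmul_def word_lin_sum) (simp add: word_lin_def sum_distrib_left mult.assoc)

lemma word_lin_swap: "word_lin (\<lambda>s. word_lin (\<lambda>t. g s t) q) p = word_lin (\<lambda>t. word_lin (\<lambda>s. g s t) p) q"
  unfolding word_lin_def sum_distrib_left by (subst sum.swap) (simp add: mult.left_commute)

lemma word_lin_fscal: "word_lin g (fscal c p) = c * word_lin g p"
  by (simp add: fscal_def word_lin_fmul)

text \<open>Functionals given by their values on words separate elements. Identities in the free
  algebra are thereby checked as identities between finite sums in k.\<close>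

lemma word_lin_eqI:
  assumes "\<And>g. word_lin g p = word_lin g q"
  shows "p = q"
proof (rule poly_mapping_eqI)
  fix t
  have "word_lin (\<lambda>s. if s = t then 1 else 0) p = Poly_Mapping.lookup p t" for p :: "'a \<Rightarrow>\<^sub>0 'b"
    by (simp add: word_lin_def if_distrib[of "\<lambda>x. _ * x"] in_keys_iff cong: if_cong)
  then show "Poly_Mapping.lookup p t = Poly_Mapping.lookup q t" using assms by metis
qed

lemma fmul_single: "fmul (Poly_Mapping.single u a) (Poly_Mapping.single v b) = Poly_Mapping.single (u @ v) (a * b)"
  by (rule word_lin_eqI) (simp add: word_lin_fmul)

lemma Lword_eq_single: "Lword I J = Poly_Mapping.single (zip I J) 1"
proof -
  have "foldr fmul (map (\<lambda>(i, j). Lgen i j) w) (Poly_Mapping.single [] 1) = Poly_Mapping.single w (1 :: 'b)"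
    for w :: "('a \<times> 'a) list"
    by (induction w) (auto simp: Lgen_def fmul_single)
  then show ?thesis by (simp add: Lword_def)
qed

lemma word_lin_frt_rel:
  "word_lin g (frt_rel R ((a, b), (c, d))) =
    (\<Sum>p\<in>UNIV. \<Sum>q\<in>UNIV. R ((a, b), (p, q)) * g [(p, c), (q, d)])
    - (\<Sum>p\<in>UNIV. \<Sum>q\<in>UNIV. R ((p, q), (c, d)) * g [(b, q), (a, p)])"
  by (simp add: frt_rel_def word_lin_diff word_lin_sum word_lin_fscal Lgen_def fmul_single)

lemma IR_fscal: "p \<in> IR R \<Longrightarrow> fscal c p \<in> IR R"
  unfolding IR_def fscal_def by (rule fid_lmul)

lemma IR_add: "p \<in> IR R \<Longrightarrow> q \<in> IR R \<Longrightarrow> p + q \<in> IR R"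
  unfolding IR_def by (rule fid_add)

lemma IR_zero: "0 \<in> IR R"
  unfolding IR_def by (rule fid_zero)

lemma IR_sum: "(\<And>i. i \<in> A \<Longrightarrow> f i \<in> IR R) \<Longrightarrow> (\<Sum>i\<in>A. f i) \<in> IR R"
  by (induction A rule: infinite_finite_induct) (auto intro: IR_add IR_zero)

text \<open>Entry \<open>(I, K)\<close> of \<open>L A - A L\<close>, where \<open>L\<close> is the matrix with entries \<open>Lword I J\<close>.\<close>
definition comm_defect :: "nat \<Rightarrow> ('i::finite list \<times> 'i list \<Rightarrow> 'k::comm_ring_1) \<Rightarrow> 'i list \<Rightarrow> 'i list \<Rightarrow> (('i \<times> 'i) list \<Rightarrow>\<^sub>0 'k)" where
  "comm_defect m A I K = (\<Sum>J\<in>tidx m. fscal (A (J, K)) (Lword I J)) - (\<Sum>J\<in>tidx m. fscal (A (I, J)) (Lword J K))"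

lemma word_lin_comm_defect:
  "word_lin g (comm_defect m A I K) = (\<Sum>J\<in>tidx m. A (J, K) * g (zip I J)) - (\<Sum>J\<in>tidx m. A (I, J) * g (zip J K))"
  by (simp add: comm_defect_def word_lin_diff word_lin_sum word_lin_fscal Lword_eq_single)

text \<open>Here the relations of H_R meet the symmetric group: an entry of
  \<open>L s_b - s_b L\<close> is, up to sign, one FRT relator between the words of the outer
  letters. The flip inside \<open>tauR\<close> causes the exchanged index
  \<open>(y, x)\<close>.\<close>

lemma comm_defect_Rpos:
  fixes R :: "('i::finite \<times> 'i) \<times> ('i \<times> 'i) \<Rightarrow> 'k::comm_ring_1"
  assumes "length u = b" "b + 2 + length v = m" "length u' = b" "b + 2 + length v' = m"
  shows "comm_defect m (Rpos m (tauR R) b) (u @ [x, y] @ v) (u' @ [x', y'] @ v') =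
    fmul (Poly_Mapping.single (zip u u') (- 1)) (fmul (frt_rel R ((y, x), (x', y'))) (Poly_Mapping.single (zip v v') 1))"
    (is "comm_defect m ?S ?I ?K = ?r")
proof (rule word_lin_eqI)
  fix g :: "('i \<times> 'i) list \<Rightarrow> 'k"
  define h where "h w = g (zip u u' @ w @ zip v v')" for w
  have z: "zip (u @ [p, q] @ v) (u' @ [p', q'] @ v') = zip u u' @ [(p, p'), (q, q')] @ zip v v'" for p q p' q'
    using assms by simp
  have "(\<Sum>J\<in>tidx m. ?S (J, ?K) * g (zip ?I J)) = (\<Sum>p\<in>UNIV. \<Sum>q\<in>UNIV. tauR R ((p, q), (x', y')) * h [(x, p), (y, q)])"
  proof (subst sum_tidx_local[OF assms(3,4)], goal_cases)
    case (1 J)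
    then show ?case by (simp only: Rpos_eq_0'[OF assms(3,4) 1(2)] mult_zero_left)
  next
    case 2
    show ?case by (simp only: Rpos_local[OF assms(3,4)] z h_def)
  qed
  also have "\<dots> = (\<Sum>p\<in>UNIV. \<Sum>q\<in>UNIV. R ((p, q), (x', y')) * h [(x, q), (y, p)])"
    unfolding tauR_def prod.case by (rule sum.swap)
  finally have 1: "(\<Sum>J\<in>tidx m. ?S (J, ?K) * g (zip ?I J)) = \<dots>" .
  have 2: "(\<Sum>J\<in>tidx m. ?S (?I, J) * g (zip J ?K)) = (\<Sum>p\<in>UNIV. \<Sum>q\<in>UNIV. R ((y, x), (p, q)) * h [(p, x'), (q, y')])"
  proof (subst sum_tidx_local[OF assms(1,2)], goal_cases)
    case (1 J)
    then show ?case by (simp only: Rpos_eq_0[OF assms(1,2) 1(2)] mult_zero_left)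
  next
    case 2
    show ?case by (simp only: Rpos_local[OF assms(1,2)] z h_def tauR_def prod.case)
  qed
  have "word_lin g ?r = - word_lin (\<lambda>w. g (zip u u' @ w @ zip v v')) (frt_rel R ((y, x), (x', y')))"
    by (simp only: word_lin_fmul word_lin_single mult_1 mult_minus1)
  then show "word_lin g (comm_defect m ?S ?I ?K) = word_lin g ?r"
    unfolding word_lin_comm_defect 1 2 by (simp only: word_lin_frt_rel h_def minus_diff_eq)
qed

lemma comm_defect_SRm:
  fixes R :: "('i::finite \<times> 'i) \<times> ('i \<times> 'i) \<Rightarrow> 'k::field"
  assumes "A \<in> SRm m R" "I \<in> tidx m" "K \<in> tidx m"
  shows "comm_defect m A I K \<in> IR R"
  using assms
proof (induction arbitrary: I K)
  case SR_id
  have "comm_defect m (mid m) I K = (0 :: ('i \<times> 'i) list \<Rightarrow>\<^sub>0 'k)"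
  proof (rule word_lin_eqI)
    fix g :: "('i \<times> 'i) list \<Rightarrow> 'k"
    have "(\<Sum>J\<in>tidx m. mid m (J, K) * g (zip I J)) = (\<Sum>J\<in>tidx m. if J = K then g (zip I K) else 0)"
      by (rule sum.cong) (auto simp: mid_def tidx_def)
    moreover have "(\<Sum>J\<in>tidx m. mid m (I, J) * g (zip J K)) = (\<Sum>J\<in>tidx m. if J = I then g (zip I K) else 0)"
      by (rule sum.cong) (auto simp: mid_def tidx_def)
    ultimately show "word_lin g (comm_defect m (mid m) I K) = word_lin g 0"
      using SR_id by (simp add: word_lin_comm_defect)
  qed
  then show ?case by (simp add: IR_zero)
next
  case (SR_gen b)
  have "length I = m" "length K = m" using SR_gen by (simp_all add: tidx_def)
  obtain u x y v where I: "I = u @ [x, y] @ v" "length u = b" "b + 2 + length v = m"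
    using SR_gen(1) \<open>length I = m\<close> list_split_at2[of b I] by metis
  obtain u' x' y' v' where K: "K = u' @ [x', y'] @ v'" "length u' = b" "b + 2 + length v' = m"
    using SR_gen(1) \<open>length K = m\<close> list_split_at2[of b K] by metis
  show ?case
    unfolding sgen_eq_Rpos[OF SR_gen(1)] I(1) K(1) comm_defect_Rpos[OF I(2,3) K(2,3)] IR_def
    by (intro fid_lmul fid_rmul fid_gen) simp
next
  case (SR_add A B)
  have "comm_defect m (\<lambda>x. A x + B x) I K = comm_defect m A I K + comm_defect m B I K"
    by (rule word_lin_eqI) (simp add: word_lin_comm_defect word_lin_add algebra_simps sum.distrib)
  then show ?case using SR_add by (simp add: IR_add)
next
  case (SR_scal A c)
  have "comm_defect m (\<lambda>x. c * A x) I K = fscal c (comm_defect m A I K)"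
    by (rule word_lin_eqI) (simp add: word_lin_comm_defect word_lin_fscal algebra_simps sum_distrib_left)
  then show ?case using SR_scal by (simp add: IR_fscal)
next
  case (SR_mul A B)
  \<comment> \<open>The Leibniz rule \<open>[L, A B] = [L, A] B + A [L, B]\<close>, entry by
    entry.\<close>
  have "comm_defect m (mmul m A B) I K =
    (\<Sum>J\<in>tidx m. fscal (B (J, K)) (comm_defect m A I J)) + (\<Sum>J\<in>tidx m. fscal (A (I, J)) (comm_defect m B J K))"
    (is "_ = ?r")
  proof (rule word_lin_eqI)
    fix g :: "('i \<times> 'i) list \<Rightarrow> 'k"
    have "word_lin g ?r =
      ((\<Sum>J\<in>tidx m. \<Sum>J'\<in>tidx m. B (J, K) * (A (J', J) * g (zip I J'))) - (\<Sum>J\<in>tidx m. \<Sum>J'\<in>tidx m. B (J, K) * (A (I, J') * g (zip J' J))))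
      + ((\<Sum>J\<in>tidx m. \<Sum>J'\<in>tidx m. A (I, J) * (B (J', K) * g (zip J J'))) - (\<Sum>J\<in>tidx m. \<Sum>J'\<in>tidx m. A (I, J) * (B (J, J') * g (zip J' K))))"
      by (simp only: word_lin_add word_lin_sum word_lin_fscal word_lin_comm_defect right_diff_distrib sum_subtractf sum_distrib_left)
    moreover have "(\<Sum>J\<in>tidx m. \<Sum>J'\<in>tidx m. B (J, K) * (A (I, J') * g (zip J' J))) =
        (\<Sum>J\<in>tidx m. \<Sum>J'\<in>tidx m. A (I, J) * (B (J', K) * g (zip J J')))"
      by (subst sum.swap) (simp add: mult.left_commute)
    moreover have "(\<Sum>J\<in>tidx m. \<Sum>J'\<in>tidx m. B (J, K) * (A (J', J) * g (zip I J'))) =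
        (\<Sum>J\<in>tidx m. mmul m A B (J, K) * g (zip I J))"
      unfolding mmul_def prod.case sum_distrib_right by (subst sum.swap) (simp add: mult_ac)
    moreover have "(\<Sum>J\<in>tidx m. \<Sum>J'\<in>tidx m. A (I, J) * (B (J, J') * g (zip J' K))) =
        (\<Sum>J\<in>tidx m. mmul m A B (I, J) * g (zip J K))"
      unfolding mmul_def prod.case sum_distrib_right by (subst sum.swap) (simp add: mult_ac)
    ultimately show "word_lin g (comm_defect m (mmul m A B) I K) = word_lin g ?r"
      by (simp add: word_lin_comm_defect)
  qed
  then show ?case using SR_mul by (auto intro!: IR_add IR_sum IR_fscal)
qed

section \<open>HR_m as the commutant of SR_m\<close>

lemma HR_functional_sum:
  assumes "HR_functional R \<psi>"
  shows "\<psi> (\<Sum>i\<in>A. f i) = (\<Sum>i\<in>A. \<psi> (f i))"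
proof -
  have "\<psi> 0 = 0" using assms unfolding HR_functional_def by (metis add_cancel_right_right)
  then show ?thesis
    using assms by (induction A rule: infinite_finite_induct) (auto simp: HR_functional_def)
qed

lemma HR_functional_diff:
  assumes "HR_functional R \<psi>"
  shows "\<psi> (p - q) = \<psi> p - \<psi> q"
proof -
  have "\<psi> (p - q + q) = \<psi> (p - q) + \<psi> q" using assms unfolding HR_functional_def by blast
  then show ?thesis by simp
qed

lemma hrmap_in_mats: "hrmap m \<psi> \<in> mats m"
  by (auto simp: hrmap_def mats_def)

lemma SRm_in_mats: "A \<in> SRm m R \<Longrightarrow> A \<in> mats m"
proof (induction rule: SRm.induct)
  case (SR_add A B)
  then show ?case by (simp add: mats_def)
next
  case (SR_scal A c)
  then show ?case by (simp add: mats_def)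
qed (auto intro: mid_in_mats sgen_in_mats mmul_in_mats)

lemma hrmap_commutes_SRm:
  assumes "HR_functional R \<psi>" and A: "A \<in> SRm m R"
  shows "mmul m (hrmap m \<psi>) A = mmul m A (hrmap m \<psi>)"
proof (rule mats_eqI)
  show "mmul m (hrmap m \<psi>) A \<in> mats m" "mmul m A (hrmap m \<psi>) \<in> mats m"
    by (intro mmul_in_mats hrmap_in_mats SRm_in_mats[OF A])+
  fix I K :: "'a list"
  assume len: "length I = m" "length K = m"
  then have "\<psi> (comm_defect m A I K) = 0"
    using comm_defect_SRm[OF A] assms(1) by (simp add: HR_functional_def tidx_def)
  moreover have "\<psi> (fscal c p) = c * \<psi> p" for c p
    using assms(1) by (simp add: HR_functional_def)
  ultimately have "(\<Sum>J\<in>tidx m. A (J, K) * \<psi> (Lword I J)) = (\<Sum>J\<in>tidx m. A (I, J) * \<psi> (Lword J K))"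
    by (simp add: comm_defect_def HR_functional_diff[OF assms(1)] HR_functional_sum[OF assms(1)])
  moreover have "mmul m (hrmap m \<psi>) A (I, K) = (\<Sum>J\<in>tidx m. A (J, K) * \<psi> (Lword I J))"
    unfolding mmul_def prod.case using len by (intro sum.cong) (auto simp: hrmap_def tidx_def)
  moreover have "mmul m A (hrmap m \<psi>) (I, K) = (\<Sum>J\<in>tidx m. A (I, J) * \<psi> (Lword J K))"
    unfolding mmul_def prod.case using len by (intro sum.cong) (auto simp: hrmap_def tidx_def)
  ultimately show "mmul m (hrmap m \<psi>) A (I, K) = mmul m A (hrmap m \<psi>) (I, K)" by simp
qed

lemma mmul_add_left: "mmul m (\<lambda>x. A x + B x) C = (\<lambda>x. mmul m A C x + mmul m B C x)"
  and mmul_add_right: "mmul m C (\<lambda>x. A x + B x) = (\<lambda>x. mmul m C A x + mmul m C B x)"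
  and mmul_scale_left: "mmul m (\<lambda>x. c * A x) C = (\<lambda>x. c * mmul m A C x)"
  and mmul_scale_right: "mmul m C (\<lambda>x. c * A x) = (\<lambda>x. c * mmul m C A x)"
  by (auto simp: mmul_def fun_eq_iff algebra_simps sum.distrib sum_distrib_left)

lemma mmul_zero_left: "mmul m (\<lambda>_. 0) C = (\<lambda>_. 0)"
  and mmul_zero_right: "mmul m C (\<lambda>_. 0) = (\<lambda>_. 0)"
  by (auto simp: mmul_def fun_eq_iff)

lemma HRm_subset_commutant: "HRm m R \<subseteq> commutant m (SRm m R)"
proof
  fix H assume "H \<in> HRm m R"
  then show "H \<in> commutant m (SRm m R)"
    unfolding HRm_def
  proof induction
    case kspan_zero
    then show ?case by (simp add: commutant_def mats_def mmul_zero_left mmul_zero_right)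
  next
    case (kspan_step s v c)
    then obtain \<psi> where \<psi>: "s = hrmap m \<psi>" "HR_functional R \<psi>" by blast
    have "(\<lambda>x. c * s x + v x) \<in> mats m"
      using kspan_step.IH hrmap_in_mats[of m \<psi>] \<psi>(1) by (simp add: commutant_def mats_def)
    then show ?case
      using kspan_step.IH hrmap_commutes_SRm[OF \<psi>(2)]
      by (simp add: commutant_def \<psi>(1) mmul_add_left mmul_add_right mmul_scale_left mmul_scale_right)
  qed
qed

lemma kspan_base: "s \<in> S \<Longrightarrow> s \<in> kspan S"
  using kspan_step[OF _ kspan_zero, of s S 1] by simp

text \<open>The functional takes the value \<open>A (I, J)\<close> on the monomial
  \<open>L_IJ\<close>, a word of pairs being decoded into its two index lists. Commutation of
  \<open>A\<close> with each s_b makes it vanish on the FRT relators in every context.\<close>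

lemma commutant_functional:
  fixes R :: "('i::finite \<times> 'i) \<times> ('i \<times> 'i) \<Rightarrow> 'k::field"
  assumes A: "A \<in> commutant m (SRm m R)"
  shows "HR_functional R (word_lin (\<lambda>t. A (map fst t, map snd t)))"
proof -
  let ?g = "\<lambda>t. A (map fst t, map snd t)"
  have mats: "A \<in> mats m" using A by (simp add: commutant_def)
  \<comment> \<open>The surrounding words \<open>u\<close>, \<open>v\<close> are kept arbitrary so
    that left and right multiplication in the two-sided ideal can be absorbed into them.\<close>
  have "word_lin (\<lambda>t. ?g (u @ t @ v)) p = 0" if "p \<in> IR R" for p u v
    using that unfolding IR_def
  proof (induction arbitrary: u v)
    case (fid_gen p)
    then obtain a b c d where p: "p = frt_rel R ((a, b), (c, d))" by auto
    show ?case
    proof (cases "length u + 2 + length v = m")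
      \<comment> \<open>Words of total length other than \<open>m\<close> are killed, because
        \<open>A\<close> is zero off length \<open>m\<close>.\<close>
      case False
      then have "A (map fst u @ x # y # map fst v, map snd u @ x' # y' # map snd v) = 0" for x y x' y'
        using mats by (auto simp: mats_def)
      then show ?thesis unfolding p word_lin_frt_rel by simp
    next
      case True
      let ?u = "map fst u" and ?v = "map fst v" and ?u' = "map snd u" and ?v' = "map snd v"
      have l: "length ?u = length u" "length u + 2 + length ?v = m"
        and l': "length ?u' = length u" "length u + 2 + length ?v' = m" using True by auto
      have "Suc (length u) < m" using True by simp
      then have comm: "mmul m A (Rpos m (tauR R) (length u)) = mmul m (Rpos m (tauR R) (length u)) A"
        using A SR_gen[of "length u" m R] by (simp add: commutant_def sgen_eq_Rpos)
      have "(\<Sum>p\<in>UNIV. \<Sum>q\<in>UNIV. A (?u @ [b, a] @ ?v, ?u' @ [p, q] @ ?v') * tauR R ((p, q), (c, d))) =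
          (\<Sum>p\<in>UNIV. \<Sum>q\<in>UNIV. tauR R ((b, a), (p, q)) * A (?u @ [p, q] @ ?v, ?u' @ [c, d] @ ?v'))"
        using fun_cong[OF comm, of "(?u @ [b, a] @ ?v, ?u' @ [c, d] @ ?v')"]
        by (simp only: mmul_Rpos[OF l] mmul_Rpos_right[OF l'])
      also have "(\<Sum>p\<in>UNIV. \<Sum>q\<in>UNIV. A (?u @ [b, a] @ ?v, ?u' @ [p, q] @ ?v') * tauR R ((p, q), (c, d))) =
          (\<Sum>p\<in>UNIV. \<Sum>q\<in>UNIV. R ((p, q), (c, d)) * A (?u @ [b, a] @ ?v, ?u' @ [q, p] @ ?v'))"
        unfolding tauR_def prod.case by (subst sum.swap) (simp only: mult.commute)
      finally show ?thesis
        unfolding p word_lin_frt_rel by (simp add: tauR_def)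
    qed
  next
    case (fid_lmul p a)
    have "word_lin (\<lambda>t. ?g (u @ (s @ t) @ v)) p = 0" for s
      using fid_lmul.IH[of "u @ s" v] by simp
    then show ?case unfolding word_lin_fmul by (simp only: word_lin_zero_fun)
  next
    case (fid_rmul p a)
    have "word_lin (\<lambda>s. ?g (u @ (s @ t) @ v)) p = 0" for t
      using fid_rmul.IH[of u "t @ v"] by simp
    then show ?case unfolding word_lin_fmul by (subst word_lin_swap) (simp only: word_lin_zero_fun)
  qed (simp_all add: word_lin_add)
  from this[of _ "[]" "[]"] show ?thesis
    by (simp add: HR_functional_def word_lin_add word_lin_fscal)
qed

lemma commutant_SRm: "commutant m (SRm m R) = HRm m R"
proof
  show "commutant m (SRm m R) \<subseteq> HRm m R"
  proof
    fix A assume A: "A \<in> commutant m (SRm m R)"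
    have "hrmap m (word_lin (\<lambda>t. A (map fst t, map snd t))) = A"
    proof (rule mats_eqI)
      fix I J :: "'a list"
      assume "length I = m" "length J = m"
      then show "hrmap m (word_lin (\<lambda>t. A (map fst t, map snd t))) (I, J) = A (I, J)"
        by (simp add: hrmap_def Lword_eq_single)
    qed (use A hrmap_in_mats in \<open>auto simp: commutant_def\<close>)
    then show "A \<in> HRm m R"
      unfolding HRm_def using commutant_functional[OF A] by (intro kspan_base) (metis (mono_tags, lifting) mem_Collect_eq)
  qed
qed (rule HRm_subset_commutant)

section \<open>Irreducibility and the double commutant\<close>

lemma ksubspace_sum:
  assumes "ksubspace U" "\<And>i. i \<in> A \<Longrightarrow> f i \<in> U"
  shows "(\<lambda>x. \<Sum>i\<in>A. f i x) \<in> U"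
  using assms(2)
proof (induction A rule: infinite_finite_induct)
  case (insert a A)
  then show ?case using assms(1) by (simp add: ksubspace_def)
qed (use assms(1) in \<open>simp_all add: ksubspace_def\<close>)

lemma ksubspace_scale: "ksubspace U \<Longrightarrow> u \<in> U \<Longrightarrow> (\<lambda>x. c * u x) \<in> U"
  by (simp add: ksubspace_def)

lemma ksubspace_kspan: "ksubspace (kspan S)"
proof -
  have "(\<lambda>x. u x + v x) \<in> kspan S" if "u \<in> kspan S" "v \<in> kspan S" for u v :: "'a \<Rightarrow> 'b"
    using that
  proof induction
    case (kspan_step s w c)
    then show ?case using kspan.kspan_step[of s S "\<lambda>x. w x + v x" c] by (simp add: add.assoc)
  qed simp
  moreover have "(\<lambda>x. c * u x) \<in> kspan S" if "u \<in> kspan S" for u :: "'a \<Rightarrow> 'b" and c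
    using that
  proof induction
    case kspan_zero
    then show ?case using kspan.kspan_zero by simp
  next
    case (kspan_step s w d)
    then show ?case using kspan.kspan_step[of s S "\<lambda>x. c * w x" "c * d"] by (simp add: algebra_simps)
  qed
  ultimately show ?thesis by (simp add: ksubspace_def kspan.kspan_zero)
qed

lemma mapp_sum: "mapp m A (\<lambda>J. \<Sum>i\<in>S. v i J) = (\<lambda>I. \<Sum>i\<in>S. mapp m A (v i) I)"
proof
  fix I
  have "(\<Sum>J\<in>tidx m. A (I, J) * (\<Sum>i\<in>S. v i J)) = (\<Sum>i\<in>S. \<Sum>J\<in>tidx m. A (I, J) * v i J)"
    unfolding sum_distrib_left by (rule sum.swap)
  then show "mapp m A (\<lambda>J. \<Sum>i\<in>S. v i J) I = (\<Sum>i\<in>S. mapp m A (v i) I)"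
    by (simp add: mapp_def)
qed

lemma mapp_zero: "mapp m A (\<lambda>_. 0) = (\<lambda>_. 0)"
  by (simp add: mapp_def fun_eq_iff)

lemma mapp_eq_imp_mats_eq:
  assumes "A \<in> mats m" "B \<in> mats m" "\<And>v. v \<in> vecs m \<Longrightarrow> mapp m A v = mapp m B v"
  shows "A = B"
proof (rule mats_eqI[OF assms(1,2)])
  fix I J :: "'a list"
  assume len: "length I = m" "length J = m"
  let ?e = "\<lambda>K. if K = J then 1 else 0 :: 'b"
  have "mapp m C ?e I = C (I, J)" for C
    using len by (simp add: mapp_def tidx_def[symmetric] if_distrib[of "\<lambda>x. _ * x"] cong: if_cong) (simp add: tidx_def)
  moreover have "?e \<in> vecs m" using len by (simp add: vecs_def)
  ultimately show "A (I, J) = B (I, J)" using assms(3) by metis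
qed

lemma vecs_nonzero:
  assumes "v \<in> vecs m" "v \<noteq> (\<lambda>_. 0)"
  obtains I where "I \<in> tidx m" "v I \<noteq> 0"
  using assms by (auto simp: vecs_def tidx_def fun_eq_iff)

lemma ksubspace_nonzero:
  assumes "ksubspace U" "U \<noteq> {\<lambda>_. 0}"
  obtains u where "u \<in> U" "u \<noteq> (\<lambda>_. 0)"
  using assms unfolding ksubspace_def by blast

lemma mapp_kspan_closed:
  assumes "ksubspace U" "H \<in> kspan S" "\<And>s. s \<in> S \<Longrightarrow> mapp m s u \<in> U"
  shows "mapp m H u \<in> U"
  using assms(2)
proof induction
  case kspan_zero
  have "mapp m (\<lambda>_. 0) u = (\<lambda>_. 0)" by (simp add: mapp_def fun_eq_iff)
  then show ?case using assms(1) by (simp add: ksubspace_def)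
next
  case (kspan_step s v c)
  have "mapp m (\<lambda>x. c * s x + v x) u = (\<lambda>I. c * mapp m s u I + mapp m v u I)"
    by (simp add: mapp_def fun_eq_iff algebra_simps sum.distrib sum_distrib_left)
  then show ?case using kspan_step assms(1) assms(3)[of s] by (simp add: ksubspace_def)
qed

text \<open>Applying \<open>\<psi>\<close> to the second factor of the coaction on \<open>u\<close>
  gives a linear combination of the vectors \<open>ws\<close>, which lie in
  \<open>U\<close>.\<close>

lemma subcomodule_invariant:
  assumes "subcomodule m R U"
  shows "invariant_under m (HRm m R) U"
  unfolding invariant_under_def
proof (intro ballI)
  fix H u assume H: "H \<in> HRm m R" and u: "u \<in> U"
  have U: "U \<subseteq> vecs m" "ksubspace U" using assms by (auto simp: subcomodule_def)
  have "\<exists>ws hs. length ws = length hs \<and> set ws \<subseteq> U \<and> (\<forall>I\<in>tidx m.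
      (\<Sum>J\<in>tidx m. fscal (u J) (Lword I J)) - (\<Sum>k<length ws. fscal ((ws!k) I) (hs!k)) \<in> IR R)"
    using assms unfolding subcomodule_def by (elim conjE) (erule bspec[OF _ u])
  then obtain ws hs where ws: "length ws = length hs" "set ws \<subseteq> U"
    and eq: "\<And>I. I \<in> tidx m \<Longrightarrow>
      (\<Sum>J\<in>tidx m. fscal (u J) (Lword I J)) - (\<Sum>k<length ws. fscal ((ws!k) I) (hs!k)) \<in> IR R"
    by (elim exE conjE) (drule (1) that, simp)
  have "mapp m (hrmap m \<psi>) u \<in> U" if \<psi>: "HR_functional R \<psi>" for \<psi>
  proof -
    have sc: "\<psi> (fscal c p) = c * \<psi> p" for c p using \<psi> by (simp add: HR_functional_def)
    have "mapp m (hrmap m \<psi>) u = (\<lambda>I. \<Sum>k<length ws. \<psi> (hs ! k) * (ws ! k) I)"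
    proof
      fix I
      show "mapp m (hrmap m \<psi>) u I = (\<Sum>k<length ws. \<psi> (hs ! k) * (ws ! k) I)"
      proof (cases "length I = m")
        case True
        then have "I \<in> tidx m" by (simp add: tidx_def)
        have "mapp m (hrmap m \<psi>) u I = (\<Sum>J\<in>tidx m. u J * \<psi> (Lword I J))"
          using True by (auto simp: mapp_def hrmap_def tidx_def intro!: sum.cong)
        also have "\<dots> = \<psi> (\<Sum>J\<in>tidx m. fscal (u J) (Lword I J))"
          by (simp add: HR_functional_sum[OF \<psi>] sc)
        also have "\<dots> = \<psi> (\<Sum>k<length ws. fscal ((ws!k) I) (hs!k))"
        proof -
          have "\<psi> p = 0" if "p \<in> IR R" for p using \<psi> that by (simp add: HR_functional_def)
          from this[OF eq[OF \<open>I \<in> tidx m\<close>]] show ?thesis by (simp only: HR_functional_diff[OF \<psi>] right_minus_eq)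
        qed
        also have "\<dots> = (\<Sum>k<length ws. \<psi> (hs ! k) * (ws ! k) I)"
          by (simp add: HR_functional_sum[OF \<psi>] sc mult.commute)
        finally show ?thesis .
      next
        case False
        then have "(ws ! k) I = 0" if "k < length ws" for k
          using ws(2) U(1) nth_mem[OF that] by (auto simp: vecs_def)
        then show ?thesis using False by (simp add: mapp_def)
      qed
    qed
    also have "\<dots> \<in> U"
      using ws(2) by (intro ksubspace_sum[OF U(2)] ksubspace_scale[OF U(2)]) auto
    finally show ?thesis .
  qed
  then have "mapp m s u \<in> U" if "s \<in> {hrmap m \<psi> |\<psi>. HR_functional R \<psi>}" for s
    using that by blast
  with U(2) H[unfolded HRm_def] show "mapp m H u \<in> U"
    by (rule mapp_kspan_closed)
qed

context unitary_QYBE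
begin

abbreviation act :: "((nat \<Rightarrow> nat) \<Rightarrow> 'k) \<Rightarrow> ('i list \<Rightarrow> 'k) \<Rightarrow> ('i list \<Rightarrow> 'k)" where
  "act x v \<equiv> mapp m (grep m R x) v"

lemma act_gmul: "act (gmul m x y) v = act x (act y v)"
  by (simp add: grep_gmul mapp_mmul)

lemma act_scale_left: "act (\<lambda>\<sigma>. c * x \<sigma>) v = (\<lambda>I. c * act x v I)"
  by (simp add: mapp_grep fun_eq_iff sum_distrib_left mult.assoc)

lemma act_sum_left: "act (\<lambda>\<sigma>. \<Sum>i\<in>A. x i \<sigma>) v = (\<lambda>I. \<Sum>i\<in>A. act (x i) v I)"
  unfolding mapp_grep fun_eq_iff sum_distrib_right by (intro allI) (rule sum.swap)

lemma act_zero_left: "act (\<lambda>_. 0) v = (\<lambda>_. 0)"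
  by (simp add: mapp_grep fun_eq_iff)

lemma act_gdelta: "g \<in> perms m \<Longrightarrow> act (gdelta g) v = mapp m (Ract m R g) v"
  by (simp only: grep_gdelta)

lemma act_gdelta_id: "v \<in> vecs m \<Longrightarrow> act (gdelta id) v = v"
  by (simp only: act_gdelta[OF perms_id] Ract_id mapp_mid)

lemma grep_in_SRm: "grep m R x \<in> SRm m R"
  by (simp add: SRm_eq_grep)

lemma Ract_in_SRm: "g \<in> perms m \<Longrightarrow> Ract m R g \<in> SRm m R"
  using grep_in_SRm grep_gdelta by metis

lemma HRm_act:
  assumes "H \<in> HRm m R"
  shows "mapp m H (act x v) = act x (mapp m H v)"
proof -
  have "mmul m H (grep m R x) = mmul m (grep m R x) H"
    using assms grep_in_SRm unfolding commutant_SRm[symmetric] commutant_def by blast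
  then show ?thesis by (metis mapp_mmul)
qed

lemma HRm_Ract: "H \<in> HRm m R \<Longrightarrow> g \<in> perms m \<Longrightarrow> mapp m H (mapp m (Ract m R g) v) = mapp m (Ract m R g) (mapp m H v)"
  using HRm_act[of H "gdelta g" v] by (simp only: act_gdelta)

section \<open>The subcomodules c_p W\<close>

lemma rhoH_eq: "rhoH m R p = {act (young_sym m p) v | v. v \<in> vecs m}"
  by (simp add: rhoH_def)

lemma act_young_in_rhoH: "v \<in> vecs m \<Longrightarrow> act (young_sym m p) v \<in> rhoH m R p"
  by (auto simp: rhoH_eq)

lemma rhoH_vecs: "w \<in> rhoH m R p \<Longrightarrow> w \<in> vecs m"
  by (auto simp: rhoH_eq mapp_in_vecs)

lemma ksubspace_rhoH: "ksubspace (rhoH m R p)"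
  unfolding ksubspace_def
proof (intro conjI ballI allI)
  have "act (young_sym m p) (\<lambda>_. 0) \<in> rhoH m R p" by (rule act_young_in_rhoH) (simp add: vecs_def)
  then show "(\<lambda>_. 0) \<in> rhoH m R p" by (simp add: mapp_zero)
  show "(\<lambda>x. u x + v x) \<in> rhoH m R p" if "u \<in> rhoH m R p" "v \<in> rhoH m R p" for u v
  proof -
    obtain a b where "a \<in> vecs m" "b \<in> vecs m" "u = act (young_sym m p) a" "v = act (young_sym m p) b"
      using \<open>u \<in> rhoH m R p\<close> \<open>v \<in> rhoH m R p\<close> by (auto simp: rhoH_eq)
    then show ?thesis
      using act_young_in_rhoH[of "\<lambda>x. a x + b x" p] by (simp add: mapp_add vecs_def)
  qed
  show "(\<lambda>x. c * u x) \<in> rhoH m R p" if "u \<in> rhoH m R p" for c u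
  proof -
    obtain a where "a \<in> vecs m" "u = act (young_sym m p) a"
      using \<open>u \<in> rhoH m R p\<close> by (auto simp: rhoH_eq)
    then show ?thesis
      using act_young_in_rhoH[of "\<lambda>x. c * a x" p] by (simp add: mapp_scale vecs_def)
  qed
qed

lemma HRm_rhoH: "H \<in> HRm m R \<Longrightarrow> w \<in> rhoH m R p \<Longrightarrow> mapp m H w \<in> rhoH m R p"
  by (auto simp: rhoH_eq HRm_act mapp_in_vecs)

lemma young_act_rhoH:
  assumes "is_partition m p" "w \<in> rhoH m R p"
  shows "act (young_sym m p) w = (\<lambda>I. young_norm m p * w I)"
  using assms by (auto simp: rhoH_eq act_scale_left young_sym_square simp flip: act_gmul)

text \<open>For \<open>w = c v\<close> the coaction equals
  \<open>\<Sum>_J (c e_J) \<otimes> h_J\<close>, where the \<open>h_J\<close> are the components of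
  the coaction on \<open>v\<close>. So \<open>ws\<close> consists of the columns of c, and the error
  modulo the ideal is a combination of commutator entries of c.\<close>

lemma subcomodule_rhoH: "subcomodule m R (rhoH m R p)"
  unfolding subcomodule_def
proof (intro conjI ballI)
  show "rhoH m R p \<subseteq> vecs m" using rhoH_vecs by blast
  show "ksubspace (rhoH m R p)" by (rule ksubspace_rhoH)
  fix w assume "w \<in> rhoH m R p"
  let ?A = "grep m R (young_sym m p)"
  obtain v where v: "w = act (young_sym m p) v" using \<open>w \<in> rhoH m R p\<close> by (auto simp: rhoH_eq)
  obtain xs :: "'i list list" where xs: "set xs = tidx m" "distinct xs"
    using finite_distinct_list[OF finite_tidx] by blast
  define ws where "ws = map (\<lambda>J I. ?A (I, J)) xs"
  define h where "h J = (\<Sum>K\<in>tidx m. fscal (v K) (Lword J K))" for J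
  define hs where "hs = map h xs"
  have "(\<lambda>I. ?A (I, J)) \<in> rhoH m R p" if "J \<in> tidx m" for J
  proof -
    let ?e = "\<lambda>K. if K = J then 1 else 0 :: 'k"
    have "?e \<in> vecs m" using that by (simp add: vecs_def tidx_def)
    moreover have "act (young_sym m p) ?e = (\<lambda>I. ?A (I, J))"
      using that grep_in_mats[of "young_sym m p"]
      by (auto simp: mapp_def fun_eq_iff if_distrib[of "\<lambda>x. _ * x"] mats_def cong: if_cong)
    ultimately show ?thesis using act_young_in_rhoH by metis
  qed
  then have "set ws \<subseteq> rhoH m R p" using xs by (auto simp: ws_def)
  moreover have "(\<Sum>J\<in>tidx m. fscal (w J) (Lword I J)) - (\<Sum>k<length ws. fscal ((ws!k) I) (hs!k)) \<in> IR R"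
    if I: "I \<in> tidx m" for I
  proof -
    have "(\<Sum>k<length ws. fscal ((ws!k) I) (hs!k)) = (\<Sum>k<length xs. fscal (?A (I, xs ! k)) (h (xs ! k)))"
      by (simp add: ws_def hs_def)
    also have "\<dots> = (\<Sum>J\<in>tidx m. fscal (?A (I, J)) (h J))"
      using sum.reindex_bij_betw[OF bij_betw_nth[OF xs(2) refl xs(1)[symmetric]]] by (simp add: xs)
    finally have "(\<Sum>J\<in>tidx m. fscal (w J) (Lword I J)) - (\<Sum>k<length ws. fscal ((ws!k) I) (hs!k)) =
      (\<Sum>K\<in>tidx m. fscal (v K) (comm_defect m ?A I K))" (is "?l = ?r")
    proof (intro word_lin_eqI)
      fix g :: "('i \<times> 'i) list \<Rightarrow> 'k"
      assume e: "(\<Sum>k<length ws. fscal ((ws!k) I) (hs!k)) = (\<Sum>J\<in>tidx m. fscal (?A (I, J)) (h J))"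
      have "(\<Sum>J\<in>tidx m. w J * g (zip I J)) = (\<Sum>J\<in>tidx m. \<Sum>K\<in>tidx m. v K * (?A (J, K) * g (zip I J)))"
        unfolding v mapp_def
        by (rule sum.cong[OF refl]) (simp add: tidx_def sum_distrib_left sum_distrib_right mult_ac)
      also have "\<dots> = (\<Sum>K\<in>tidx m. v K * (\<Sum>J\<in>tidx m. ?A (J, K) * g (zip I J)))"
        unfolding sum_distrib_left by (rule sum.swap)
      finally have 1: "(\<Sum>J\<in>tidx m. w J * g (zip I J)) = \<dots>" .
      have 2: "(\<Sum>J\<in>tidx m. ?A (I, J) * (\<Sum>K\<in>tidx m. v K * g (zip J K))) =
          (\<Sum>K\<in>tidx m. v K * (\<Sum>J\<in>tidx m. ?A (I, J) * g (zip J K)))"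
        unfolding sum_distrib_left by (subst sum.swap) (simp only: mult.left_commute)
      show "word_lin g ?l = word_lin g ?r"
        unfolding e by (simp add: h_def word_lin_diff word_lin_sum word_lin_fscal word_lin_comm_defect
            Lword_eq_single 1 2 right_diff_distrib sum_subtractf)
    qed
    also have "\<dots> \<in> IR R"
      using I by (intro IR_sum IR_fscal comm_defect_SRm grep_in_SRm)
    finally show ?thesis .
  qed
  ultimately show "\<exists>ws hs. length ws = length hs \<and> set ws \<subseteq> rhoH m R p \<and>
      (\<forall>I\<in>tidx m. (\<Sum>J\<in>tidx m. fscal (w J) (Lword I J)) - (\<Sum>k<length ws. fscal ((ws!k) I) (hs!k)) \<in> IR R)"
    by (intro exI[of _ ws] exI[of _ hs]) (simp add: ws_def hs_def)
qed

text \<open>The average \<open>\<Sum>\<^sub>g g\<^sup>-\<^sup>1 E g\<close> of the rank one operator \<open>E v = v I0 \<cdot> w\<close>.\<close>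
definition transfer_map :: "('i list \<Rightarrow> 'k) \<Rightarrow> 'i list \<Rightarrow> 'i list \<times> 'i list \<Rightarrow> 'k" where
  "transfer_map w I0 = (\<lambda>(I, J). \<Sum>g\<in>perms m. mapp m (Ract m R (inv g)) w I * Ract m R g (I0, J))"

text \<open>The element of k[S_m] through which the transfer map acts: it depends on
  \<open>u\<close> and \<open>I0\<close> but not on \<open>w\<close>.\<close>

definition matrix_coeff :: "'i list \<Rightarrow> ('i list \<Rightarrow> 'k) \<Rightarrow> (nat \<Rightarrow> nat) \<Rightarrow> 'k" where
  "matrix_coeff I0 u = (\<lambda>\<sigma>. mapp m (Ract m R (inv \<sigma>)) u I0)"

lemma transfer_map_in_mats: "transfer_map w I0 \<in> mats m"
  using Ract_in_mats by (auto simp: transfer_map_def mats_def mapp_def intro!: sum.neutral)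

lemma mmul_transfer_map_Ract:
  assumes \<tau>: "\<tau> \<in> perms m"
  shows "mmul m (transfer_map w I0) (Ract m R \<tau>) = mmul m (Ract m R \<tau>) (transfer_map w I0)"
proof (rule mats_eqI)
  fix I J :: "'i list"
  assume len: "length I = m" "length J = m"
  have "mmul m (transfer_map w I0) (Ract m R \<tau>) (I, J) =
      (\<Sum>g\<in>perms m. mapp m (Ract m R (inv g)) w I * mmul m (Ract m R g) (Ract m R \<tau>) (I0, J))"
    unfolding transfer_map_def mmul_def prod.case sum_distrib_left sum_distrib_right mult.assoc by (rule sum.swap)
  also have "\<dots> = (\<Sum>g\<in>perms m. mapp m (Ract m R \<tau>) (mapp m (Ract m R (inv (g \<circ> \<tau>))) w) I * Ract m R (g \<circ> \<tau>) (I0, J))"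
  proof (rule sum.cong[OF refl])
    fix g assume g: "g \<in> perms m"
    have "inv g = \<tau> \<circ> inv (g \<circ> \<tau>)"
      unfolding perms_inv_compose[OF g \<tau>] perms_inv_o_cancel(2)[OF \<tau>] ..
    then have "mapp m (Ract m R (inv g)) w = mapp m (Ract m R \<tau>) (mapp m (Ract m R (inv (g \<circ> \<tau>))) w)"
      using Ract_compose[OF \<tau> perms_inv[OF perms_compose[OF g \<tau>]]] by (simp add: mapp_mmul)
    then show "mapp m (Ract m R (inv g)) w I * mmul m (Ract m R g) (Ract m R \<tau>) (I0, J) =
        mapp m (Ract m R \<tau>) (mapp m (Ract m R (inv (g \<circ> \<tau>))) w) I * Ract m R (g \<circ> \<tau>) (I0, J)"
      by (simp only: Ract_compose[OF g \<tau>])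
  qed
  also have "\<dots> = (\<Sum>g\<in>perms m. mapp m (Ract m R \<tau>) (mapp m (Ract m R (inv g)) w) I * Ract m R g (I0, J))"
    by (rule sum_perms_right[OF \<tau>])
  also have "\<dots> = (\<Sum>g\<in>perms m. \<Sum>K\<in>tidx m. Ract m R \<tau> (I, K) * (mapp m (Ract m R (inv g)) w K * Ract m R g (I0, J)))"
    by (subst (1) mapp_def) (simp add: len sum_distrib_right mult.assoc)
  also have "\<dots> = mmul m (Ract m R \<tau>) (transfer_map w I0) (I, J)"
    unfolding transfer_map_def mmul_def prod.case sum_distrib_left by (rule sum.swap)
  finally show "mmul m (transfer_map w I0) (Ract m R \<tau>) (I, J) = mmul m (Ract m R \<tau>) (transfer_map w I0) (I, J)" .
qed (intro mmul_in_mats transfer_map_in_mats Ract_in_mats)+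

lemma transfer_map_in_HRm: "transfer_map w I0 \<in> HRm m R"
proof -
  have "mmul m (transfer_map w I0) (grep m R x) = mmul m (grep m R x) (transfer_map w I0)" for x
    by (rule ext) (simp add: mmul_grep_left mmul_grep_right mmul_transfer_map_Ract)
  then show ?thesis
    unfolding commutant_SRm[symmetric] commutant_def SRm_eq_grep using transfer_map_in_mats by blast
qed

lemma mapp_transfer_map:
  assumes "I0 \<in> tidx m" "w \<in> vecs m"
  shows "mapp m (transfer_map w I0) u = act (matrix_coeff I0 u) w"
proof
  fix I
  show "mapp m (transfer_map w I0) u I = act (matrix_coeff I0 u) w I"
  proof (cases "length I = m")
    case True
    have "mapp m (transfer_map w I0) u I = (\<Sum>J\<in>tidx m. transfer_map w I0 (I, J) * u J)"
      using True by (simp add: mapp_def)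
    also have "\<dots> = (\<Sum>g\<in>perms m. mapp m (Ract m R (inv g)) w I * (\<Sum>J\<in>tidx m. Ract m R g (I0, J) * u J))"
      unfolding transfer_map_def prod.case sum_distrib_left sum_distrib_right mult.assoc by (rule sum.swap)
    also have "\<dots> = (\<Sum>g\<in>perms m. mapp m (Ract m R (inv g)) w I * mapp m (Ract m R g) u I0)"
      using assms(1) by (simp add: mapp_def[of m "Ract m R _" u] tidx_def)
    also have "\<dots> = (\<Sum>g\<in>perms m. mapp m (Ract m R g) w I * mapp m (Ract m R (inv g)) u I0)"
      by (subst sum_perms_inv[symmetric]) (auto intro!: sum.cong simp: permutes_inv_inv)
    finally show ?thesis by (simp add: mapp_grep matrix_coeff_def mult.commute)
  qed (simp add: mapp_def)
qed

text \<open>Compute \<open>c y c w\<close> in two ways, with \<open>y\<close> the matrix coefficient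
  and h the transfer map. The trace gives \<open>c y c = n^2 u(I0) c\<close>, and c acts on
  \<open>w\<close> by n. On the other side, \<open>y w = h u\<close>, and h commutes with c, which
  acts on \<open>u\<close> by n. Cancelling n^2 leaves the formula.\<close>

lemma mapp_transfer_map_rhoH:
  assumes p: "is_partition m p" and u: "u \<in> rhoH m R p" and w: "w \<in> rhoH m R p" and I0: "I0 \<in> tidx m"
  shows "mapp m (transfer_map w I0) u = (\<lambda>I. young_norm m p * u I0 * w I)"
proof -
  let ?c = "young_sym m p :: _ \<Rightarrow> 'k" and ?n = "young_norm m p :: 'k" and ?y = "matrix_coeff I0 u" and ?H = "mapp m (transfer_map w I0)"
  have n: "?n \<noteq> 0" by (rule young_norm_nonzero[OF p])
  have "gmul m (gmul m ?c ?y) ?c id = gmul m ?c (gmul m ?c ?y) id" by (rule gmul_trace)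
  also have "\<dots> = ?n * gmul m ?c ?y id"
    by (simp only: young_sym_square[OF p] gmul_scale_left flip: gmul_assoc)
  \<comment> \<open>The inverses in \<open>matrix_coeff\<close> and in the convolution cancel, so
    this sum is the coordinate \<open>I0\<close> of \<open>c u\<close>, that is
    \<open>n u(I0)\<close>.\<close>
  also have "gmul m ?c ?y id = (\<Sum>\<pi>\<in>perms m. ?c \<pi> * mapp m (Ract m R \<pi>) u I0)"
    unfolding gmul_at_id matrix_coeff_def by (intro sum.cong) (auto simp: permutes_inv_inv)
  also have "\<dots> = ?n * u I0"
    using young_act_rhoH[OF p u] by (simp flip: mapp_grep)
  finally have id: "gmul m (gmul m ?c ?y) ?c id = ?n * (?n * u I0)" .
  have \<alpha>: "gmul m (gmul m ?c ?y) ?c = (\<lambda>\<sigma>. (?n * (?n * u I0)) * ?c \<sigma>)"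
    using young_sym_sandwich[OF p, of ?y] unfolding id .
  have "act (gmul m (gmul m ?c ?y) ?c) w = act ?c (act ?y (\<lambda>I. ?n * w I))"
    by (simp add: act_gmul young_act_rhoH[OF p w])
  also have "\<dots> = (\<lambda>I. ?n * act ?c (?H u) I)"
    by (simp add: mapp_scale mapp_transfer_map[OF I0 rhoH_vecs[OF w]])
  also have "act ?c (?H u) = ?H (\<lambda>I. ?n * u I)"
    unfolding HRm_act[OF transfer_map_in_HRm, symmetric] young_act_rhoH[OF p u] ..
  also have "\<dots> = (\<lambda>I. ?n * ?H u I)" by (rule mapp_scale)
  finally have eq: "(\<lambda>I. ?n * (?n * u I0) * (?n * w I)) = (\<lambda>I. ?n * (?n * ?H u I))"
    unfolding \<alpha> act_scale_left young_act_rhoH[OF p w] .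
  show ?thesis
  proof
    fix I
    have "(?n * ?n) * ?H u I = (?n * ?n) * (?n * u I0 * w I)"
      using fun_cong[OF eq, of I] by (simp only: mult_ac)
    then show "?H u I = ?n * u I0 * w I" using n by (simp only: mult_cancel_left) simp
  qed
qed

text \<open>With \<open>I0\<close> chosen so that \<open>u I0\<close> is nonzero, the transfer maps
  carry \<open>u\<close> to a nonzero multiple of any prescribed \<open>w\<close>.\<close>

lemma invariant_contains_rhoH:
  assumes p: "is_partition m p" and U: "ksubspace U" "invariant_under m (HRm m R) U"
    and u: "u \<in> U" "u \<in> rhoH m R p" "u \<noteq> (\<lambda>_. 0)"
  shows "rhoH m R p \<subseteq> U"
proof
  fix w assume w: "w \<in> rhoH m R p"
  obtain I0 where I0: "I0 \<in> tidx m" "u I0 \<noteq> 0" using vecs_nonzero[OF rhoH_vecs[OF u(2)] u(3)] .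
  define k where "k = young_norm m p * u I0"
  have "mapp m (transfer_map w I0) u \<in> U"
    using U(2) u(1) transfer_map_in_HRm by (simp add: invariant_under_def)
  then have "(\<lambda>I. inverse k * (k * w I)) \<in> U"
    unfolding mapp_transfer_map_rhoH[OF p u(2) w I0(1)] k_def by (rule ksubspace_scale[OF U(1)])
  moreover have "k \<noteq> 0" using I0 young_norm_nonzero[OF p] by (simp add: k_def)
  ultimately show "w \<in> U" by (simp flip: mult.assoc)
qed

lemma irreducible_rhoH:
  assumes p: "is_partition m p" and nz: "rhoH m R p \<noteq> {\<lambda>_. 0}"
  shows "irreducible_comodule m R (rhoH m R p)"
  unfolding irreducible_comodule_def
proof (intro conjI allI impI)
  fix U assume U: "subcomodule m R U \<and> U \<subseteq> rhoH m R p"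
  then have sub: "ksubspace U" by (simp add: subcomodule_def)
  show "U = {\<lambda>_. 0} \<or> U = rhoH m R p"
  proof (rule disjCI)
    assume "U \<noteq> rhoH m R p"
    show "U = {\<lambda>_. 0}"
    proof (rule ccontr)
      assume "U \<noteq> {\<lambda>_. 0}"
      then obtain u where "u \<in> U" "u \<noteq> (\<lambda>_. 0)" using ksubspace_nonzero[OF sub] by blast
      then have "rhoH m R p \<subseteq> U"
        using invariant_contains_rhoH[OF p sub subcomodule_invariant] U by blast
      then show False using U \<open>U \<noteq> rhoH m R p\<close> by blast
    qed
  qed
qed (use subcomodule_rhoH nz in auto)

lemma commutant_HRm: "commutant m (HRm m R) = SRm m R"
proof
  show "SRm m R \<subseteq> commutant m (HRm m R)"
    using SRm_in_mats unfolding commutant_SRm[symmetric] by (auto simp: commutant_def)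
  show "commutant m (HRm m R) \<subseteq> SRm m R"
  proof
    fix T assume T: "T \<in> commutant m (HRm m R)"
    have comm: "mapp m T (mapp m H v) = mapp m H (mapp m T v)" if "H \<in> HRm m R" for H v
    proof -
      have "mmul m T H = mmul m H T" using T that by (simp add: commutant_def)
      then show ?thesis by (simp flip: mapp_mmul)
    qed
    \<comment> \<open>The operator T composed with g c agrees with one element \<open>y\<close> of
      the group algebra, the same for all \<open>v\<close>.\<close>
    have "\<exists>y. \<forall>v\<in>vecs m. mapp m T (act (gmul m (gdelta g) (young_sym m p)) v) = act y v"
      if p: "is_partition m p" and g: "g \<in> perms m" for p g
    proof (cases "rhoH m R p = {\<lambda>_. 0}")
      case True
      then have "act (young_sym m p) v = (\<lambda>_. 0)" if "v \<in> vecs m" for v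
        using act_young_in_rhoH[OF that] by blast
      then show ?thesis by (intro exI[of _ "\<lambda>_. 0"]) (simp add: act_gmul mapp_zero act_zero_left)
    next
      case False
      then obtain u where u: "u \<in> rhoH m R p" "u \<noteq> (\<lambda>_. 0)" using ksubspace_nonzero[OF ksubspace_rhoH] by blast
      obtain I0 where I0: "I0 \<in> tidx m" "u I0 \<noteq> 0" using vecs_nonzero[OF rhoH_vecs[OF u(1)] u(2)] .
      define k where "k = young_norm m p * u I0"
      have k: "k \<noteq> 0" using I0 young_norm_nonzero[OF p] by (simp add: k_def)
      \<comment> \<open>The matrix coefficient of \<open>T g u\<close>: moving the transfer map past
        \<open>T\<close> and \<open>g\<close> lets it act on \<open>u\<close>, where it yields
        \<open>k w\<close>.\<close>
      define y where "y = matrix_coeff I0 (mapp m T (mapp m (Ract m R g) u))"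
      have "mapp m T (act (gmul m (gdelta g) (young_sym m p)) v) = act (gmul m (\<lambda>\<sigma>. inverse k * y \<sigma>) (young_sym m p)) v"
        if v: "v \<in> vecs m" for v
      proof -
        define w where "w = act (young_sym m p) v"
        have w: "w \<in> rhoH m R p" unfolding w_def by (rule act_young_in_rhoH[OF v])
        let ?H = "transfer_map w I0"
        have "act y w = mapp m ?H (mapp m T (mapp m (Ract m R g) u))"
          unfolding y_def by (rule mapp_transfer_map[OF I0(1) rhoH_vecs[OF w], symmetric])
        also have "\<dots> = mapp m T (mapp m (Ract m R g) (mapp m ?H u))"
          unfolding comm[OF transfer_map_in_HRm, symmetric] HRm_Ract[OF transfer_map_in_HRm g] ..
        also have "\<dots> = (\<lambda>I. k * mapp m T (mapp m (Ract m R g) w) I)"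
          unfolding mapp_transfer_map_rhoH[OF p u(1) w I0(1)] k_def[symmetric] by (simp only: mapp_scale)
        finally have "act (\<lambda>\<sigma>. inverse k * y \<sigma>) w = mapp m T (mapp m (Ract m R g) w)"
          unfolding act_scale_left using k by (simp add: fun_eq_iff)
        then show ?thesis by (simp add: act_gmul w_def grep_gdelta[OF g])
      qed
      then show ?thesis by blast
    qed
    then obtain Y where Y: "\<And>p g v. is_partition m p \<Longrightarrow> g \<in> perms m \<Longrightarrow> v \<in> vecs m \<Longrightarrow>
        mapp m T (act (gmul m (gdelta g) (young_sym m p)) v) = act (Y p g) v"
      by metis
    obtain A where A: "gdelta id = (\<lambda>\<sigma>. \<Sum>p\<in>{p. is_partition m p}. A p * (young_central m p \<sigma> :: 'k))"
      using id_eq_sum_young_central by blast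
    \<comment> \<open>Insert the expansion of the identity to the right of \<open>T\<close> and
      replace each \<open>T g c_p\<close> by \<open>Y p g\<close>; the factor \<open>inv g\<close>
      remains on the right.\<close>
    define X where "X = (\<lambda>\<sigma>. \<Sum>p\<in>{p. is_partition m p}. A p * (\<Sum>g\<in>perms m. gmul m (Y p g) (gdelta (inv g)) \<sigma>))"
    have "T = grep m R X"
    proof (rule mapp_eq_imp_mats_eq)
      fix v :: "'i list \<Rightarrow> 'k" assume v: "v \<in> vecs m"
      have "mapp m T v = mapp m T (act (gdelta id) v)" using v by (simp only: act_gdelta_id)
      also have "\<dots> = (\<lambda>I. \<Sum>p\<in>{p. is_partition m p}. A p * (\<Sum>g\<in>perms m.
          mapp m T (act (gmul m (gdelta g) (young_sym m p)) (act (gdelta (inv g)) v)) I))"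
        unfolding A young_central_def by (simp only: act_sum_left act_scale_left mapp_sum mapp_scale act_gmul)
      also have "\<dots> = (\<lambda>I. \<Sum>p\<in>{p. is_partition m p}. A p * (\<Sum>g\<in>perms m. act (Y p g) (act (gdelta (inv g)) v) I))"
        by (intro ext sum.cong refl arg_cong2[where f = "(*)"]) (simp add: Y mapp_in_vecs)
      also have "\<dots> = act X v"
        unfolding X_def by (simp only: act_sum_left act_scale_left act_gmul)
      finally show "mapp m T v = act X v" .
    qed (use T grep_in_mats in \<open>auto simp: commutant_def\<close>)
    then show "T \<in> SRm m R" using grep_in_SRm by simp
  qed
qed

end

context unitary_QYBE
begin

section \<open>The decomposition\<close>

text \<open>The linear extension of \<open>y \<otimes> w\<close> to \<open>y w\<close>. Defining it
  on all functions of a permutation and an index makes it independent of how an element is written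
  as a sum of tensors.\<close>

definition glue :: "((nat \<Rightarrow> nat) \<times> 'i list \<Rightarrow> 'k) \<Rightarrow> 'i list \<Rightarrow> 'k" where
  "glue F = (\<lambda>I. \<Sum>\<pi>\<in>perms m. mapp m (Ract m R \<pi>) (\<lambda>J. F (\<pi>, J)) I)"

definition decomp_map :: "(nat list \<times> (nat \<Rightarrow> nat) \<times> 'i list \<Rightarrow> 'k) \<Rightarrow> 'i list \<Rightarrow> 'k" where
  "decomp_map f = (\<lambda>I. \<Sum>p\<in>{p. is_partition m p}. glue (\<lambda>(\<pi>, J). f (p, \<pi>, J)) I)"

lemma glue_in_vecs: "glue F \<in> vecs m"
  by (simp add: glue_def vecs_def mapp_def)

lemma glue_linear: "glue (\<lambda>x. c * F x + G x) = (\<lambda>I. c * glue F I + glue G I)"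
  by (simp add: glue_def mapp_add mapp_scale sum.distrib sum_distrib_left)

lemma glue_zero: "glue (\<lambda>_. 0) = (\<lambda>_. 0)"
  by (simp add: glue_def mapp_zero)

lemma glue_add: "glue (\<lambda>x. F x + G x) = (\<lambda>I. glue F I + glue G I)"
  using glue_linear[of 1 F G] by simp

lemma glue_scale: "glue (\<lambda>x. c * F x) = (\<lambda>I. c * glue F I)"
  using glue_linear[of c F "\<lambda>_. 0"] by (simp add: glue_zero)

lemma glue_sum: "glue (\<lambda>x. \<Sum>i\<in>A. F i x) = (\<lambda>I. \<Sum>i\<in>A. glue (F i) I)"
  unfolding glue_def mapp_sum by (rule ext) (rule sum.swap)

lemma glue_tensor: "glue (\<lambda>(\<pi>, J). y \<pi> * w J) = act y w"
  by (simp add: glue_def mapp_scale mapp_grep fun_eq_iff)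

lemma decomp_map_in_vecs: "decomp_map f \<in> vecs m"
  using glue_in_vecs by (simp add: decomp_map_def vecs_def)

lemma decomp_map_klinear: "klinear_on D decomp_map"
  by (simp add: klinear_on_def decomp_map_def glue_def mapp_add mapp_scale sum.distrib sum_distrib_left)

lemma glue_shift:
  assumes \<sigma>: "\<sigma> \<in> perms m"
  shows "glue (\<lambda>(\<pi>, J). F (inv \<sigma> \<circ> \<pi>, J)) = mapp m (Ract m R \<sigma>) (glue F)"
proof
  fix I
  have "glue (\<lambda>(\<pi>, J). F (inv \<sigma> \<circ> \<pi>, J)) I =
      (\<Sum>\<pi>\<in>perms m. mapp m (Ract m R (\<sigma> \<circ> \<pi>)) (\<lambda>J. F (inv \<sigma> \<circ> (\<sigma> \<circ> \<pi>), J)) I)"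
    unfolding glue_def prod.case by (rule sum_perms_left[OF \<sigma>, symmetric])
  also have "\<dots> = (\<Sum>\<pi>\<in>perms m. mapp m (Ract m R \<sigma>) (mapp m (Ract m R \<pi>) (\<lambda>J. F (\<pi>, J))) I)"
    unfolding perms_inv_o_cancel(1)[OF \<sigma>] by (rule sum.cong[OF refl]) (simp only: Ract_compose[OF \<sigma>] mapp_mmul)
  also have "\<dots> = mapp m (Ract m R \<sigma>) (glue F) I"
    by (simp add: glue_def mapp_sum)
  finally show "glue (\<lambda>(\<pi>, J). F (inv \<sigma> \<circ> \<pi>, J)) I = mapp m (Ract m R \<sigma>) (glue F) I" .
qed

lemma decomp_map_sact:
  assumes \<sigma>: "\<sigma> \<in> perms m"
  shows "decomp_map (sact \<sigma> f) = mapp m (Ract m R \<sigma>) (decomp_map f)"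
  unfolding decomp_map_def mapp_sum
proof (intro ext sum.cong refl)
  fix I p
  show "glue (\<lambda>(\<pi>, J). sact \<sigma> f (p, \<pi>, J)) I = mapp m (Ract m R \<sigma>) (glue (\<lambda>(\<pi>, J). f (p, \<pi>, J))) I"
    using fun_cong[OF glue_shift[OF \<sigma>, of "\<lambda>(\<pi>, J). f (p, \<pi>, J)"], of I] by (simp add: sact_def)
qed

lemma decomp_map_hact:
  assumes h: "h \<in> HRm m R"
  shows "decomp_map (hact m h f) = mapp m h (decomp_map f)"
  unfolding decomp_map_def mapp_sum
proof (intro ext sum.cong refl)
  fix I p
  \<comment> \<open>\<open>hact\<close> carries no length guard; it agrees with \<open>mapp\<close>
    because \<open>h\<close> vanishes off length \<open>m\<close>.\<close>
  have "h \<in> mats m" using h unfolding commutant_SRm[symmetric] by (simp add: commutant_def)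
  then have "(\<lambda>J. hact m h f (p, \<pi>, J)) = mapp m h (\<lambda>J. f (p, \<pi>, J))" for \<pi>
    by (auto simp: hact_def mapp_def mats_def fun_eq_iff)
  then show "glue (\<lambda>(\<pi>, J). hact m h f (p, \<pi>, J)) I = mapp m h (glue (\<lambda>(\<pi>, J). f (p, \<pi>, J))) I"
    by (simp add: glue_def mapp_sum HRm_Ract[OF h])
qed

lemma gmul_young_in_specht: "x \<in> galg m \<Longrightarrow> gmul m x (young_sym m p) \<in> specht m p"
  by (auto simp: specht_def)

lemma young_sym_in_specht: "(young_sym m p :: _ \<Rightarrow> 'k) \<in> specht m p"
proof -
  have "gmul m (gdelta id) (young_sym m p) = (young_sym m p :: _ \<Rightarrow> 'k)"
    by (simp add: gmul_gdelta_left[OF perms_id])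
  then show ?thesis using gmul_young_in_specht[OF gdelta_in_galg[OF perms_id]] by metis
qed

abbreviation block :: "nat list \<Rightarrow> ((nat \<Rightarrow> nat) \<times> 'i list \<Rightarrow> 'k) set" where
  "block p \<equiv> ktensor (specht m p) (rhoH m R p)"

lemma block_induct [consumes 1, case_names zero step]:
  assumes "F \<in> block p"
    and "P (\<lambda>_. 0)"
    and "\<And>c y w F. \<lbrakk>y \<in> specht m p; w \<in> rhoH m R p; F \<in> block p; P F\<rbrakk>
      \<Longrightarrow> P (\<lambda>x. c * (case x of (\<pi>, I) \<Rightarrow> y \<pi> * w I) + F x)"
  shows "P F"
  using assms(1) unfolding ktensor_def
proof induction
  case (kspan_step s v c)
  then obtain y w where "s = (\<lambda>(\<pi>, I). y \<pi> * w I)" "y \<in> specht m p" "w \<in> rhoH m R p" by blast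
  then show ?case using assms(3)[of y w v c] kspan_step by (simp add: ktensor_def)
qed (rule assms(2))

lemma tensor_in_block: "y \<in> specht m p \<Longrightarrow> w \<in> rhoH m R p \<Longrightarrow> (\<lambda>(\<pi>, I). y \<pi> * w I) \<in> block p"
  unfolding ktensor_def by (rule kspan_base) blast

lemma ksubspace_block: "ksubspace (block p)"
  unfolding ktensor_def by (rule ksubspace_kspan)

lemma block_outside: "F \<in> block p \<Longrightarrow> \<pi> \<notin> perms m \<Longrightarrow> F (\<pi>, I) = 0"
proof (induction rule: block_induct)
  case (step c y w F)
  then have "y \<pi> = 0" using galgD[OF gmul_in_galg[OF young_sym_in_galg]] by (auto simp: specht_def)
  then show ?case using step by simp
qed simp

text \<open>Reads \<open>F\<close> back from \<open>glue F\<close>. On a tensor with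
  \<open>y = x c_p\<close> the operator is \<open>c_q (g^-1 x) c_p\<close>. For different shapes
  orthogonality kills it. For equal shapes the trace, used twice, gives the scalar
  \<open>n y(g)\<close>, and c acting on \<open>w\<close> supplies the second factor n.\<close>

lemma block_inversion:
  assumes p: "is_partition m p" and q: "is_partition m q" and g: "g \<in> perms m" and F: "F \<in> block p"
  shows "act (young_sym m q) (mapp m (Ract m R (inv g)) (glue F)) =
    (\<lambda>I. if p = q then (young_norm m p)\<^sup>2 * F (g, I) else 0)"
  using F
proof (induction rule: block_induct)
  case zero
  show ?case by (simp add: glue_zero mapp_zero)
next
  case (step c y w F)
  let ?d = "gdelta (inv g) :: _ \<Rightarrow> 'k" and ?c = "young_sym m p :: _ \<Rightarrow> 'k" and ?n = "young_norm m p :: 'k"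
  have w: "w \<in> rhoH m R p" by fact
  obtain x where x: "x \<in> galg m" "y = gmul m x ?c" using step.hyps(1) by (auto simp: specht_def)
  have dx: "gmul m ?d x \<in> galg m" by (rule gmul_in_galg[OF x(1)])
  have "act (young_sym m q) (mapp m (Ract m R (inv g)) (act y w)) =
      act (gmul m (gmul m (young_sym m q) (gmul m ?d x)) ?c) w"
    by (simp only: x(2) act_gmul act_gdelta[OF perms_inv[OF g]])
  also have "\<dots> = (\<lambda>I. if p = q then ?n\<^sup>2 * (y g * w I) else 0)"
  proof (cases "p = q")
    case False
    then show ?thesis
      using young_sym_orthogonal[OF q p _ dx] by (simp add: act_zero_left)
  next
    case True
    have "gmul m (gmul m ?c (gmul m ?d x)) ?c id = gmul m ?c (gmul m ?c (gmul m ?d x)) id" by (rule gmul_trace)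
    also have "\<dots> = ?n * gmul m ?c (gmul m ?d x) id"
      by (simp only: young_sym_square[OF p] gmul_scale_left flip: gmul_assoc)
    also have "gmul m ?c (gmul m ?d x) id = gmul m (gmul m ?d x) ?c id" by (rule gmul_trace)
    also have "\<dots> = y g"
      unfolding gmul_assoc x(2)[symmetric]
      unfolding gmul_gdelta_left[OF perms_inv[OF g]] perms_inv_inv[OF g] comp_id ..
    finally have id: "gmul m (gmul m ?c (gmul m ?d x)) ?c id = ?n * y g" .
    have "gmul m (gmul m ?c (gmul m ?d x)) ?c = (\<lambda>\<sigma>. ?n * y g * ?c \<sigma>)"
      using young_sym_sandwich[OF p, of "gmul m ?d x"] unfolding id .
    then show ?thesis
      unfolding True[symmetric] by (simp only: act_scale_left young_act_rhoH[OF p w]) (simp add: power2_eq_square mult_ac)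
  qed
  finally have base: "act (young_sym m q) (mapp m (Ract m R (inv g)) (act y w)) = \<dots>" .
  show ?case
    unfolding glue_linear glue_tensor mapp_add mapp_scale base step.IH by (auto simp: fun_eq_iff algebra_simps)
qed

lemma decomp_map_inversion:
  assumes f: "f \<in> dsum m R" and p: "is_partition m p" and g: "g \<in> perms m"
  shows "act (young_sym m p) (mapp m (Ract m R (inv g)) (decomp_map f)) = (\<lambda>I. (young_norm m p)\<^sup>2 * f (p, g, I))"
proof
  fix I
  have "act (young_sym m p) (mapp m (Ract m R (inv g)) (decomp_map f)) I =
      (\<Sum>q\<in>{q. is_partition m q}. act (young_sym m p) (mapp m (Ract m R (inv g)) (glue (\<lambda>(\<pi>, J). f (q, \<pi>, J)))) I)"
    by (simp add: decomp_map_def mapp_sum)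
  also have "\<dots> = (\<Sum>q\<in>{q. is_partition m q}. if q = p then (young_norm m p)\<^sup>2 * f (p, g, I) else 0)"
    using f by (intro sum.cong refl) (auto simp: block_inversion[OF _ p g] dsum_def)
  finally show "act (young_sym m p) (mapp m (Ract m R (inv g)) (decomp_map f)) I = (young_norm m p)\<^sup>2 * f (p, g, I)"
    using p by (simp add: finite_partitions)
qed

lemma inj_decomp_map: "inj_on decomp_map (dsum m R)"
proof (rule inj_onI)
  fix f f' assume f: "f \<in> dsum m R" and f': "f' \<in> dsum m R" and eq: "decomp_map f = decomp_map f'"
  have "f (p, g, I) = f' (p, g, I)" for p g I
  proof (cases "is_partition m p \<and> g \<in> perms m")
    case True
    then have "(\<lambda>I. (young_norm m p)\<^sup>2 * f (p, g, I)) = (\<lambda>I. (young_norm m p)\<^sup>2 * f' (p, g, I))"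
      using decomp_map_inversion[OF f] decomp_map_inversion[OF f'] eq by metis
    then have "(young_norm m p)\<^sup>2 * f (p, g, I) = (young_norm m p)\<^sup>2 * f' (p, g, I)" by (rule fun_cong)
    moreover have "(young_norm m p)\<^sup>2 \<noteq> (0 :: 'k)" using True by (simp add: young_norm_nonzero)
    ultimately show ?thesis by (simp only: mult_cancel_left) simp
  next
    case False
    then consider "\<not> is_partition m p" | "is_partition m p" "g \<notin> perms m" by blast
    then show ?thesis
    proof cases
      case 2
      then have "(\<lambda>(\<pi>, I). f (p, \<pi>, I)) \<in> block p" "(\<lambda>(\<pi>, I). f' (p, \<pi>, I)) \<in> block p"
        using f f' by (auto simp: dsum_def)
      from block_outside[OF this(1) 2(2), of I] block_outside[OF this(2) 2(2), of I] show ?thesis by simp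
    qed (use f f' in \<open>simp add: dsum_def\<close>)
  qed
  then show "f = f'" by (simp add: fun_eq_iff)
qed

lemma surj_decomp_map:
  assumes v: "v \<in> vecs m"
  shows "v \<in> decomp_map ` dsum m R"
proof -
  obtain A where A: "gdelta id = (\<lambda>\<sigma>. \<Sum>p\<in>{p. is_partition m p}. A p * (young_central m p \<sigma> :: 'k))"
    using id_eq_sum_young_central by blast
  define y where "y g p = (gmul m (gdelta g) (young_sym m p) :: _ \<Rightarrow> 'k)" for g p
  define w where "w g p = act (gmul m (young_sym m p) (gdelta (inv g))) v" for g p
  \<comment> \<open>The vector \<open>w g p\<close> carries its own c so that it lies in
    \<open>rhoH\<close>. Then \<open>y g p\<close> applied to it contains \<open>c c = n c\<close>,
    and the coefficient \<open>A p\<close> is divided by n to compensate.\<close>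
  define F where "F p = (\<lambda>x. A p / young_norm m p * (\<Sum>g\<in>perms m. (\<lambda>(\<pi>, I). y g p \<pi> * w g p I) x))" for p
  define f where "f = (\<lambda>(p, x). if is_partition m p then F p x else 0)"
  have w: "w g p \<in> rhoH m R p" for g p
    unfolding w_def act_gmul by (rule act_young_in_rhoH[OF mapp_in_vecs])
  have "F p \<in> block p" for p
    unfolding F_def using gmul_young_in_specht[OF gdelta_in_galg] w
    by (intro ksubspace_scale[OF ksubspace_block] ksubspace_sum[OF ksubspace_block] tensor_in_block) (auto simp: y_def)
  then have "f \<in> dsum m R" by (simp add: f_def dsum_def case_prod_eta)
  moreover have "decomp_map f = v"
  proof -
    have "glue (\<lambda>(\<pi>, J). f (p, \<pi>, J)) = (\<lambda>I. A p * act (young_central m p) v I)" if p: "is_partition m p" for p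
    proof -
      have *: "act (y g p) (w g p) = (\<lambda>I. young_norm m p * act (gmul m (gmul m (gdelta g) (young_sym m p)) (gdelta (inv g))) v I)" for g
        using young_act_rhoH[OF p w[of g p]] by (simp add: y_def act_gmul mapp_scale) (simp add: w_def act_gmul)
      have "glue (\<lambda>(\<pi>, J). f (p, \<pi>, J)) = glue (F p)"
        using p by (simp add: f_def case_prod_eta)
      also have "\<dots> = (\<lambda>I. A p / young_norm m p * (\<Sum>g\<in>perms m. act (y g p) (w g p) I))"
        unfolding F_def glue_scale glue_sum glue_tensor ..
      also have "\<dots> = (\<lambda>I. A p * act (young_central m p) v I)"
        unfolding young_central_def act_sum_left * sum_distrib_left[symmetric] using young_norm_nonzero[OF p, where 'k = 'k] by simp
      finally show ?thesis .
    qed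
    then have "decomp_map f = (\<lambda>I. \<Sum>p\<in>{p. is_partition m p}. A p * act (young_central m p) v I)"
      by (simp add: decomp_map_def)
    also have "\<dots> = act (gdelta id) v" unfolding A by (simp only: act_sum_left act_scale_left)
    finally show ?thesis by (simp only: act_gdelta_id[OF v])
  qed
  ultimately show ?thesis by blast
qed

lemma bij_decomp_map: "bij_betw decomp_map (dsum m R) (vecs m)"
  unfolding bij_betw_def using inj_decomp_map surj_decomp_map decomp_map_in_vecs by blast

lemma decomp_map_component:
  assumes p: "is_partition m p"
  shows "decomp_map ` dsum_comp m R p = glue ` block p"
proof
  have glue_eq: "decomp_map f = glue (\<lambda>(\<pi>, J). f (p, \<pi>, J))" if "\<And>q \<pi> I. q \<noteq> p \<Longrightarrow> f (q, \<pi>, I) = 0" for f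
  proof
    fix I
    have "decomp_map f I = (\<Sum>q\<in>{q. is_partition m q}. if q = p then glue (\<lambda>(\<pi>, J). f (p, \<pi>, J)) I else 0)"
      unfolding decomp_map_def
    proof (intro sum.cong refl)
      fix q
      have "(\<lambda>(\<pi>, J). f (q, \<pi>, J)) = (\<lambda>_. 0)" if "q \<noteq> p"
        using \<open>\<And>q \<pi> I. q \<noteq> p \<Longrightarrow> f (q, \<pi>, I) = 0\<close> that by auto
      then show "glue (\<lambda>(\<pi>, J). f (q, \<pi>, J)) I = (if q = p then glue (\<lambda>(\<pi>, J). f (p, \<pi>, J)) I else 0)"
        by (cases "q = p") (simp_all only: glue_zero if_False if_True simp_thms)
    qed
    then show "decomp_map f I = glue (\<lambda>(\<pi>, J). f (p, \<pi>, J)) I" using p by (simp add: finite_partitions)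
  qed
  show "decomp_map ` dsum_comp m R p \<subseteq> glue ` block p"
  proof
    fix u assume "u \<in> decomp_map ` dsum_comp m R p"
    then obtain f where f: "f \<in> dsum_comp m R p" "u = decomp_map f" by blast
    then have "u = glue (\<lambda>(\<pi>, J). f (p, \<pi>, J))" using glue_eq by (simp add: dsum_comp_def)
    moreover have "(\<lambda>(\<pi>, J). f (p, \<pi>, J)) \<in> block p" using f p by (simp add: dsum_comp_def dsum_def)
    ultimately show "u \<in> glue ` block p" by blast
  qed
  show "glue ` block p \<subseteq> decomp_map ` dsum_comp m R p"
  proof
    fix u assume "u \<in> glue ` block p"
    then obtain F where F: "F \<in> block p" "u = glue F" by blast
    define f where "f = (\<lambda>(q, x). if q = p then F x else 0)"
    have "(\<lambda>_. 0) \<in> block q" for q using ksubspace_block[of q] by (simp add: ksubspace_def)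
    then have "(\<lambda>(\<pi>, I). f (q, \<pi>, I)) \<in> block q" for q
      using F(1) by (cases "q = p") (simp_all add: f_def case_prod_unfold)
    then have "f \<in> dsum_comp m R p"
      using p by (auto simp: dsum_comp_def dsum_def f_def)
    moreover have "decomp_map f = u"
      using glue_eq[of f] F by (simp add: f_def case_prod_eta)
    ultimately show "u \<in> decomp_map ` dsum_comp m R p" by blast
  qed
qed

text \<open>\<open>B\<close> is arbitrary so that the lemma serves both for invariance of a block
  and, with \<open>B = mid m\<close>, for containment of a block in \<open>U\<close>.\<close>

lemma glue_block_in_subspace:
  assumes U: "ksubspace U" and yw: "\<And>y w. y \<in> specht m p \<Longrightarrow> w \<in> rhoH m R p \<Longrightarrow> mapp m B (act y w) \<in> U"
    and F: "F \<in> block p"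
  shows "mapp m B (glue F) \<in> U"
  using F
proof (induction rule: block_induct)
  case zero
  show ?case using U by (simp add: glue_zero mapp_zero ksubspace_def)
next
  case (step c y w F)
  then show ?case
    using U yw[of y w] by (simp only: glue_linear glue_tensor mapp_add mapp_scale) (simp add: ksubspace_def)
qed

lemma ksubspace_glue_block: "ksubspace (glue ` block p)"
  unfolding ksubspace_def
proof (intro conjI ballI allI)
  have "(\<lambda>_. 0) \<in> block p" using ksubspace_block[of p] by (simp add: ksubspace_def)
  then show "(\<lambda>_. 0) \<in> glue ` block p" using glue_zero by (metis image_eqI)
  show "(\<lambda>x. u x + v x) \<in> glue ` block p" if uv: "u \<in> glue ` block p" "v \<in> glue ` block p" for u v
  proof -
    obtain F G where FG: "u = glue F" "F \<in> block p" "v = glue G" "G \<in> block p" using uv by blast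
    then have "(\<lambda>x. F x + G x) \<in> block p" using ksubspace_block[of p] by (simp add: ksubspace_def)
    then show ?thesis unfolding FG(1,3) glue_add[symmetric] by (rule imageI)
  qed
  show "(\<lambda>x. c * u x) \<in> glue ` block p" if u: "u \<in> glue ` block p" for c u
  proof -
    obtain F where F: "u = glue F" "F \<in> block p" using u by blast
    show ?thesis unfolding F(1) glue_scale[symmetric] by (rule imageI, rule ksubspace_scale[OF ksubspace_block F(2)])
  qed
qed

lemma act_in_glue_block: "y \<in> specht m p \<Longrightarrow> w \<in> rhoH m R p \<Longrightarrow> act y w \<in> glue ` block p"
  unfolding glue_tensor[symmetric] by (intro imageI tensor_in_block)

lemma glue_block_invariant: "invariant_under m (SRm m R \<union> HRm m R) (glue ` block p)"
  unfolding invariant_under_def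
proof (intro ballI)
  fix B u assume B: "B \<in> SRm m R \<union> HRm m R" and "u \<in> glue ` block p"
  then obtain F where F: "F \<in> block p" "u = glue F" by blast
  have "mapp m B (act y w) \<in> glue ` block p" if y: "y \<in> specht m p" and w: "w \<in> rhoH m R p" for y w
  proof (cases "B \<in> HRm m R")
    case True
    show ?thesis unfolding HRm_act[OF True] by (rule act_in_glue_block[OF y HRm_rhoH[OF True w]])
  next
    case False
    then obtain x where x: "B = grep m R x" using B SRm_eq_grep by auto
    obtain x' where "x' \<in> galg m" "y = gmul m x' (young_sym m p)" using y by (auto simp: specht_def)
    then have "gmul m x y \<in> specht m p"
      using gmul_young_in_specht[OF gmul_in_galg, of x' x p] by (simp add: gmul_assoc)
    then show ?thesis unfolding x act_gmul[symmetric] by (rule act_in_glue_block[OF _ w])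
  qed
  then show "mapp m B u \<in> glue ` block p"
    unfolding F(2) by (rule glue_block_in_subspace[OF ksubspace_glue_block _ F(1)])
qed

text \<open>From a nonzero \<open>u = glue F\<close> in \<open>U\<close>, choose \<open>g\<close>
  with \<open>F (g, I)\<close> nonzero. Then \<open>c g^-1 u\<close> is n^2 times the slice of
  \<open>F\<close> at \<open>g\<close>, a nonzero vector of \<open>rhoH\<close> in \<open>U\<close>.
  The HR_m action fills \<open>rhoH\<close> from it, and the SR_m action fills the block.\<close>

lemma irreducible_glue_block:
  assumes p: "is_partition m p" and nz: "rhoH m R p \<noteq> {\<lambda>_. 0}"
  shows "irreducible_SH m R (glue ` block p)"
  unfolding irreducible_SH_def
proof (intro conjI allI impI)
  show "ksubspace (glue ` block p)" by (rule ksubspace_glue_block)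
  show "invariant_under m (SRm m R \<union> HRm m R) (glue ` block p)" by (rule glue_block_invariant)
  obtain w where w: "w \<in> rhoH m R p" "w \<noteq> (\<lambda>_. 0)" using ksubspace_nonzero[OF ksubspace_rhoH nz] .
  have "act (young_sym m p) w \<noteq> (\<lambda>_. 0)"
    using w young_norm_nonzero[OF p, where 'k = 'k] by (auto simp: young_act_rhoH[OF p] fun_eq_iff)
  then show "glue ` block p \<noteq> {\<lambda>_. 0}" using act_in_glue_block[OF young_sym_in_specht w(1)] by blast
  fix U assume U: "ksubspace U \<and> U \<subseteq> glue ` block p \<and> invariant_under m (SRm m R \<union> HRm m R) U"
  then have inv: "mapp m B u \<in> U" if "B \<in> SRm m R \<union> HRm m R" "u \<in> U" for B u
    using that by (simp add: invariant_under_def)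
  show "U = {\<lambda>_. 0} \<or> U = glue ` block p"
  proof (cases "U = {\<lambda>_. 0}")
    case False
    then obtain u where u: "u \<in> U" "u \<noteq> (\<lambda>_. 0)" using U ksubspace_nonzero by blast
    then obtain F where F: "F \<in> block p" "u = glue F" using U by blast
    obtain g I where gI: "F (g, I) \<noteq> 0"
      using u(2) glue_zero unfolding F(2) by (metis ext surj_pair)
    then have g: "g \<in> perms m" using block_outside[OF F(1)] by blast
    let ?u = "act (young_sym m p) (mapp m (Ract m R (inv g)) u)"
    have "?u = (\<lambda>I. (young_norm m p)\<^sup>2 * F (g, I))"
      unfolding F(2) using block_inversion[OF p p g F(1)] by simp
    then have "?u I \<noteq> 0" using gI young_norm_nonzero[OF p] by simp
    then have "?u \<noteq> (\<lambda>_. 0)" by auto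
    moreover have "?u \<in> U"
      using u(1) grep_in_SRm Ract_in_SRm[OF perms_inv[OF g]] by (intro inv) auto
    moreover have "?u \<in> rhoH m R p" by (rule act_young_in_rhoH[OF mapp_in_vecs])
    moreover have "invariant_under m (HRm m R) U" using inv by (simp add: invariant_under_def)
    ultimately have rho: "rhoH m R p \<subseteq> U" using invariant_contains_rhoH[OF p] U by blast
    have "mapp m (mid m) (glue G) \<in> U" if "G \<in> block p" for G
    proof (rule glue_block_in_subspace[OF _ _ that])
      show "ksubspace U" using U by blast
      show "mapp m (mid m) (act y w) \<in> U" if "w \<in> rhoH m R p" for y w
        unfolding mapp_mid[OF mapp_in_vecs] using rho that grep_in_SRm by (intro inv) auto
    qed
    then have "glue ` block p \<subseteq> U" by (auto simp only: mapp_mid[OF glue_in_vecs])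
    then show ?thesis using U by blast
  qed blast
qed

text \<open>The symmetrizer c_p separates the blocks: it acts as the nonzero scalar n on some
  nonzero vector of block \<open>p\<close>, and by inversion at \<open>g = id\<close> it annihilates
  block \<open>q\<close>.\<close>

lemma glue_blocks_not_isomorphic:
  assumes p: "is_partition m p" and q: "is_partition m q" and "p \<noteq> q" and nz: "rhoH m R p \<noteq> {\<lambda>_. 0}"
  shows "\<not> iso_SH m R (glue ` block p) (glue ` block q)"
proof
  assume "iso_SH m R (glue ` block p) (glue ` block q)"
  then obtain T where bij: "bij_betw T (glue ` block p) (glue ` block q)" and lin: "klinear_on (glue ` block p) T"
    and eqv: "\<And>A w. A \<in> SRm m R \<union> HRm m R \<Longrightarrow> w \<in> glue ` block p \<Longrightarrow> T (mapp m A w) = mapp m A (T w)"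
    unfolding iso_SH_def by blast
  let ?c = "young_sym m p :: _ \<Rightarrow> 'k" and ?n = "young_norm m p :: 'k"
  have n: "?n \<noteq> 0" by (rule young_norm_nonzero[OF p])
  have scale: "T (\<lambda>x. c * w x) = (\<lambda>y. c * T w y)" if "w \<in> glue ` block p" for c w
    using lin that unfolding klinear_on_def by blast
  obtain w0 where w0: "w0 \<in> rhoH m R p" "w0 \<noteq> (\<lambda>_. 0)" using ksubspace_nonzero[OF ksubspace_rhoH nz] .
  define w where "w = act ?c w0"
  have w: "w \<in> glue ` block p" unfolding w_def by (rule act_in_glue_block[OF young_sym_in_specht w0(1)])
  have cw: "act ?c w = (\<lambda>I. ?n * w I)"
    unfolding w_def by (rule young_act_rhoH[OF p act_young_in_rhoH[OF rhoH_vecs[OF w0(1)]]])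
  have "T w \<in> glue ` block q" using bij w by (metis bij_betw_def imageI)
  then obtain G where G: "G \<in> block q" "T w = glue G" by blast
  have "act ?c (T w) = act ?c (mapp m (Ract m R (inv id)) (glue G))"
    unfolding G(2) by (simp only: inv_id Ract_id mapp_mid[OF glue_in_vecs])
  also have "\<dots> = (\<lambda>_. 0)"
    using block_inversion[OF q p perms_id G(1)] \<open>p \<noteq> q\<close> by simp
  finally have "(\<lambda>I. ?n * T w I) = (\<lambda>_. 0)"
    using eqv[of "grep m R ?c" w] grep_in_SRm w cw scale[OF w] by simp
  then have "T w = (\<lambda>_. 0)" using n by (simp add: fun_eq_iff)
  also have "\<dots> = T (\<lambda>_. 0)" using scale[OF w, of 0] by simp
  finally have "T w = T (\<lambda>_. 0)" .
  moreover have "(\<lambda>_. 0) \<in> glue ` block p" using ksubspace_glue_block[of p] unfolding ksubspace_def by blast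
  ultimately have "w = (\<lambda>_. 0)" using bij_betw_imp_inj_on[OF bij] w by (metis inj_onD)
  then have "(\<lambda>I. ?n * w0 I) = (\<lambda>_. 0)" by (simp only: w_def young_act_rhoH[OF p w0(1)])
  then have "?n * w0 I = 0" for I by (rule fun_cong)
  then show False using n w0(2) by (auto simp: fun_eq_iff)
qed

end

theorem theoremA5:
  fixes R :: "('i::finite \<times> 'i) \<times> ('i \<times> 'i) \<Rightarrow> 'k::field_char_0" and m :: nat
  assumes "unitary_R R" and "QYBE R"
  shows "commutant m (SRm m R) = HRm m R
    \<and> commutant m (HRm m R) = SRm m R
    \<and> (\<forall>p. is_partition m p \<longrightarrow> subcomodule m R (rhoH m R p))
    \<and> (\<forall>p. is_partition m p \<and> rhoH m R p \<noteq> {\<lambda>_. 0} \<longrightarrow> irreducible_comodule m R (rhoH m R p))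
    \<and> (\<exists>\<Phi>. bij_betw \<Phi> (dsum m R) (vecs m) \<and> klinear_on (dsum m R) \<Phi>
         \<and> (\<forall>\<sigma> f. \<sigma> permutes {..<m} \<and> f \<in> dsum m R \<longrightarrow> \<Phi> (sact \<sigma> f) = mapp m (Ract m R \<sigma>) (\<Phi> f))
         \<and> (\<forall>h f. h \<in> HRm m R \<and> f \<in> dsum m R \<longrightarrow> \<Phi> (hact m h f) = mapp m h (\<Phi> f))
         \<and> (\<forall>p. is_partition m p \<and> rhoH m R p \<noteq> {\<lambda>_. 0} \<longrightarrow> irreducible_SH m R (\<Phi> ` dsum_comp m R p))
         \<and> (\<forall>p q. is_partition m p \<and> is_partition m q \<and> p \<noteq> q \<and> rhoH m R p \<noteq> {\<lambda>_. 0} \<and> rhoH m R q \<noteq> {\<lambda>_. 0}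
              \<longrightarrow> \<not> iso_SH m R (\<Phi> ` dsum_comp m R p) (\<Phi> ` dsum_comp m R q)))"
proof -
  interpret unitary_QYBE R m using assms by unfold_locales
  show ?thesis
  proof (intro conjI allI impI exI[of _ decomp_map])
    fix p assume "is_partition m p \<and> rhoH m R p \<noteq> {\<lambda>_. 0}"
    then show "irreducible_SH m R (decomp_map ` dsum_comp m R p)"
      using irreducible_glue_block decomp_map_component by simp
  next
    fix p q
    assume "is_partition m p \<and> is_partition m q \<and> p \<noteq> q \<and> rhoH m R p \<noteq> {\<lambda>_. 0} \<and> rhoH m R q \<noteq> {\<lambda>_. 0}"
    then show "\<not> iso_SH m R (decomp_map ` dsum_comp m R p) (decomp_map ` dsum_comp m R q)"
      using glue_blocks_not_isomorphic decomp_map_component by simp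
  qed (simp_all add: commutant_SRm commutant_HRm subcomodule_rhoH irreducible_rhoH bij_decomp_map decomp_map_klinear
      decomp_map_sact decomp_map_hact)
qed

end
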